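(* For infinitely many $n$ there is an $n$-vertex graph $G$ which is $f$-non-expanding with $$f(x)=\frac{1}{\log x}\cdot(70\log\log x)^2,$$ such that every $(\tfrac12,q)$-local sparse spanning graph algorithm for the family of graphs isomorphic to $G$ satisfies $q\ge \log\log(n)/8000$.
   Context: All logarithms are base $2$. For a graph $H$ and $S\subseteq V(H)$, $\partial_H(S)$ denotes the set of edges with exactly one endpoint in $S$, and $\phi_H=\min_S|\partial_H(S)|/|S|$ over $S\subseteq V(H)$ with $1\le|S|\le|V(H)|/2$. A graph is $f$-non-expanding if every subgraph $H$ on $t>2$ vertices satisfies $\phi_H\le f(t)$. Input model: the algorithm receives integers $n,d\ge1$ and oracle access to the incidence-list representation of a graph $G=(V,E)$ with vertex set (ids) $\{1,\dots,n\}$ and maximum degree at most $d$: each vertex has an ordered list of its neighbours, and a query $(v,i)$ returns the $i$-th neighbour of $v$ or an indication that $v$ has fewer than $i$ neighbours. The family of graphs isomorphic to $G$ consists of all relabelings of $G$ on vertex set $\{1,\dots,n\}$, with arbitrary orderings of the incidence lists. An algorithm $\mathcal{A}$ (possibly randomized) is an $(\varepsilon,q)$-local sparse spanning graph algorithm for a family $\mathcal{C}$ if, given $n,d$ and oracle access to a connected $n$-vertex graph $G=(V,E)\in\mathcal{C}$ of maximum degree at most $d$, it provides query access to a subgraph $G'=(V,E')$ of $G$ (on input an edge $(u,v)\in E$ it answers whether $(u,v)\in E'$, answers to any sequence of queries being consistent with the same $G'$) such that: (i) $G'$ is connected; (ii) $|E'|<(1+\varepsilon)n$ with probability at least $2/3$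 over the internal randomness of $\mathcal{A}$; (iii) $E'$ is determined by $G$ and the internal randomness of $\mathcal{A}$; (iv) $\mathcal{A}$ makes at most $q$ queries to $G$ (per queried edge). *)

theory Defs
  imports "HOL-Probability.Probability_Measure"
begin

section \<open>Graphs and expansion\<close>

type_synonym 'v ugraph = "'v set \<times> 'v set set"

abbreviation verts :: "'v ugraph \<Rightarrow> 'v set" where "verts \<equiv> fst"
abbreviation edges :: "'v ugraph \<Rightarrow> 'v set set" where "edges \<equiv> snd"

definition simple_graph :: "'v ugraph \<Rightarrow> bool" where
  "simple_graph G \<longleftrightarrow> finite (verts G) \<and> (\<forall>e\<in>edges G. e \<subseteq> verts G \<and> card e = 2)"

(* Arbitrary, not necessarily induced, subgraphs. *)
definition is_subgraph :: "'v ugraph \<Rightarrow> 'v ugraph \<Rightarrow> bool" where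
  "is_subgraph H G \<longleftrightarrow> simple_graph H \<and> verts H \<subseteq> verts G \<and> edges H \<subseteq> edges G"

definition graph_connected :: "'v ugraph \<Rightarrow> bool" where
  "graph_connected G \<longleftrightarrow>
     (\<forall>u\<in>verts G. \<forall>v\<in>verts G. (u, v) \<in> {(x, y). {x, y} \<in> edges G}\<^sup>*)"

definition vdegree :: "'v ugraph \<Rightarrow> 'v \<Rightarrow> nat" where
  "vdegree G v = card {e \<in> edges G. v \<in> e}"

definition edge_boundary :: "'v ugraph \<Rightarrow> 'v set \<Rightarrow> 'v set set" where
  "edge_boundary H S = {e \<in> edges H. card (e \<inter> S) = 1}"

(* Only meaningful for graphs with at least two vertices; otherwise no admissible S exists. *)
definition expansion :: "'v ugraph \<Rightarrow> real" where
  "expansion H = Min {real (card (edge_boundary H S)) / real (card S) | S.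
     S \<subseteq> verts H \<and> 1 \<le> card S \<and> real (card S) \<le> real (card (verts H)) / 2}"

definition non_expanding :: "(real \<Rightarrow> real) \<Rightarrow> 'v ugraph \<Rightarrow> bool" where
  "non_expanding f G \<longleftrightarrow>
     (\<forall>H. is_subgraph H G \<and> card (verts H) > 2 \<longrightarrow> expansion H \<le> f (real (card (verts H))))"

section \<open>Incidence-list queries\<close>

type_synonym incidence_lists = "nat \<Rightarrow> nat list"

definition represents :: "incidence_lists \<Rightarrow> nat ugraph \<Rightarrow> bool" where
  "represents L G \<longleftrightarrow>
     (\<forall>v\<in>verts G. distinct (L v) \<and> set (L v) = {u. {v, u} \<in> edges G})"

(* Positions are counted from 1.  Ill-formed queries (v not a vertex, or i = 0) also
   return None; their answers carry no information. *)
definition neighbour_query :: "nat ugraph \<Rightarrow> incidence_lists \<Rightarrow> nat \<Rightarrow> nat \<Rightarrow> nat option" where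
  "neighbour_query G L v i =
     (if v \<in> verts G \<and> 1 \<le> i \<and> i \<le> length (L v) then Some (L v ! (i - 1)) else None)"

definition isomorphic_family :: "nat ugraph \<Rightarrow> (nat ugraph \<times> incidence_lists) set" where
  "isomorphic_family G = {(H, L).
     (\<exists>\<pi>. bij_betw \<pi> (verts G) {1..card (verts G)} \<and>
          H = ({1..card (verts G)}, (\<lambda>e. \<pi> ` e) ` edges G)) \<and>
     represents L H}"

section \<open>Local algorithms\<close>

(* The computation on one queried edge, with the random seed fixed, is an adaptive
   decision tree: Probe v i k asks the query (v, i) and continues with k applied to
   the reply. *)
datatype computation =
    Answer bool
  | Probe nat nat "nat option \<Rightarrow> computation"

primrec result :: "(nat \<Rightarrow> nat \<Rightarrow> nat option) \<Rightarrow> computation \<Rightarrow> bool" where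
  "result ask (Answer b) = b"
| "result ask (Probe v i k) = result ask (k (ask v i))"

primrec replies :: "(nat \<Rightarrow> nat \<Rightarrow> nat option) \<Rightarrow> computation \<Rightarrow> nat option list" where
  "replies ask (Answer b) = []"
| "replies ask (Probe v i k) = ask v i # replies ask (k (ask v i))"

(* What an algorithm may remember from earlier edge queries: the queried (ordered)
   edges and the query replies received while answering them. *)
type_synonym history = "((nat \<times> nat) \<times> nat option list) list"

(* Arguments: n, d, random seed, history, queried edge (u, v).  There is no computability
   or uniformity requirement.  The distribution of the seed is a separate parameter M of
   local_sparse_spanning_alg, an arbitrary probability measure on infinite bit strings. *)
type_synonym local_alg =
  "nat \<Rightarrow> nat \<Rightarrow> (nat \<Rightarrow> bool) \<Rightarrow> history \<Rightarrow> nat \<times> nat \<Rightarrow> computation"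

definition history_after ::
  "(nat \<Rightarrow> nat \<Rightarrow> nat option) \<Rightarrow> (history \<Rightarrow> nat \<times> nat \<Rightarrow> computation) \<Rightarrow>
   (nat \<times> nat) list \<Rightarrow> history" where
  "history_after ask B es = foldl (\<lambda>h e. h @ [(e, replies ask (B h e))]) [] es"

(* B provides query access to the edge set F: whatever edges es were queried before, the
   answer for an edge (u, v) is whether it belongs to F, found with at most q graph
   queries. *)
definition provides_access ::
  "nat \<Rightarrow> nat ugraph \<Rightarrow> incidence_lists \<Rightarrow> (history \<Rightarrow> nat \<times> nat \<Rightarrow> computation) \<Rightarrow>
   nat set set \<Rightarrow> bool" where
  "provides_access q G L B F \<longleftrightarrow>
     (\<forall>es u v. (\<forall>(x, y)\<in>set es. {x, y} \<in> edges G) \<and> {u, v} \<in> edges G \<longrightarrow>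
        (let c = B (history_after (neighbour_query G L) B es) (u, v) in
          (result (neighbour_query G L) c \<longleftrightarrow> {u, v} \<in> F) \<and>
          length (replies (neighbour_query G L) c) \<le> q))"

(* E' depends only on the input (G, L) and the seed, and not on the edges queried so far.
   A non-measurable event has measure 0 in HOL, so the last line also forces the event to
   be measurable. *)
definition local_sparse_spanning_alg ::
  "real \<Rightarrow> nat \<Rightarrow> (nat ugraph \<times> incidence_lists) set \<Rightarrow>
   (nat \<Rightarrow> bool) measure \<Rightarrow> local_alg \<Rightarrow> bool" where
  "local_sparse_spanning_alg \<epsilon> q C M A \<longleftrightarrow>
     prob_space M \<and>
     (\<forall>n\<ge>1. \<forall>d\<ge>1. \<forall>(G, L)\<in>C.
        simple_graph G \<and> verts G = {1..n} \<and> represents L G \<and> graph_connected G \<and>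
        (\<forall>v\<in>verts G. vdegree G v \<le> d) \<longrightarrow>
        (\<exists>E'. (\<forall>\<omega>\<in>space M.
                 E' \<omega> \<subseteq> edges G \<and>
                 provides_access q G L (A n d \<omega>) (E' \<omega>) \<and>
                 graph_connected (verts G, E' \<omega>)) \<and>
              measure M {\<omega>\<in>space M. real (card (E' \<omega>)) < (1 + \<epsilon>) * real n} \<ge> 2 / 3))"

end

theory Submission
  imports Defs
begin

text \<open>
  Take a graph \<open>R = (V, E)\<close> of average degree at least 4, maximum degree 8 and girth \<open>g\<close> of order
  \<open>log \<bar>V\<bar>\<close>, and let \<open>C\<close> be its mod 2 homology cover: a vertex is a vertex of \<open>R\<close> together with a set of
  edges of \<open>R\<close>, and crossing an edge \<open>e\<close> flips the membership of \<open>e\<close> in this set. So \<open>C\<close> sits in a cube of dimension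
  \<open>\<bar>E\<bar>\<close>, and \<open>log log \<bar>C\<bar>\<close> is of order \<open>g\<close>.

  Every subgraph of \<open>C\<close> on \<open>t\<close> vertices has expansion \<open>O(1 / log t)\<close>. Otherwise no coordinate cut is sparse, and
  summing over the coordinates shows that the vertices differ from the coordinatewise majority in
  \<open>o(log t)\<close> coordinates on average. But two edge sets over vertices of \<open>R\<close> differ by a path plus
  cycles, each of length at least \<open>g\<close>, so the number of vertices within \<open>k\<close> flips of a given one is only
  exponential in \<open>k\<close>.

  The hard graph is a chain of copies of \<open>C\<close>. For every edge \<open>i\<close> of \<open>R\<close> one copy loses all lifts of \<open>i\<close> but one, which
  thereby becomes a bridge and must be kept by the algorithm. A deck transformation combined with a swap of two
  copies takes this bridge to any other lift of \<open>i\<close>, and under a random labelling the two edges can only be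
  told apart by probing close to the few irregular vertices. Hence almost all edges are kept.
\<close>

section \<open>Even edge sets and joins\<close>

text \<open>Average degree 4 defeats sparsity: the copies carry at least \<open>2 n\<close> edges,
  more than the \<open>3/2 n\<close> that an output may keep, so almost all edges cannot be kept.
  The label sets over a vertex \<open>v\<close> are restricted to those with odd vertices
  \<open>a\<close> and \<open>v\<close>, which makes a copy connected. The base graph has no cut
  with fewer than two edges. Hence, once the lifts of \<open>i\<close> are deleted, each of the two
  sides, \<open>i\<close> present or \<open>i\<close> absent, is governed by a connected base graph
  without \<open>i\<close> and stays connected, and the surviving lift is all that joins them. This
  bridge has to look ordinary to \<open>q\<close> probes. It is placed at a label set with more than
  \<open>q + 1\<close> elements, away from the connectors between copies, which sit at the empty
  label set; the girth keeps the deleted lifts away. Neighbourhoods of irregular vertices grow like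
  \<open>256 ^ q\<close>, which has to stay far below both the size of a fibre and the number of
  copies per base edge. Random seeds are handled by averaging, which yields one seed that is sparse
  on two thirds of the labellings; memory is handled by asking every edge with an empty history,
  since the output set may not depend on earlier queries.\<close>

lemma odd_card_sym_diff:
  assumes "finite A" "finite B"
  shows "odd (card (sym_diff A B)) \<longleftrightarrow> odd (card A) \<noteq> odd (card B)"
proof -
  have "card (sym_diff A B) = card (A - B) + card (B - A)"
    by (rule card_Un_disjoint) (use assms in auto)
  moreover have "card A = card (A - B) + card (A \<inter> B)"
    using card_Un_disjoint[of "A - B" "A \<inter> B"] assms
    by (metis Diff_Int_distrib2 Un_Diff_Int finite_Diff finite_Int inf_commute Diff_disjoint inf_assoc Int_Diff_disjoint)
  moreover have "card B = card (B - A) + card (A \<inter> B)"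
    using card_Un_disjoint[of "B - A" "A \<inter> B"] assms
    by (metis Un_Diff_Int finite_Diff finite_Int inf_commute Int_Diff_disjoint)
  ultimately show ?thesis by presburger
qed

text \<open>The boundary map modulo 2; the sets that it sends to the empty set form the cycle
  space.\<close>

definition odd_verts :: "'a set set \<Rightarrow> 'a set" where
  "odd_verts w = {v. odd (card {e \<in> w. v \<in> e})}"

lemma odd_verts_empty [simp]: "odd_verts {} = {}"
  by (simp add: odd_verts_def)

lemma odd_verts_single [simp]: "odd_verts {e} = e"
proof -
  have "{e' \<in> {e}. v \<in> e'} = (if v \<in> e then {e} else {})" for v by auto
  then show ?thesis by (auto simp: odd_verts_def split: if_splits)
qed

lemma odd_verts_sym_diff:
  assumes "finite w" "finite w'"
  shows "odd_verts (sym_diff w w') = sym_diff (odd_verts w) (odd_verts w')"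
proof -
  have "{e \<in> sym_diff w w'. v \<in> e} = sym_diff {e \<in> w. v \<in> e} {e \<in> w'. v \<in> e}" for v by auto
  then have "odd (card {e \<in> sym_diff w w'. v \<in> e}) \<longleftrightarrow>
      odd (card {e \<in> w. v \<in> e}) \<noteq> odd (card {e \<in> w'. v \<in> e})" for v
    using odd_card_sym_diff[of "{e \<in> w. v \<in> e}" "{e \<in> w'. v \<in> e}"] assms by simp
  then show ?thesis by (auto simp: odd_verts_def)
qed

lemma odd_verts_Diff:
  assumes "finite w" "C \<subseteq> w"
  shows "odd_verts (w - C) = sym_diff (odd_verts w) (odd_verts C)"
proof -
  have "w - C = sym_diff w C" using assms by auto
  then show ?thesis using odd_verts_sym_diff[of w C] assms finite_subset by metis
qed

lemma odd_verts_memD: "v \<in> odd_verts w \<Longrightarrow> \<exists>e\<in>w. v \<in> e"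
  by (auto simp: odd_verts_def) (metis (mono_tags, lifting) card.empty empty_Collect_eq even_zero)

section \<open>Walks, and trails inside edge sets with prescribed odd vertices\<close>

definition nbrs :: "'a set set \<Rightarrow> 'a \<Rightarrow> 'a set" where
  "nbrs E v = {u. {v, u} \<in> E}"

text \<open>Only the edge set and the end of a walk with \<open>l\<close> steps are recorded. A
  trail shows as a pair \<open>(C, v)\<close> occurring at length \<open>card C\<close>, that is, no
  edge is repeated.\<close>

primrec walk_sets :: "'a set set \<Rightarrow> nat \<Rightarrow> 'a \<Rightarrow> ('a set set \<times> 'a) set" where
  "walk_sets E 0 u = {({}, u)}"
| "walk_sets E (Suc l) u = (\<Union>u'\<in>nbrs E u. (\<lambda>(C, v). (insert {u, u'} C, v)) ` walk_sets E l u')"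

lemma card_walk_sets:
  assumes "\<And>v. finite (nbrs E v) \<and> card (nbrs E v) \<le> d"
  shows "finite (walk_sets E l u) \<and> card (walk_sets E l u) \<le> d ^ l"
proof (induction l arbitrary: u)
  case (Suc l)
  have "card (walk_sets E (Suc l) u) \<le> (\<Sum>u'\<in>nbrs E u. card ((\<lambda>(C, v). (insert {u, u'} C, v)) ` walk_sets E l u'))"
    using assms by (simp add: card_UN_le)
  also have "\<dots> \<le> (\<Sum>u'\<in>nbrs E u. d ^ l)"
    by (rule sum_mono) (meson Suc card_image_le le_trans)
  also have "\<dots> \<le> d ^ Suc l" using assms[of u] by simp
  finally show ?case using Suc assms by simp
qed simp

lemma walk_sets_mono: "E \<subseteq> E' \<Longrightarrow> walk_sets E l u \<subseteq> walk_sets E' l u"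
proof (induction l arbitrary: u)
  case (Suc l)
  have "nbrs E u \<subseteq> nbrs E' u" using Suc.prems by (auto simp: nbrs_def)
  then show ?case using Suc by fastforce
qed simp

lemma edge_at_odd:
  assumes "u \<in> odd_verts w" "\<forall>e\<in>w. card e = 2"
  obtains u' where "{u, u'} \<in> w" "u' \<noteq> u"
proof -
  obtain e where e: "e \<in> w" "u \<in> e" using odd_verts_memD assms by metis
  then obtain a b where ab: "e = {a, b}" "a \<noteq> b" using assms(2) card_2_iff by metis
  show ?thesis using that[of a] that[of b] ab e by (auto simp: insert_commute)
qed

text \<open>Deleting an edge at \<open>u\<close> moves the odd vertex from \<open>u\<close> to the
  other end of that edge, so the walk can go on until it reaches \<open>v\<close>, never using an
  edge twice. Writing the ends as \<open>sym_diff {u} {v}\<close> includes \<open>u = v\<close>,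
  where the empty trail suffices.\<close>

lemma trail_in_join:
  assumes "finite w" "\<forall>e\<in>w. card e = 2" "odd_verts w = sym_diff {u} {v}"
  shows "\<exists>C\<subseteq>w. (C, v) \<in> walk_sets w (card C) u \<and> odd_verts C = sym_diff {u} {v}"
  using assms
proof (induction "card w" arbitrary: w u rule: less_induct)
  case less
  show ?case
  proof (cases "u = v")
    case True
    then show ?thesis by (intro exI[of _ "{}"]) simp
  next
    case False
    then have "u \<in> odd_verts w" using less.prems by auto
    then obtain u' where u': "{u, u'} \<in> w" "u' \<noteq> u" using edge_at_odd less.prems by metis
    let ?w = "w - {{u, u'}}"
    have "odd_verts ?w = sym_diff (sym_diff {u} {v}) {u, u'}"
      using odd_verts_Diff[of w "{{u, u'}}"] u' less.prems by simp
    also have "\<dots> = sym_diff {u'} {v}" using False u' by auto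
    finally have o: "odd_verts ?w = sym_diff {u'} {v}" .
    have c: "card ?w < card w" using u' less.prems by (intro psubset_card_mono) auto
    obtain C where C: "C \<subseteq> ?w" "(C, v) \<in> walk_sets ?w (card C) u'"
        "odd_verts C = sym_diff {u'} {v}"
    proof -
      have "finite ?w" "\<forall>e\<in>?w. card e = 2" using less.prems by simp_all
      then show ?thesis using less.hyps[OF c _ _ o] that by blast
    qed
    have fC: "finite C" using C(1) less.prems(1) finite_subset finite_Diff by metis
    have nin: "{u, u'} \<notin> C" using C(1) by auto
    have "(C, v) \<in> walk_sets w (card C) u'"
      using C(2) walk_sets_mono[of ?w w] by blast
    moreover have "u' \<in> nbrs w u" using u' by (simp add: nbrs_def)
    ultimately have "(insert {u, u'} C, v) \<in> walk_sets w (Suc (card C)) u" by force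
    moreover have "odd_verts (insert {u, u'} C) = sym_diff {u} {v}"
    proof -
      have "insert {u, u'} C = sym_diff {{u, u'}} C" using nin by auto
      then have "odd_verts (insert {u, u'} C) = sym_diff {u, u'} (odd_verts C)"
        using odd_verts_sym_diff[of "{{u, u'}}" C] fC by simp
      then show ?thesis using C(3) u' False by auto
    qed
    ultimately have "(insert {u, u'} C, v) \<in> walk_sets w (card (insert {u, u'} C)) u \<and>
        odd_verts (insert {u, u'} C) = sym_diff {u} {v}" using nin fC by simp
    moreover have "insert {u, u'} C \<subseteq> w" using C(1) u' by auto
    ultimately show ?thesis by blast
  qed
qed

text \<open>Without one of its edges the set joins the two ends of that edge; the trail found in the
  rest is closed by putting the edge back.\<close>

lemma closed_trail_in_even:
  assumes "finite w" "\<forall>e\<in>w. card e = 2" "odd_verts w = {}" "w \<noteq> {}"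
  shows "\<exists>C\<subseteq>w. \<exists>s\<in>\<Union>w. C \<noteq> {} \<and> (C, s) \<in> walk_sets w (card C) s \<and> odd_verts C = {}"
proof -
  obtain e where e: "e \<in> w" using assms by auto
  then obtain s s' where ss: "e = {s, s'}" "s \<noteq> s'" using assms card_2_iff by metis
  let ?w = "w - {e}"
  have "odd_verts ?w = sym_diff {s'} {s}"
    using odd_verts_Diff[of w "{e}"] e ss assms by auto
  then obtain C where C: "C \<subseteq> ?w" "(C, s) \<in> walk_sets ?w (card C) s'"
      "odd_verts C = sym_diff {s'} {s}"
    using trail_in_join[of ?w s' s] assms by auto
  have fC: "finite C" using C assms finite_subset by blast
  have nin: "e \<notin> C" using C by auto
  have "(C, s) \<in> walk_sets w (card C) s'"
    using C(2) walk_sets_mono[of ?w w] by blast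
  moreover have "s' \<in> nbrs w s" using e ss by (simp add: nbrs_def)
  ultimately have "(insert e C, s) \<in> walk_sets w (Suc (card C)) s" using ss by force
  moreover have "insert e C = sym_diff {e} C" using nin by auto
  then have "odd_verts (insert e C) = {}"
    using odd_verts_sym_diff[of "{e}" C] fC C(3) ss by auto
  ultimately have "insert e C \<noteq> {} \<and> (insert e C, s) \<in> walk_sets w (card (insert e C)) s \<and>
      odd_verts (insert e C) = {}" using nin fC by simp
  moreover have "insert e C \<subseteq> w" "s \<in> \<Union>w" using C(1) e ss by auto
  ultimately show ?thesis by blast
qed

text \<open>Phrased with even sets in place of cycles: a nonempty finite even set of edges contains
  a cycle, so this forbids cycles with fewer than \<open>g\<close> edges.\<close>

definition girth_ge :: "nat \<Rightarrow> 'a set set \<Rightarrow> bool" where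
  "girth_ge g E \<longleftrightarrow> (\<forall>w\<subseteq>E. odd_verts w = {} \<longrightarrow> w \<noteq> {} \<longrightarrow> g \<le> card w)"

definition joins :: "'a set set \<Rightarrow> nat \<Rightarrow> 'a \<Rightarrow> ('a set set \<times> 'a) set" where
  "joins E k u = {(w, v). w \<subseteq> E \<and> card w = k \<and> odd_verts w = sym_diff {u} {v}}"

definition even_sets :: "'a set set \<Rightarrow> 'a set set set" where
  "even_sets E = {w. w \<subseteq> E \<and> odd_verts w = {}}"

text \<open>Splitting off a closed trail of length \<open>l\<close> leaves an even set with
  \<open>k - l\<close> edges. The trail has at most \<open>card V * 8 ^ l\<close> choices of start
  and steps. Since \<open>l \<ge> g\<close>, the factor \<open>card V \<le> 2 * 8 ^ g\<close> is
  absorbed by \<open>2 * 8 ^ l\<close>; this is how a girth of logarithmic order makes the count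
  exponential in \<open>k\<close> alone.\<close>

lemma card_even_sets:
  fixes V :: "'a set"
  assumes fin: "finite E" "finite V" and two: "\<forall>e\<in>E. card e = 2 \<and> e \<subseteq> V"
    and deg: "\<And>v. finite (nbrs E v) \<and> card (nbrs E v) \<le> 8"
    and g: "girth_ge g E" "0 < g" and r: "card V \<le> 2 * 8 ^ g"
  shows "card {w \<in> even_sets E. card w = k} \<le> 256 ^ k"
proof (induction k rule: less_induct)
  case (less k)
  let ?c = "\<lambda>k. {w \<in> even_sets E. card w = k}"
  have finc: "finite (?c j)" for j
    by (rule finite_subset[of _ "Pow E"]) (use fin in \<open>auto simp: even_sets_def\<close>)
  show ?case
  proof (cases "k = 0")
    case True
    have "?c 0 \<subseteq> {{}}" using fin finite_subset by (fastforce simp: even_sets_def)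
    then have "card (?c 0) \<le> 1" using card_mono[of "{{}}" "?c 0"] by simp
    then show ?thesis using True by simp
  next
    case False
    let ?U = "\<Union>l\<in>{g..k}. \<Union>s\<in>V. \<Union>p\<in>walk_sets E l s. (\<lambda>w. w \<union> fst p) ` ?c (k - l)"
    have sub: "?c k \<subseteq> ?U"
    proof
      fix w assume w: "w \<in> ?c k"
      then have wE: "w \<subseteq> E" "odd_verts w = {}" "card w = k" "w \<noteq> {}" "finite w"
        using False fin finite_subset by (auto simp: even_sets_def)
      then obtain C s where C: "C \<subseteq> w" "s \<in> \<Union>w" "C \<noteq> {}" "(C, s) \<in> walk_sets w (card C) s"
          "odd_verts C = {}"
        using closed_trail_in_even[of w] two by blast
      have sV: "s \<in> V" using C wE two by blast
      have gl: "g \<le> card C" using g C wE unfolding girth_ge_def by (meson subset_trans)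
      have lk: "card C \<le> k" using C wE card_mono by metis
      have ws: "(C, s) \<in> walk_sets E (card C) s" using C walk_sets_mono[OF wE(1)] by blast
      have "w - C \<in> ?c (k - card C)"
        using wE C odd_verts_Diff[of w C] card_Diff_subset[of C w] finite_subset[of C w]
        by (auto simp: even_sets_def)
      moreover have "w = (w - C) \<union> fst (C, s)" using C by auto
      ultimately have "w \<in> (\<lambda>w. w \<union> fst (C, s)) ` ?c (k - card C)" by blast
      then show "w \<in> ?U" using sV gl lk ws
        by (intro UN_I[of "card C"] UN_I[of s] UN_I[of "(C, s)"]) auto
    qed
    have fw: "finite (walk_sets E l s)" "card (walk_sets E l s) \<le> 8 ^ l" for l s
      using card_walk_sets[of E 8] deg by auto
    have "card (?c k) \<le> card ?U"
      by (rule card_mono[OF _ sub]) (use fin fw finc in auto)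
    also have "\<dots> \<le> (\<Sum>l\<in>{g..k}. card (\<Union>s\<in>V. \<Union>p\<in>walk_sets E l s. (\<lambda>w. w \<union> fst p) ` ?c (k - l)))"
      by (rule card_UN_le) simp
    also have "\<dots> \<le> (\<Sum>l\<in>{g..k}. card V * (8 ^ l * 256 ^ (k - l)))"
    proof (rule sum_mono)
      fix l assume l: "l \<in> {g..k}"
      have "card (\<Union>p\<in>walk_sets E l s. (\<lambda>w. w \<union> fst p) ` ?c (k - l)) \<le> 8 ^ l * 256 ^ (k - l)" for s
      proof -
        have "card (\<Union>p\<in>walk_sets E l s. (\<lambda>w. w \<union> fst p) ` ?c (k - l))
            \<le> (\<Sum>p\<in>walk_sets E l s. card ((\<lambda>w. w \<union> fst p) ` ?c (k - l)))"
          by (rule card_UN_le) (rule fw)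
        also have "\<dots> \<le> (\<Sum>p\<in>walk_sets E l s. 256 ^ (k - l))"
          by (rule sum_mono, rule order_trans[OF card_image_le[OF finc] less])
            (use l g False in auto)
        also have "\<dots> \<le> 8 ^ l * 256 ^ (k - l)" using fw by simp
        finally show ?thesis .
      qed
      then have "(\<Sum>s\<in>V. card (\<Union>p\<in>walk_sets E l s. (\<lambda>w. w \<union> fst p) ` ?c (k - l)))
          \<le> (\<Sum>s\<in>V. 8 ^ l * 256 ^ (k - l))" by (intro sum_mono)
      then show "card (\<Union>s\<in>V. \<Union>p\<in>walk_sets E l s. (\<lambda>w. w \<union> fst p) ` ?c (k - l))
          \<le> card V * (8 ^ l * 256 ^ (k - l))"
        using card_UN_le[OF fin(2)] order_trans by fastforce
    qed
    also have "\<dots> \<le> 256 ^ k"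
    proof -
      \<comment> \<open>As \<open>256 = 8 * 8 * 2 * 2\<close>, length \<open>l\<close> contributes
        at most \<open>2 * 256 ^ k / 4 ^ l\<close>, and these terms sum to at most
        \<open>256 ^ k\<close> over \<open>l \<ge> 1\<close>.\<close>
      have e: "2 * 8 ^ g * (8 ^ l * 256 ^ (k - l)) * 2 ^ l * 2 ^ l \<le> 2 * (256::nat) ^ k" if "l \<in> {g..k}" for l
      proof -
        have "(2 * 8 ^ g * (8 ^ l * 256 ^ (k - l)) * 2 ^ l * 2 ^ l :: nat)
            \<le> 2 * 8 ^ l * (8 ^ l * 256 ^ (k - l)) * 2 ^ l * 2 ^ l"
          using that by (simp add: power_increasing)
        also have "\<dots> = 2 * ((8 * 8 * 2 * 2) ^ l * 256 ^ (k - l))" by (simp only: power_mult_distrib ac_simps)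
        also have "(8 * 8 * 2 * 2) ^ l * 256 ^ (k - l) = (256::nat) ^ k"
          using that by (simp flip: power_add)
        finally show ?thesis .
      qed
      have "real (card V * (8 ^ l * 256 ^ (k - l))) \<le> 2 * 256 ^ k * (1/4) ^ l" if "l \<in> {g..k}" for l
      proof -
        have "card V * (8 ^ l * 256 ^ (k - l)) * 4 ^ l \<le> 2 * 256 ^ k"
        proof -
          have "card V * (8 ^ l * 256 ^ (k - l)) * 4 ^ l = card V * (8 ^ l * 256 ^ (k - l)) * 2 ^ l * 2 ^ l"
            by (simp flip: power_mult_distrib)
          also have "\<dots> \<le> 2 * 8 ^ g * (8 ^ l * 256 ^ (k - l)) * 2 ^ l * 2 ^ l"
            using r by (intro mult_le_mono) auto
          finally show ?thesis using e[OF that] by linarith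
        qed
        then have "real (card V * (8 ^ l * 256 ^ (k - l)) * 4 ^ l) \<le> 2 * 256 ^ k"
          by (metis of_nat_le_iff of_nat_mult of_nat_numeral of_nat_power)
        then show ?thesis by (simp add: power_one_over field_simps)
      qed
      then have "real (\<Sum>l\<in>{g..k}. card V * (8 ^ l * 256 ^ (k - l))) \<le> (\<Sum>l\<in>{g..k}. 2 * 256 ^ k * (1/4) ^ l)"
        by (subst of_nat_sum) (rule sum_mono)
      also have "\<dots> \<le> (\<Sum>l\<in>{1..k}. 2 * 256 ^ k * (1/4) ^ l)"
        by (rule sum_mono2) (use g in auto)
      also have "\<dots> = 2 * 256 ^ k * (\<Sum>l\<in>{1..k}. (1/4) ^ l)" by (simp add: sum_distrib_left)
      also have "\<dots> \<le> 2 * 256 ^ k * (1/2)"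
      proof -
        have S: "(\<Sum>l\<in>{1..k}. (1/4::real) ^ l) = (1 - (1/4) ^ k) / 3"
          by (induction k) (simp_all add: diff_divide_distrib)
        have "(1 - x) / 3 \<le> 1 / 2" if "0 \<le> x" for x :: real using that by simp
        from this[OF zero_le_power, of "1/4" k] have "(1 - (1/4::real) ^ k) / 3 \<le> 1 / 2" by simp
        then have "(\<Sum>l\<in>{1..k}. (1/4::real) ^ l) \<le> 1/2" using S by metis
        then show ?thesis by (intro mult_left_mono) auto
      qed
      finally have "real (\<Sum>l\<in>{g..k}. card V * (8 ^ l * 256 ^ (k - l))) \<le> real (256 ^ k)"
        by (simp del: of_nat_sum of_nat_mult)
      then show ?thesis by (simp only: of_nat_le_iff)
    qed
    finally show ?thesis .
  qed
qed

text \<open>Split off a trail from \<open>u\<close> to the other end; the remainder is even. The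
  start \<open>u\<close> is fixed, so no factor \<open>card V\<close> arises and a geometric series
  remains.\<close>

lemma card_joins:
  fixes V :: "'a set"
  assumes fin: "finite E" "finite V" and two: "\<forall>e\<in>E. card e = 2 \<and> e \<subseteq> V"
    and deg: "\<And>v. finite (nbrs E v) \<and> card (nbrs E v) \<le> 8"
    and g: "girth_ge g E" "0 < g" and r: "card V \<le> 2 * 8 ^ g"
  shows "finite (joins E k u) \<and> card (joins E k u) \<le> 2 * 256 ^ k"
proof -
  let ?c = "\<lambda>k. {w \<in> even_sets E. card w = k}"
  have finc: "finite (?c j)" for j
    by (rule finite_subset[of _ "Pow E"]) (use fin in \<open>auto simp: even_sets_def\<close>)
  have fw: "finite (walk_sets E l s)" "card (walk_sets E l s) \<le> 8 ^ l" for l s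
    using card_walk_sets[of E 8] deg by auto
  let ?U = "\<Union>l\<in>{..k}. \<Union>p\<in>walk_sets E l u. (\<lambda>w. (w \<union> fst p, snd p)) ` ?c (k - l)"
  have finU: "finite ?U" using fw finc by auto
  have sub: "joins E k u \<subseteq> ?U"
  proof
    fix p assume "p \<in> joins E k u"
    then obtain w v where p: "p = (w, v)" and w: "w \<subseteq> E" "card w = k" "odd_verts w = sym_diff {u} {v}"
      by (auto simp: joins_def)
    have fw: "finite w" using w fin finite_subset by blast
    obtain C where C: "C \<subseteq> w" "(C, v) \<in> walk_sets w (card C) u" "odd_verts C = sym_diff {u} {v}"
      using trail_in_join[OF fw _ w(3)] two w by blast
    have "w - C \<in> ?c (k - card C)"
      using w C fw odd_verts_Diff[of w C] card_Diff_subset[of C w] finite_subset[of C w]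
      by (auto simp: even_sets_def)
    moreover have "p = ((w - C) \<union> fst (C, v), snd (C, v))" using C p by auto
    moreover have "(C, v) \<in> walk_sets E (card C) u" using C walk_sets_mono[OF w(1)] by blast
    moreover have "card C \<le> k" using C w fw card_mono by metis
    ultimately show "p \<in> ?U" by blast
  qed
  have "card ?U \<le> (\<Sum>l\<in>{..k}. card (\<Union>p\<in>walk_sets E l u. (\<lambda>w. (w \<union> fst p, snd p)) ` ?c (k - l)))"
    by (rule card_UN_le) simp
  also have "\<dots> \<le> (\<Sum>l\<in>{..k}. 8 ^ l * 256 ^ (k - l))"
  proof (rule sum_mono)
    fix l
    have "card (\<Union>p\<in>walk_sets E l u. (\<lambda>w. (w \<union> fst p, snd p)) ` ?c (k - l))
        \<le> (\<Sum>p\<in>walk_sets E l u. card ((\<lambda>w. (w \<union> fst p, snd p)) ` ?c (k - l)))"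
      by (rule card_UN_le) (rule fw)
    also have "\<dots> \<le> (\<Sum>p\<in>walk_sets E l u. 256 ^ (k - l))"
      by (rule sum_mono, rule order_trans[OF card_image_le[OF finc] card_even_sets[OF assms]])
    also have "\<dots> \<le> 8 ^ l * 256 ^ (k - l)" using fw by simp
    finally show "card (\<Union>p\<in>walk_sets E l u. (\<lambda>w. (w \<union> fst p, snd p)) ` ?c (k - l)) \<le> 8 ^ l * 256 ^ (k - l)" .
  qed
  also have "\<dots> \<le> 2 * 256 ^ k"
  proof (induction k)
    case (Suc k)
    have "(\<Sum>l\<in>{..Suc k}. 8 ^ l * 256 ^ (Suc k - l)) = (\<Sum>l\<in>{..k}. 256 * (8 ^ l * 256 ^ (k - l))) + (8::nat) ^ Suc k"
      by (simp add: Suc_diff_le mult_ac)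
    also have "\<dots> = 256 * (\<Sum>l\<in>{..k}. 8 ^ l * 256 ^ (k - l)) + 8 ^ Suc k"
      by (simp add: sum_distrib_left)
    finally have e: "(\<Sum>l\<in>{..Suc k}. 8 ^ l * 256 ^ (Suc k - l)) = 256 * (\<Sum>l\<in>{..k}. 8 ^ l * 256 ^ (k - l)) + (8::nat) ^ Suc k" .
    \<comment> \<open>Closed form of the geometric sum, with \<open>248 = 256 - 8\<close>.\<close>
    have "248 * (\<Sum>l\<in>{..k}. 8 ^ l * 256 ^ (k - l)) + 8 ^ Suc k = (256::nat) ^ Suc k" for k
    proof (induction k)
      case (Suc k)
      have "(\<Sum>l\<in>{..Suc k}. 8 ^ l * 256 ^ (Suc k - l)) = (\<Sum>l\<in>{..k}. 256 * (8 ^ l * 256 ^ (k - l))) + (8::nat) ^ Suc k"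
        by (simp add: Suc_diff_le mult_ac)
      then show ?case using Suc by (simp flip: sum_distrib_left)
    qed simp
    from this[of "Suc k"] show ?case by simp
  qed simp
  finally show ?thesis using card_mono[OF finU sub] finite_subset[OF sub finU] by simp
qed

section \<open>Expansion of graphs whose edges flip coordinates\<close>

lemma expansion_le_cut:
  assumes "simple_graph H" "S \<subseteq> verts H" "1 \<le> card S" "2 * card S \<le> card (verts H)"
  shows "expansion H \<le> card (edge_boundary H S) / card S"
proof -
  let ?M = "{real (card (edge_boundary H S)) / real (card S) | S.
     S \<subseteq> verts H \<and> 1 \<le> card S \<and> real (card S) \<le> real (card (verts H)) / 2}"
  have "?M \<subseteq> (\<lambda>S. real (card (edge_boundary H S)) / real (card S)) ` Pow (verts H)" by auto
  moreover have "finite (Pow (verts H))" using assms(1) by (simp add: simple_graph_def)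
  ultimately have fin: "finite ?M" using finite_subset by blast
  have "real (card S) \<le> real (card (verts H)) / 2" using assms(4) by linarith
  then show ?thesis unfolding expansion_def using fin assms(2,3) by (intro Min_le) blast+
qed

lemma finite_edges: "simple_graph H \<Longrightarrow> finite (edges H)"
  unfolding simple_graph_def by (rule finite_subset[of _ "Pow (verts H)"]) auto

text \<open>A vertex of at most average degree serves as a one-element cut.\<close>

lemma expansion_le_twice_density:
  assumes H: "simple_graph H" and t: "card (verts H) > 2" and e: "card (edges H) \<le> c * card (verts H)"
  shows "expansion H \<le> 2 * c"
proof -
  have finV: "finite (verts H)" and fE: "finite (edges H)"
    using H finite_edges[of H] by (auto simp: simple_graph_def)
  have "(\<Sum>v\<in>verts H. card {e \<in> edges H. v \<in> e}) = (\<Sum>e\<in>edges H. card {v \<in> verts H. v \<in> e})"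
    by (rule sum_multicount_gen[symmetric]) (use finV fE in \<open>auto intro: finV fE\<close>)
  also have "\<dots> = (\<Sum>e\<in>edges H. 2)"
  proof (rule sum.cong[OF refl])
    fix e assume "e \<in> edges H"
    then have "card e = 2" "e \<subseteq> verts H" using H by (auto simp: simple_graph_def)
    then show "card {v \<in> verts H. v \<in> e} = 2" by (metis Collect_mem_eq Int_absorb1 Int_def)
  qed
  also have "\<dots> \<le> (2 * c) * card (verts H)" using e by simp
  finally have le: "(\<Sum>v\<in>verts H. card {e \<in> edges H. v \<in> e}) \<le> (\<Sum>v\<in>verts H. 2 * c)" by (simp add: mult.commute)
  obtain v where v: "v \<in> verts H" "card {e \<in> edges H. v \<in> e} \<le> 2 * c"
  proof (rule ccontr)
    assume "\<not> thesis"
    then have "\<forall>v\<in>verts H. 2 * c < card {e \<in> edges H. v \<in> e}" using that by force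
    moreover have "verts H \<noteq> {}" using t by auto
    ultimately have "(\<Sum>v\<in>verts H. 2 * c) < (\<Sum>v\<in>verts H. card {e \<in> edges H. v \<in> e})"
      using finV by (intro sum_strict_mono) auto
    then show False using le by simp
  qed
  have sub: "edge_boundary H {v} \<subseteq> {e \<in> edges H. v \<in> e}"
  proof
    fix e assume "e \<in> edge_boundary H {v}"
    then have "e \<in> edges H" "card (e \<inter> {v}) = 1" by (auto simp: edge_boundary_def)
    moreover have "v \<in> e" if "card (e \<inter> {v}) = 1" using that by (cases "v \<in> e") auto
    ultimately show "e \<in> {e \<in> edges H. v \<in> e}" by blast
  qed
  then have "card (edge_boundary H {v}) \<le> 2 * c"
    using v(2) card_mono[OF _ sub] fE by (simp add: order_trans)
  moreover have "expansion H \<le> card (edge_boundary H {v}) / card {v}"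
    by (rule expansion_le_cut) (use H t v in auto)
  ultimately show ?thesis by simp
qed

text \<open>The distance to the majority point \<open>Y\<close> is at most
  \<open>5 / expansion H\<close> on average, so by Markov half of the vertices are within
  \<open>10 / expansion H\<close> of it and hence pairwise within \<open>20 / expansion H\<close>.
  The growth bound gives \<open>t \<le> 16 * 512 ^ k = 2 ^ (9 * k + 4)\<close>, and
  \<open>180 = 9 * 20\<close>.\<close>

lemma expansion_of_coordinates:
  fixes X :: "'v \<Rightarrow> 'c set"
  assumes H: "simple_graph H" and t: "card (verts H) > 2"
    and fX: "\<And>v. v \<in> verts H \<Longrightarrow> finite (X v)"
    and flip: "\<And>u v. {u, v} \<in> edges H \<Longrightarrow> \<exists>c. sym_diff (X u) (X v) = {c}"
    and e: "card (edges H) \<le> 5 * card (verts H)"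
    and cnt: "\<And>u k. u \<in> verts H \<Longrightarrow>
      card {v \<in> verts H. card (sym_diff (X u) (X v)) \<le> k} \<le> 8 * 512 ^ k"
    and pos: "expansion H > 0"
  shows "log 2 (card (verts H)) \<le> 180 / expansion H + 4"
proof -
  let ?V = "verts H" and ?t = "card (verts H)" and ?phi = "expansion H"
  have finV: "finite ?V" and fE: "finite (edges H)"
    using H finite_edges[of H] by (auto simp: simple_graph_def)
  define C where "C = (\<Union>v\<in>?V. X v)"
  have finC: "finite C" using finV fX by (simp add: C_def)
  define Y where "Y = {c \<in> C. 2 * card {v \<in> ?V. c \<in> X v} > ?t}"
  \<comment> \<open>The minority side of coordinate \<open>c\<close>, which is small enough to be an
    admissible cut.\<close>
  define S where "S c = {v \<in> ?V. c \<in> sym_diff (X v) Y}" for c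
  have finS: "finite (S c)" for c using finV by (simp add: S_def)
  have small: "2 * card (S c) \<le> ?t" if "c \<in> C" for c
  proof (cases "c \<in> Y")
    case True
    then have "S c = ?V - {v \<in> ?V. c \<in> X v}" by (auto simp: S_def)
    then have "card (S c) = ?t - card {v \<in> ?V. c \<in> X v}"
      using finV by (simp add: card_Diff_subset)
    then show ?thesis using True by (auto simp: Y_def)
  next
    case False
    then have "S c = {v \<in> ?V. c \<in> X v}" by (auto simp: S_def)
    then show ?thesis using False that by (auto simp: Y_def)
  qed
  define lab where "lab u v = sym_diff (X u) (X v)" for u v
  have lab_sym: "lab u v = lab v u" for u v by (auto simp: lab_def)
  \<comment> \<open>An edge leaving \<open>S c\<close> flips \<open>c\<close> and nothing else. The
    boundaries for different coordinates are therefore disjoint, and their sizes add up to at most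
    the number of edges.\<close>
  have bd: "\<exists>u v. e = {u, v} \<and> lab u v = {c}" if "e \<in> edge_boundary H (S c)" for e c
  proof -
    have eE: "e \<in> edges H" "card (e \<inter> S c) = 1" using that by (auto simp: edge_boundary_def)
    then have "card e = 2" "e \<subseteq> ?V" using H by (auto simp: simple_graph_def)
    then obtain u v where uv: "e = {u, v}" "u \<noteq> v" "u \<in> ?V" "v \<in> ?V"
      by (auto simp: card_2_iff)
    have "(u \<in> S c) \<noteq> (v \<in> S c)" using eE(2) uv by (auto simp: Int_insert_left split: if_splits)
    then have "c \<in> sym_diff (X u) (X v)" using uv by (auto simp: S_def)
    moreover obtain c' where c': "sym_diff (X u) (X v) = {c'}" using flip[of u v] uv eE(1) by metis
    ultimately have "c = c'" by (metis singletonD)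
    then have "e = {u, v} \<and> lab u v = {c}" using c' uv(1) by (simp add: lab_def)
    then show ?thesis by blast
  qed
  have "(\<Sum>c\<in>C. card (edge_boundary H (S c))) = card (\<Union>c\<in>C. edge_boundary H (S c))"
  proof (rule card_UN_disjoint[symmetric, OF finC])
    show "\<forall>c\<in>C. finite (edge_boundary H (S c))" using fE by (simp add: edge_boundary_def)
    show "\<forall>c\<in>C. \<forall>c'\<in>C. c \<noteq> c' \<longrightarrow> edge_boundary H (S c) \<inter> edge_boundary H (S c') = {}"
    proof (intro ballI impI)
      fix c c' :: 'c assume "c \<noteq> c'"
      have False if e: "e \<in> edge_boundary H (S c)" "e \<in> edge_boundary H (S c')" for e
      proof -
        obtain u v where 1: "e = {u, v}" "lab u v = {c}" using bd[OF e(1)] by blast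
        obtain u' v' where 2: "e = {u', v'}" "lab u' v' = {c'}" using bd[OF e(2)] by blast
        have "lab u v = lab u' v'" using 1(1) 2(1) lab_sym by (auto simp: doubleton_eq_iff)
        then show False using 1 2 \<open>c \<noteq> c'\<close> by simp
      qed
      then show "edge_boundary H (S c) \<inter> edge_boundary H (S c') = {}" by blast
    qed
  qed
  also have "\<dots> \<le> card (edges H)" by (rule card_mono[OF fE]) (auto simp: edge_boundary_def)
  finally have sumb: "(\<Sum>c\<in>C. card (edge_boundary H (S c))) \<le> 5 * ?t" using e by simp
  have cut: "?phi * card (S c) \<le> card (edge_boundary H (S c))" if "c \<in> C" for c
  proof (cases "card (S c) = 0")
    case False
    then have "?phi \<le> card (edge_boundary H (S c)) / card (S c)"
      using small[OF that] by (intro expansion_le_cut[OF H]) (auto simp: S_def)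
    then show ?thesis using False by (simp add: field_simps)
  qed simp
  let ?d = "\<lambda>v. card (sym_diff (X v) Y)"
  have fY: "finite Y" using finC by (simp add: Y_def)
  have dC: "sym_diff (X v) Y = {c \<in> C. c \<in> sym_diff (X v) Y}" if "v \<in> ?V" for v
    using that by (auto simp: C_def Y_def)
  have "(\<Sum>v\<in>?V. ?d v) = (\<Sum>v\<in>?V. card {c \<in> C. c \<in> sym_diff (X v) Y})"
    using dC by (intro sum.cong) metis+
  also have "\<dots> = (\<Sum>c\<in>C. card {v \<in> ?V. c \<in> sym_diff (X v) Y})"
    by (rule sum_multicount_gen) (use finV finC in \<open>auto\<close>)
  finally have dbl: "(\<Sum>v\<in>?V. ?d v) = (\<Sum>c\<in>C. card (S c))" by (simp add: S_def)
  have "?phi * (\<Sum>v\<in>?V. ?d v) = (\<Sum>c\<in>C. ?phi * card (S c))"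
    by (simp add: dbl sum_distrib_left)
  also have "\<dots> \<le> (\<Sum>c\<in>C. real (card (edge_boundary H (S c))))" by (rule sum_mono) (rule cut)
  also have "\<dots> \<le> 5 * ?t" using sumb by (metis of_nat_le_iff of_nat_mult of_nat_numeral of_nat_sum)
  finally have tot: "?phi * (\<Sum>v\<in>?V. real (?d v)) \<le> 5 * ?t" by simp
  define Good where "Good = {v \<in> ?V. ?phi * ?d v \<le> 10}"
  have finG: "finite Good" using finV by (simp add: Good_def)
  have half: "?t \<le> 2 * card Good"
  proof -
    have "10 * real (card (?V - Good)) = (\<Sum>v\<in>?V - Good. 10)" by simp
    also have "\<dots> \<le> (\<Sum>v\<in>?V - Good. ?phi * ?d v)" by (rule sum_mono) (auto simp: Good_def)
    also have "\<dots> \<le> (\<Sum>v\<in>?V. ?phi * ?d v)" by (rule sum_mono2) (use finV pos in auto)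
    also have "\<dots> \<le> 5 * ?t" using tot by (simp add: sum_distrib_left)
    finally have "2 * card (?V - Good) \<le> ?t" by simp
    moreover have "card (?V - Good) = ?t - card Good"
      using finG by (intro card_Diff_subset) (auto simp: Good_def)
    ultimately show ?thesis by linarith
  qed
  then have "Good \<noteq> {}" using t by auto
  then obtain v0 where v0: "v0 \<in> Good" by blast
  define k where "k = nat \<lfloor>20 / ?phi\<rfloor>"
  have kle: "real k \<le> 20 / ?phi" using pos by (simp add: k_def)
  have "Good \<subseteq> {v \<in> ?V. card (sym_diff (X v0) (X v)) \<le> k}"
  proof
    fix v assume v: "v \<in> Good"
    have "sym_diff (X v0) (X v) \<subseteq> sym_diff (X v0) Y \<union> sym_diff (X v) Y" by auto
    then have "card (sym_diff (X v0) (X v)) \<le> card (sym_diff (X v0) Y \<union> sym_diff (X v) Y)"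
      using v v0 fX fY by (intro card_mono) (auto simp: Good_def)
    also have "\<dots> \<le> ?d v0 + ?d v" by (rule card_Un_le)
    finally have "real (card (sym_diff (X v0) (X v))) \<le> real (?d v0) + real (?d v)" by linarith
    moreover have dG: "real (?d w) \<le> 10 / ?phi" if "w \<in> Good" for w
      using that pos by (simp add: Good_def field_simps)
    ultimately have "real (card (sym_diff (X v0) (X v))) \<le> 20 / ?phi"
      using dG[OF v] dG[OF v0] by simp
    then have "card (sym_diff (X v0) (X v)) \<le> k" unfolding k_def by linarith
    then show "v \<in> {v \<in> ?V. card (sym_diff (X v0) (X v)) \<le> k}" using v by (simp add: Good_def)
  qed
  then have "card Good \<le> card {v \<in> ?V. card (sym_diff (X v0) (X v)) \<le> k}"
    using finV by (intro card_mono) auto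
  then have "card Good \<le> 8 * 512 ^ k" using cnt[of v0 k] v0 by (simp add: Good_def)
  then have "?t \<le> 16 * 512 ^ k" using half by linarith
  also have "\<dots> = 2 ^ (9 * k + 4)" by (simp add: power_add power_mult)
  finally have "real ?t \<le> 2 ^ (9 * k + 4)"
    by (metis of_nat_le_iff of_nat_numeral of_nat_power)
  also have "(2::real) ^ (9 * k + 4) = 2 powr real (9 * k + 4)"
    by (rule powr_realpow[symmetric]) simp
  finally have "log 2 ?t \<le> real (9 * k + 4)" using t by (subst log_le_iff) auto
  then show ?thesis using kle by simp
qed

text \<open>The product of \<open>\<phi>\<close> and \<open>log 2 t\<close> is at most 80 while
  \<open>log 2 t \<le> 8\<close>, and at most 360 beyond. On the other side \<open>t \<ge> 3\<close>
  gives \<open>log 2 t \<ge> 3/2\<close>, so the double logarithm is at least \<open>1/2\<close> and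
  the square is at least 35 squared, that is 1225.\<close>

lemma non_expansion_bound:
  fixes t \<phi> :: real
  assumes t: "t \<ge> 3" and le: "\<phi> \<le> 10" and log: "\<phi> > 0 \<Longrightarrow> log 2 t \<le> 180 / \<phi> + 4"
  shows "\<phi> \<le> 1 / log 2 t * (70 * log 2 (log 2 t))\<^sup>2"
proof -
  define w where "w = log 2 t"
  have "log 2 (2 powr (3/2)) \<le> log 2 t"
  proof (subst log_le_cancel_iff)
    have "2 powr (3/2) = (2::real) powr (1 + 1/2)" by simp
    also have "\<dots> = 2 * sqrt 2" by (subst powr_add) (simp add: powr_half_sqrt)
    also have "\<dots> \<le> 3"
    proof -
      have "sqrt 2 \<le> 3/2" by (rule real_le_lsqrt) (auto simp: power2_eq_square)
      then show ?thesis by simp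
    qed
    finally show "2 powr (3/2) \<le> t" using t by linarith
  qed (use t in auto)
  then have w: "w \<ge> 3/2" by (simp add: w_def)
  have "log 2 (2 powr (1/2)) \<le> log 2 w"
  proof (subst log_le_cancel_iff)
    have "sqrt 2 \<le> 3/2" by (rule real_le_lsqrt) (auto simp: power2_eq_square)
    then show "2 powr (1/2) \<le> w" using w by (simp add: powr_half_sqrt)
  qed (use w in auto)
  then have L: "log 2 w \<ge> 1/2" by simp
  have "\<phi> * w \<le> 4900 * (log 2 w)\<^sup>2"
  proof (cases "w \<le> 8")
    case True
    have "\<phi> * w \<le> 10 * 8" using True w mult_right_mono[OF le, of w] by linarith
    moreover have "(1/2)\<^sup>2 \<le> (log 2 w)\<^sup>2" using L by (intro power_mono) auto
    ultimately show ?thesis by (simp add: power2_eq_square)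
  next
    case False
    have "(1/2)\<^sup>2 \<le> (log 2 w)\<^sup>2" using L by (intro power_mono) auto
    moreover have "\<phi> * w \<le> 360"
    proof (cases "\<phi> > 0")
      case True
      have "\<phi> * w \<le> 180 + 4 * \<phi>" using log[OF True] True by (simp add: w_def field_simps)
      moreover have "4 * \<phi> \<le> w * \<phi> / 2" using False True by simp
      ultimately show ?thesis by (simp add: mult.commute)
    next
      case F: False
      then have "\<phi> * w \<le> 0" using w by (simp add: mult_nonpos_nonneg)
      then show ?thesis by simp
    qed
    ultimately show ?thesis by (simp add: power2_eq_square)
  qed
  then show ?thesis using w unfolding w_def[symmetric] by (simp add: field_simps power_mult_distrib)
qed

text \<open>The assumptions are inherited by subgraphs: degree at most 10 leaves at most 5 edges per
  vertex, and balls of coordinates only shrink.\<close>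

lemma non_expanding_of_coordinates:
  fixes X :: "'v \<Rightarrow> 'c set"
  assumes G: "simple_graph G"
    and fX: "\<And>v. v \<in> verts G \<Longrightarrow> finite (X v)"
    and flip: "\<And>u v. {u, v} \<in> edges G \<Longrightarrow> \<exists>c. sym_diff (X u) (X v) = {c}"
    and deg: "\<And>v. v \<in> verts G \<Longrightarrow> card {e \<in> edges G. v \<in> e} \<le> 10"
    and cnt: "\<And>u k. u \<in> verts G \<Longrightarrow>
      card {v \<in> verts G. card (sym_diff (X u) (X v)) \<le> k} \<le> 8 * 512 ^ k"
  shows "non_expanding (\<lambda>x. 1 / log 2 x * (70 * log 2 (log 2 x))\<^sup>2) G"
  unfolding non_expanding_def
proof (intro allI impI)
  fix H assume "is_subgraph H G \<and> card (verts H) > 2"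
  then have H: "simple_graph H" "verts H \<subseteq> verts G" "edges H \<subseteq> edges G" and t: "card (verts H) > 2"
    by (auto simp: is_subgraph_def)
  have finV: "finite (verts H)" and finG: "finite (verts G)" and fE: "finite (edges H)" "finite (edges G)"
    using H(1) G finite_edges[of H] finite_edges[of G] by (auto simp: simple_graph_def)
  have "2 * card (edges H) = (\<Sum>e\<in>edges H. card {v \<in> verts H. v \<in> e})"
  proof -
    have "card {v \<in> verts H. v \<in> e} = 2" if "e \<in> edges H" for e
    proof -
      have "card e = 2" "e \<subseteq> verts H" using H(1) that by (auto simp: simple_graph_def)
      then show ?thesis by (metis Collect_mem_eq Int_absorb1 Int_def)
    qed
    then show ?thesis by simp
  qed
  also have "\<dots> = (\<Sum>v\<in>verts H. card {e \<in> edges H. v \<in> e})"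
    by (rule sum_multicount_gen) (use finV fE in \<open>auto intro: finV fE\<close>)
  also have "\<dots> \<le> (\<Sum>v\<in>verts H. 10)"
  proof (rule sum_mono)
    fix v assume "v \<in> verts H"
    then have "card {e \<in> edges G. v \<in> e} \<le> 10" using deg H by auto
    moreover have "card {e \<in> edges H. v \<in> e} \<le> card {e \<in> edges G. v \<in> e}"
      using H fE by (intro card_mono) auto
    ultimately show "card {e \<in> edges H. v \<in> e} \<le> 10" by linarith
  qed
  finally have e: "card (edges H) \<le> 5 * card (verts H)" by simp
  have cntH: "card {v \<in> verts H. card (sym_diff (X u) (X v)) \<le> k} \<le> 8 * 512 ^ k" if "u \<in> verts H" for u k
  proof -
    have "card {v \<in> verts H. card (sym_diff (X u) (X v)) \<le> k}
        \<le> card {v \<in> verts G. card (sym_diff (X u) (X v)) \<le> k}"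
      using finG H by (intro card_mono) auto
    then show ?thesis using cnt[of u k] that H by (meson order_trans subsetD)
  qed
  have le: "expansion H \<le> 10" using expansion_le_twice_density[OF H(1) t e] by simp
  have "log 2 (card (verts H)) \<le> 180 / expansion H + 4" if "expansion H > 0"
    by (rule expansion_of_coordinates[where X = X, OF H(1) t _ _ e cntH that]) (use fX flip H in auto)
  then show "expansion H \<le> 1 / log 2 (real (card (verts H))) * (70 * log 2 (log 2 (real (card (verts H)))))\<^sup>2"
    using t le by (intro non_expansion_bound) auto
qed

section \<open>A dense base graph of large girth\<close>

lemma card_nbrs:
  assumes "\<forall>e\<in>E. card e = 2"
  shows "card (nbrs E v) = card {e \<in> E. v \<in> e}"
proof -
  have "bij_betw (\<lambda>u. {v, u}) (nbrs E v) {e \<in> E. v \<in> e}"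
  proof (rule bij_betw_imageI)
    show "inj_on (\<lambda>u. {v, u}) (nbrs E v)" by (auto simp: inj_on_def doubleton_eq_iff)
    show "(\<lambda>u. {v, u}) ` nbrs E v = {e \<in> E. v \<in> e}"
    proof
      show "{e \<in> E. v \<in> e} \<subseteq> (\<lambda>u. {v, u}) ` nbrs E v"
      proof
        fix e assume e: "e \<in> {e \<in> E. v \<in> e}"
        then obtain a b where "e = {a, b}" using assms card_2_iff by (metis (no_types, lifting) mem_Collect_eq)
        then have "e = {v, a} \<or> e = {v, b}" using e by auto
        then show "e \<in> (\<lambda>u. {v, u}) ` nbrs E v" using e by (auto simp: nbrs_def)
      qed
    qed (auto simp: nbrs_def)
  qed
  then show ?thesis by (rule bij_betw_same_card)
qed

lemma handshake:
  assumes "finite V" "finite E" "\<forall>e\<in>E. card e = 2 \<and> e \<subseteq> V"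
  shows "(\<Sum>v\<in>V. card (nbrs E v)) = 2 * card E"
proof -
  have "(\<Sum>v\<in>V. card (nbrs E v)) = (\<Sum>v\<in>V. card {e \<in> E. v \<in> e})"
    using card_nbrs assms(3) by metis
  also have "\<dots> = (\<Sum>e\<in>E. 2)"
  proof (rule sum_multicount_gen[OF assms(1,2)])
    show "\<forall>e\<in>E. card {v \<in> V. v \<in> e} = 2"
      using assms(3) by (metis Collect_mem_eq Int_absorb1 Int_def)
  qed
  finally show ?thesis by simp
qed

text \<open>A greedy argument in the style of Erdos and Sachs. In a graph with the maximum number of
  edges, any two vertices of degree below 8 are at distance less than \<open>g\<close>, as otherwise
  they could be joined. They all lie in one ball of at most \<open>8 ^ g = N / 2\<close> vertices,
  so at least \<open>N / 2\<close> vertices have degree 8.\<close>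

lemma dense_girth_graph:
  assumes g: "g \<ge> 2"
  defines "N \<equiv> 2 * 8 ^ g :: nat"
  shows "\<exists>E. (\<forall>e\<in>E. card e = 2 \<and> e \<subseteq> {..<N}) \<and> girth_ge g E \<and>
    (\<forall>v. card (nbrs E v) \<le> 8) \<and> 2 * N \<le> card E"
proof -
  define P where "P E \<longleftrightarrow> (\<forall>e\<in>E. card e = 2 \<and> e \<subseteq> {..<N}) \<and> girth_ge g E \<and>
    (\<forall>v. card (nbrs E v) \<le> 8)" for E :: "nat set set"
  have "P {}" by (simp add: P_def girth_ge_def nbrs_def)
  moreover have "\<forall>E. P E \<longrightarrow> card E < Suc (card (Pow {..<N}))"
    unfolding less_Suc_eq_le P_def by (intro allI impI card_mono) auto
  ultimately obtain E where E: "P E" and max: "\<And>E'. P E' \<Longrightarrow> card E' \<le> card E"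
    using ex_has_greatest_nat[of P "{}" card "Suc (card (Pow {..<N}))"] by auto
  have two: "\<forall>e\<in>E. card e = 2 \<and> e \<subseteq> {..<N}" and gE: "girth_ge g E" and deg: "\<And>v. card (nbrs E v) \<le> 8"
    using E by (auto simp: P_def)
  have finE: "finite E" by (rule finite_subset[of _ "Pow {..<N}"]) (use two in auto)
  have finN: "finite (nbrs E v)" for v
    by (rule finite_subset[of _ "{..<N}"]) (use two in \<open>auto simp: nbrs_def\<close>)
  define U where "U = {v. v < N \<and> card (nbrs E v) < 8}"
  have reach: "v \<in> (\<Union>l<g. snd ` walk_sets E l u)" if "u \<in> U" "v \<in> U" for u v
  proof -
    consider "u = v" | "{u, v} \<in> E" | "u \<noteq> v" "{u, v} \<notin> E" by blast
    then show ?thesis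
    proof cases
      case 1
      then show ?thesis using g by (intro UN_I[of 0]) auto
    next
      case 2
      then have "({{u, v}}, v) \<in> walk_sets E 1 u" by (auto simp: nbrs_def)
      then show ?thesis using g by (intro UN_I[of 1]) force+
    next
      case 3
      let ?E = "insert {u, v} E"
      have "nbrs ?E x = nbrs E x \<union> (if x = u then {v} else if x = v then {u} else {})" for x
        using 3 by (auto simp: nbrs_def doubleton_eq_iff)
      then have "card (nbrs ?E x) \<le> 8" for x
        using deg[of x] that finN[of x] by (auto simp: U_def card_insert_if)
      moreover have "\<forall>e\<in>?E. card e = 2 \<and> e \<subseteq> {..<N}" using two 3 that by (auto simp: U_def)
      moreover have "\<not> P ?E" using max[of ?E] 3 finE by auto
      ultimately have "\<not> girth_ge g ?E" unfolding P_def by blast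
      then obtain w where w: "w \<subseteq> ?E" "odd_verts w = {}" "w \<noteq> {}" "card w < g"
        by (auto simp: girth_ge_def not_le)
      \<comment> \<open>The short even set must use the new edge, and its remaining edges join
        \<open>u\<close> to \<open>v\<close> in fewer than \<open>g\<close> steps.\<close>
      have uv: "{u, v} \<in> w" using w gE unfolding girth_ge_def by (metis not_le subset_insert)
      have fw: "finite w" using w finE finite_subset by blast
      let ?w = "w - {{u, v}}"
      have wE: "?w \<subseteq> E" using w by auto
      have "odd_verts ?w = {u, v}" using odd_verts_Diff[of w "{{u, v}}"] fw uv w by simp
      then have "odd_verts ?w = sym_diff {u} {v}" using 3 by auto
      then obtain C where C: "C \<subseteq> ?w" "(C, v) \<in> walk_sets ?w (card C) u"
        using trail_in_join[of ?w u v] fw wE two by blast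
      have "(C, v) \<in> walk_sets E (card C) u" using C(2) walk_sets_mono[OF wE] by blast
      moreover have "card C < g"
      proof -
        have "C \<subseteq> w" using C(1) by blast
        then show ?thesis using card_mono[OF fw, of C] w(4) by linarith
      qed
      moreover have "v = snd (C, v)" by simp
      ultimately show ?thesis by blast
    qed
  qed
  have "card U \<le> 8 ^ g"
  proof (cases "U = {}")
    case False
    then obtain u where u: "u \<in> U" by blast
    have fw: "finite (walk_sets E l u)" "card (walk_sets E l u) \<le> 8 ^ l" for l
      using card_walk_sets[of E 8] deg finN by auto
    have "card U \<le> card (\<Union>l<g. snd ` walk_sets E l u)"
      by (rule card_mono) (use fw reach[OF u] in auto)
    also have "\<dots> \<le> (\<Sum>l<g. card (snd ` walk_sets E l u))" by (rule card_UN_le) simp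
    also have "\<dots> \<le> (\<Sum>l<g. 8 ^ l)" by (rule sum_mono, rule order_trans[OF card_image_le]) (use fw in auto)
    also have "\<dots> \<le> 8 ^ g" by (induction g) auto
    finally show ?thesis .
  qed simp
  then have "8 * 8 ^ g \<le> 8 * card ({..<N} - U)"
    using card_Diff_subset[of U "{..<N}"] by (simp add: N_def U_def subset_iff)
  also have "\<dots> = (\<Sum>v\<in>{..<N} - U. 8)" by simp
  also have "\<dots> \<le> (\<Sum>v\<in>{..<N} - U. card (nbrs E v))" by (rule sum_mono) (auto simp: U_def)
  also have "\<dots> \<le> (\<Sum>v\<in>{..<N}. card (nbrs E v))" by (rule sum_mono2) auto
  also have "\<dots> = 2 * card E" by (rule handshake[OF _ finE two]) simp
  finally have "2 * N \<le> card E" by (simp add: N_def)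
  then show ?thesis using two gE deg by blast
qed

lemma girth_ge_subset: "girth_ge g E \<Longrightarrow> E' \<subseteq> E \<Longrightarrow> girth_ge g E'"
  unfolding girth_ge_def by (meson order_trans)

definition crossing :: "'a set set \<Rightarrow> 'a set \<Rightarrow> 'a set set" where
  "crossing E A = {e \<in> E. e \<inter> A \<noteq> {} \<and> \<not> e \<subseteq> A}"

text \<open>Take \<open>W\<close> maximizing (edges inside + 1) / vertices, of least size among the
  maximizers. A proper nonempty part \<open>B\<close> then has fewer than
  \<open>rho * card B - 1\<close> edges inside. Comparing two complementary parts with
  \<open>rho * card W - 1\<close> leaves more than one edge between them: the \<open>+ 1\<close> in
  the ratio is what raises the cut size to two. The whole graph has ratio above 2, so
  \<open>W\<close> inherits the density.\<close>

lemma base_graph_exists: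
  assumes g: "g \<ge> 2"
  shows "\<exists>(V :: nat set) E. finite V \<and> V \<noteq> {} \<and> (\<forall>e\<in>E. card e = 2 \<and> e \<subseteq> V) \<and> girth_ge g E \<and>
    (\<forall>v. card (nbrs E v) \<le> 8) \<and> card V \<le> 2 * 8 ^ g \<and> 2 * card V \<le> card E \<and>
    (\<forall>A\<subset>V. A \<noteq> {} \<longrightarrow> 2 \<le> card (crossing E A))"
proof -
  define N where "N = (2 * 8 ^ g :: nat)"
  obtain E where two: "\<forall>e\<in>E. card e = 2 \<and> e \<subseteq> {..<N}" and gE: "girth_ge g E"
    and deg: "\<And>v. card (nbrs E v) \<le> 8" and m: "2 * N \<le> card E"
    using dense_girth_graph[OF g] unfolding N_def by blast
  have finE: "finite E" by (rule finite_subset[of _ "Pow {..<N}"]) (use two in auto)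
  define EW where "EW W = {e \<in> E. e \<subseteq> W}" for W
  have finW: "finite (EW W)" for W using finE by (simp add: EW_def)
  define ratio where "ratio W = (real (card (EW W)) + 1) / real (card W)" for W
  define Ws where "Ws = Pow {..<N} - {{}}"
  have finWs: "finite Ws" by (simp add: Ws_def)
  have "0 \<in> {..<N}" by (simp add: N_def)
  then have N0: "{..<N} \<in> Ws" unfolding Ws_def by blast
  define rho where "rho = Max (ratio ` Ws)"
  have le_rho: "ratio W \<le> rho" if "W \<in> Ws" for W using that finWs by (simp add: rho_def)
  have "rho \<in> ratio ` Ws" unfolding rho_def using finWs N0 by (intro Max_in) auto
  then obtain W0 where "W0 \<in> Ws \<and> ratio W0 = rho" by auto
  then obtain W where W: "W \<in> Ws" "ratio W = rho"
      and minW: "\<And>W'. W' \<in> Ws \<Longrightarrow> ratio W' = rho \<Longrightarrow> card W \<le> card W'"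
    using ex_has_least_nat[of "\<lambda>W. W \<in> Ws \<and> ratio W = rho" W0 card] by auto
  have fW: "finite W" "W \<noteq> {}" "W \<subseteq> {..<N}" using W finite_subset by (auto simp: Ws_def)
  have cut: "2 \<le> card (crossing (EW W) A)" if A: "A \<subset> W" "A \<noteq> {}" for A
  proof -
    have lt: "real (card (EW B)) + 1 < rho * card B" if B: "B \<subset> W" "B \<noteq> {}" for B
    proof -
      have BW: "B \<in> Ws" using B fW by (auto simp: Ws_def)
      have "card B < card W" using B fW psubset_card_mono by blast
      then have "ratio B \<noteq> rho" using minW[OF BW] by auto
      then have "ratio B < rho" using le_rho[OF BW] by simp
      moreover have "card B > 0" using B fW finite_subset[of B W] by (auto simp: card_gt_0_iff)
      ultimately show ?thesis by (simp add: ratio_def field_simps)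
    qed
    let ?B = "W - A"
    have "?B \<subset> W" "?B \<noteq> {}" using A by auto
    have "EW W = EW A \<union> EW ?B \<union> crossing (EW W) A"
      using A by (auto simp: EW_def crossing_def)
    then have "card (EW W) \<le> card (EW A) + card (EW ?B) + card (crossing (EW W) A)"
      by (metis card_Un_le le_trans add_le_mono1)
    then have "real (card (EW W)) \<le> card (EW A) + card (EW ?B) + card (crossing (EW W) A)"
      by linarith
    moreover have "real (card (EW W)) + 1 = rho * card W"
      using W(2) fW by (simp add: ratio_def field_simps)
    moreover have "rho * card W = rho * card A + rho * card ?B"
    proof -
      have "card W = card A + card ?B"
        using A fW by (metis card_Diff_subset card_mono finite_subset le_add_diff_inverse psubset_imp_subset)
      then show ?thesis by (simp add: distrib_left)
    qed
    ultimately have "real (card (crossing (EW W) A)) > 1"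
      using lt[OF A] lt[OF \<open>?B \<subset> W\<close> \<open>?B \<noteq> {}\<close>] by linarith
    then show ?thesis by simp
  qed
  have "2 * card W \<le> card (EW W)"
  proof -
    have "EW {..<N} = E" using two by (auto simp: EW_def)
    moreover have "N > 0" by (simp add: N_def)
    moreover have "real (card E) \<ge> 2 * real N" using m by linarith
    ultimately have "ratio {..<N} > 2"  by (simp add: ratio_def field_simps)
    then have "ratio W > 2" using le_rho[OF N0] W by simp
    moreover have "card W > 0" using fW by (simp add: card_gt_0_iff)
    ultimately have "real (card (EW W)) + 1 > 2 * real (card W)" by (simp add: ratio_def field_simps)
    then show ?thesis by linarith
  qed
  moreover have "card (nbrs (EW W) v) \<le> 8" for v
  proof -
    have "finite (nbrs E v)" by (rule finite_subset[of _ "{..<N}"]) (use two in \<open>auto simp: nbrs_def\<close>)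
    then have "card (nbrs (EW W) v) \<le> card (nbrs E v)" by (intro card_mono) (auto simp: nbrs_def EW_def)
    then show ?thesis using deg[of v] by linarith
  qed
  moreover have "card W \<le> N" using card_mono[OF _ fW(3)] by simp
  moreover have "girth_ge g (EW W)" by (rule girth_ge_subset[OF gE]) (auto simp: EW_def)
  moreover have "\<forall>e\<in>EW W. card e = 2 \<and> e \<subseteq> W" using two by (auto simp: EW_def)
  ultimately show ?thesis using fW cut unfolding N_def by blast
qed

section \<open>The homology cover of a graph\<close>

lemma sym_diff_assoc: "sym_diff (sym_diff A B) C = sym_diff A (sym_diff B C)" by blast
lemma sym_diff_cancel: "sym_diff (sym_diff A B) B = A" by blast

definition connects :: "'a set set \<Rightarrow> 'a set \<Rightarrow> bool" where
  "connects F V \<longleftrightarrow> (\<forall>A\<subset>V. A \<noteq> {} \<longrightarrow> crossing F A \<noteq> {})"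

definition cover_rel :: "'a set set \<Rightarrow> (('a set set \<times> 'a) \<times> ('a set set \<times> 'a)) set" where
  "cover_rel F = {((x, u), (y, v)). {u, v} \<in> F \<and> y = sym_diff x {{u, v}}}"

lemma sym_cover_rel: "sym (cover_rel F)"
  by (rule symI) (auto simp: cover_rel_def insert_commute)

lemma cover_relI: "{u, v} \<in> F \<Longrightarrow> ((x, u), (sym_diff x {{u, v}}, v)) \<in> cover_rel F"
  unfolding cover_rel_def by blast

text \<open>One base path is lifted to every start label at once, so \<open>P\<close> is chosen
  before \<open>x\<close>. The set of vertices reached this way has no edge leaving it, hence is all
  of \<open>V\<close>.\<close>

lemma base_path:
  assumes con: "connects F V" and F: "\<forall>e\<in>F. card e = 2 \<and> e \<subseteq> V" "finite F" and uv: "u \<in> V" "v \<in> V"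
  shows "\<exists>P\<subseteq>F. odd_verts P = sym_diff {u} {v} \<and> (\<forall>x. ((x, u), (sym_diff x P, v)) \<in> (cover_rel F)\<^sup>*)"
proof -
  define Q where "Q P v \<longleftrightarrow> P \<subseteq> F \<and> odd_verts P = sym_diff {u} {v} \<and>
    (\<forall>x. ((x, u), (sym_diff x P, v)) \<in> (cover_rel F)\<^sup>*)" for P v
  define A where "A = {v \<in> V. \<exists>P. Q P v}"
  have "Q {} u" by (simp add: Q_def)
  then have ne: "A \<noteq> {}" using uv by (auto simp: A_def)
  have "A = V"
  proof (rule ccontr)
    assume "A \<noteq> V"
    then have "A \<subset> V" by (auto simp: A_def)
    then obtain e where e: "e \<in> crossing F A" using con ne unfolding connects_def by blast
    then have eF: "e \<in> F" "e \<inter> A \<noteq> {}" "\<not> e \<subseteq> A" by (auto simp: crossing_def)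
    obtain a b where ab: "e = {a, b}" "a \<noteq> b" using F eF(1) card_2_iff by metis
    have "\<exists>a b. e = {a, b} \<and> a \<noteq> b \<and> a \<in> A \<and> b \<notin> A"
    proof (cases "a \<in> A")
      case True
      then show ?thesis using ab eF(3) by blast
    next
      case False
      then show ?thesis using ab eF(2) by (intro exI[of _ b] exI[of _ a]) blast
    qed
    then obtain a b where ab: "e = {a, b}" "a \<noteq> b" "a \<in> A" "b \<notin> A" by metis
    then obtain P where P: "Q P a" by (auto simp: A_def)
    have PF: "P \<subseteq> F" using P unfolding Q_def by (rule conjunct1)
    have Po: "odd_verts P = sym_diff {u} {a}" using P unfolding Q_def by (rule conjunct2[THEN conjunct1])
    have Pr: "\<forall>x. ((x, u), (sym_diff x P, a)) \<in> (cover_rel F)\<^sup>*"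
      using P unfolding Q_def by (rule conjunct2[THEN conjunct2])
    have fP: "finite P" using PF F(2) by (rule finite_subset)
    have "odd_verts (sym_diff P {{a, b}}) = sym_diff (sym_diff {u} {a}) {a, b}"
      using odd_verts_sym_diff[of P "{{a, b}}"] fP Po by simp
    also have "\<dots> = sym_diff {u} {b}" using ab(2) by auto
    finally have 1: "odd_verts (sym_diff P {{a, b}}) = sym_diff {u} {b}" .
    have 2: "((x, u), (sym_diff x (sym_diff P {{a, b}}), b)) \<in> (cover_rel F)\<^sup>*" for x
    proof -
      have "((x, u), (sym_diff x P, a)) \<in> (cover_rel F)\<^sup>*" using Pr by (rule spec)
      moreover have "((sym_diff x P, a), (sym_diff (sym_diff x P) {{a, b}}, b)) \<in> cover_rel F"
        using eF(1) ab(1) by (intro cover_relI) simp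
      ultimately show ?thesis unfolding sym_diff_assoc by (rule rtrancl_into_rtrancl)
    qed
    have 3: "sym_diff P {{a, b}} \<subseteq> F" using PF eF(1) ab(1) by auto
    have "Q (sym_diff P {{a, b}}) b" unfolding Q_def by (intro conjI allI) (rule 3 1 2)+
    moreover have "b \<in> V" using F eF ab by blast
    ultimately show False using ab(4) by (auto simp: A_def)
  qed
  then have "v \<in> A" using uv(2) by simp
  then show ?thesis unfolding A_def Q_def by blast
qed

text \<open>For \<open>u \<noteq> v\<close>, follow an edge of \<open>w\<close> at \<open>u\<close>
  and recurse on the rest. For \<open>u = v\<close> no edge of \<open>w\<close> need meet
  \<open>u\<close>; then walk to an end \<open>s\<close> of some edge of \<open>w\<close>, run
  through \<open>w\<close> from there, and walk back.\<close>

lemma cover_connected: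
  assumes con: "connects F V" and F: "\<forall>e\<in>F. card e = 2 \<and> e \<subseteq> V" "finite F"
    and "w \<subseteq> F" "odd_verts w = sym_diff {u} {v}" "u \<in> V" "v \<in> V"
  shows "((x, u), (sym_diff x w, v)) \<in> (cover_rel F)\<^sup>*"
  using assms(4-)
proof (induction "card w" arbitrary: w u v x rule: less_induct)
  case less
  have fw: "finite w" using less.prems(1) F(2) by (rule finite_subset)
  have step: "((y, s), (sym_diff y w, v')) \<in> (cover_rel F)\<^sup>*"
    if s: "{s, s'} \<in> w" "odd_verts (w - {{s, s'}}) = sym_diff {s'} {v'}" "v' \<in> V" for s s' v' y
  proof -
    have "s' \<in> V" using s(1) less.prems(1) F by blast
    moreover have "card (w - {{s, s'}}) < card w" using s(1) fw by (intro psubset_card_mono) auto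
    moreover have "w - {{s, s'}} \<subseteq> F" using less.prems(1) by blast
    ultimately have *: "((sym_diff y {{s, s'}}, s'), (sym_diff (sym_diff y {{s, s'}}) (w - {{s, s'}}), v')) \<in> (cover_rel F)\<^sup>*"
      using less.hyps s(2,3) by blast
    have **: "sym_diff (sym_diff y {{s, s'}}) (w - {{s, s'}}) = sym_diff y w" using s(1) by blast
    have "((y, s), (sym_diff y {{s, s'}}, s')) \<in> cover_rel F"
      using s(1) less.prems(1) by (intro cover_relI) blast
    then show ?thesis using * unfolding ** by (rule converse_rtrancl_into_rtrancl)
  qed
  show ?case
  proof (cases "u = v")
    case False
    then have "u \<in> odd_verts w" using less.prems by auto
    moreover have "\<forall>e\<in>w. card e = 2" using less.prems(1) F(1) by blast
    ultimately obtain u' where u': "{u, u'} \<in> w" "u' \<noteq> u"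
      using edge_at_odd[of u w] by metis
    have "odd_verts (w - {{u, u'}}) = sym_diff (sym_diff {u} {v}) {u, u'}"
      using odd_verts_Diff[of w "{{u, u'}}"] u' fw less.prems by simp
    also have "\<dots> = sym_diff {u'} {v}" using False u' by auto
    finally show ?thesis by (rule step[OF u'(1) _ less.prems(4)])
  next
    case True
    show ?thesis
    proof (cases "w = {}")
      case True
      then show ?thesis using \<open>u = v\<close> by simp
    next
      case False
      then obtain e where e: "e \<in> w" by auto
      have "card e = 2" using e less.prems(1) F(1) by blast
      then obtain s s' where ss: "e = {s, s'}" "s \<noteq> s'" using card_2_iff by metis
      have sV: "s \<in> V" using e ss less.prems(1) F(1) by blast
      \<comment> \<open>The walks from \<open>u\<close> to \<open>s\<close> and back flip
        \<open>P\<close> twice, so \<open>w\<close> is the net effect.\<close>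
      obtain P where "\<forall>x. ((x, u), (sym_diff x P, s)) \<in> (cover_rel F)\<^sup>*"
        using base_path[OF con F less.prems(3) sV] by metis
      then have P: "((x, u), (sym_diff x P, s)) \<in> (cover_rel F)\<^sup>*" for x by (rule spec)
      have "odd_verts (w - {{s, s'}}) = {s, s'}"
        using odd_verts_Diff[of w "{{s, s'}}"] e ss fw less.prems \<open>u = v\<close> by simp
      then have o: "odd_verts (w - {{s, s'}}) = sym_diff {s'} {s}" using ss by auto
      have mid: "((sym_diff x P, s), (sym_diff (sym_diff x P) w, s)) \<in> (cover_rel F)\<^sup>*"
        by (rule step[of s s']) (use e ss o sV in auto)
      have "((sym_diff x w, u), (sym_diff (sym_diff x w) P, s)) \<in> (cover_rel F)\<^sup>*" by (rule P)
      then have "((sym_diff (sym_diff x w) P, s), (sym_diff x w, u)) \<in> (cover_rel F)\<^sup>*"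
        by (rule symD[OF sym_rtrancl[OF sym_cover_rel]])
      moreover have "sym_diff (sym_diff x w) P = sym_diff (sym_diff x P) w" by blast
      ultimately show ?thesis using P[of x] mid \<open>u = v\<close> by (metis rtrancl_trans)
    qed
  qed
qed

text \<open>The label sets that walks from \<open>a\<close> to \<open>v\<close> can produce. For a
  connected base graph these are the vertices over \<open>v\<close> in the component of
  \<open>({}, a)\<close>.\<close>

definition fibre :: "'a set set \<Rightarrow> 'a \<Rightarrow> 'a \<Rightarrow> 'a set set set" where
  "fibre E a v = {x. x \<subseteq> E \<and> odd_verts x = sym_diff {a} {v}}"

lemma finite_fibre: "finite E \<Longrightarrow> finite (fibre E a v)"
  by (rule finite_subset[of _ "Pow E"]) (auto simp: fibre_def)

lemma card_fibre:
  assumes con: "connects E V" and E: "\<forall>e\<in>E. card e = 2 \<and> e \<subseteq> V" "finite E" and "a \<in> V" "v \<in> V"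
  shows "card (fibre E a v) = card (even_sets E)"
proof -
  obtain P where P: "P \<subseteq> E" "odd_verts P = sym_diff {a} {v}"
    using base_path[OF con E assms(4,5)] by blast
  have fin: "finite x" if "x \<subseteq> E" for x using that E finite_subset by blast
  have "bij_betw (\<lambda>x. sym_diff x P) (fibre E a v) (even_sets E)"
  proof (rule bij_betw_byWitness[where f' = "\<lambda>x. sym_diff x P"])
    show "(\<lambda>x. sym_diff x P) ` fibre E a v \<subseteq> even_sets E"
    proof
      fix y assume "y \<in> (\<lambda>x. sym_diff x P) ` fibre E a v"
      then obtain x where x: "x \<subseteq> E" "odd_verts x = sym_diff {a} {v}" and y: "y = sym_diff x P"
        by (auto simp: fibre_def)
      have "odd_verts y = {}"
        using odd_verts_sym_diff[OF fin[OF x(1)] fin[OF P(1)]] x P by (simp add: y)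
      then show "y \<in> even_sets E" using x P unfolding y even_sets_def by blast
    qed
    show "(\<lambda>x. sym_diff x P) ` even_sets E \<subseteq> fibre E a v"
    proof
      fix y assume "y \<in> (\<lambda>x. sym_diff x P) ` even_sets E"
      then obtain x where x: "x \<subseteq> E" "odd_verts x = {}" and y: "y = sym_diff x P"
        by (auto simp: even_sets_def)
      have "odd_verts y = sym_diff {a} {v}"
        using odd_verts_sym_diff[OF fin[OF x(1)] fin[OF P(1)]] x P by (simp add: y)
      then show "y \<in> fibre E a v" using x P unfolding y fibre_def by blast
    qed
  qed (simp_all add: sym_diff_cancel)
  then show ?thesis by (rule bij_betw_same_card)
qed

text \<open>The boundary map from edge sets to vertex sets has fibres that are empty or translates
  of the cycle space, as in rank-nullity over two elements.\<close>

lemma many_even_sets: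
  assumes "finite V" and E: "\<forall>e\<in>E. e \<subseteq> V" "finite E"
  shows "2 ^ card E \<le> 2 ^ card V * card (even_sets E)"
proof -
  have fe: "finite (even_sets E)" by (rule finite_subset[of _ "Pow E"]) (use E in \<open>auto simp: even_sets_def\<close>)
  have fin: "finite x" if "x \<subseteq> E" for x using that E finite_subset by blast
  let ?f = "\<lambda>S. {x \<in> Pow E. odd_verts x = S}"
  have "Pow E \<subseteq> (\<Union>S\<in>Pow V. ?f S)"
  proof
    fix x assume x: "x \<in> Pow E"
    have "odd_verts x \<subseteq> V" using x E odd_verts_memD by fastforce
    then show "x \<in> (\<Union>S\<in>Pow V. ?f S)" using x by blast
  qed
  then have "card (Pow E) \<le> card (\<Union>S\<in>Pow V. ?f S)"
    using assms by (intro card_mono) auto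
  also have "\<dots> \<le> (\<Sum>S\<in>Pow V. card (?f S))" by (rule card_UN_le) (use assms in simp)
  also have "\<dots> \<le> (\<Sum>S\<in>Pow V. card (even_sets E))"
  proof (rule sum_mono)
    fix S
    show "card (?f S) \<le> card (even_sets E)"
    proof (cases "?f S = {}")
      case True
      then show ?thesis by (metis card.empty le0)
    next
      case False
      then obtain x0 where x0: "x0 \<subseteq> E" "odd_verts x0 = S" by blast
      have "(\<lambda>x. sym_diff x x0) ` ?f S \<subseteq> even_sets E"
      proof
        fix y assume "y \<in> (\<lambda>x. sym_diff x x0) ` ?f S"
        then obtain x where x: "x \<subseteq> E" "odd_verts x = S" and y: "y = sym_diff x x0" by blast
        have "odd_verts y = {}"
          using odd_verts_sym_diff[OF fin[OF x(1)] fin[OF x0(1)]] x x0 by (simp add: y)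
        then show "y \<in> even_sets E" using x x0 unfolding y even_sets_def by blast
      qed
      moreover have "inj_on (\<lambda>x. sym_diff x x0) (?f S)"
        by (rule inj_on_inverseI[where g = "\<lambda>x. sym_diff x x0"]) (rule sym_diff_cancel)
      ultimately show ?thesis using card_inj_on_le fe by blast
    qed
  qed
  also have "\<dots> = 2 ^ card V * card (even_sets E)" using assms by (simp add: card_Pow)
  finally show ?thesis using E by (simp add: card_Pow)
qed

section \<open>Random labellings of a graph\<close>

primrec probes :: "(nat \<Rightarrow> nat \<Rightarrow> nat option) \<Rightarrow> computation \<Rightarrow> nat list" where
  "probes ask (Answer b) = []"
| "probes ask (Probe v i k) = v # probes ask (k (ask v i))"

lemma result_cong:
  assumes "\<And>l i. l \<in> set (probes ask c) \<Longrightarrow> ask l i = ask' l i"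
  shows "result ask c = result ask' c"
  using assms
proof (induction c)
  case (Probe v i k)
  have eq: "ask v i = ask' v i" by (rule Probe.prems) simp
  have "result ask (k (ask v i)) = result ask' (k (ask v i))"
    by (rule Probe.IH[OF rangeI], rule Probe.prems) simp
  then show ?case using eq by simp
qed simp

text \<open>Being \<open>extensional\<close>, a labelling is determined by its values on
  \<open>V\<close>, so counting this set models a uniformly random labelling.\<close>

definition labelings :: "'v set \<Rightarrow> ('v \<Rightarrow> nat) set" where
  "labelings V = {p \<in> extensional V. bij_betw p V {1..card V}}"

lemma finite_labelings: "finite V \<Longrightarrow> finite (labelings V)"
  by (rule finite_subset[of _ "V \<rightarrow>\<^sub>E {1..card V}"])
    (auto simp: labelings_def PiE_def bij_betw_def finite_PiE[unfolded PiE_def])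

lemma labelings_nonempty:
  assumes "finite V"
  shows "labelings V \<noteq> {}"
proof -
  obtain p where p: "bij_betw p V {1..card V}"
    using finite_same_card_bij[OF assms, of "{1..card V}"] by auto
  then have "restrict p V \<in> labelings V"
    by (auto simp: labelings_def intro: bij_betw_cong[THEN iffD1, of V p])
  then show ?thesis by blast
qed

definition extending :: "'v set \<Rightarrow> 'v set \<Rightarrow> ('v \<Rightarrow> nat) \<Rightarrow> ('v \<Rightarrow> nat) set" where
  "extending V K \<kappa> = {p \<in> labelings V. \<forall>v\<in>K. p v = \<kappa> v}"

definition labelled_ask :: "'v set \<Rightarrow> ('v \<Rightarrow> 'v list) \<Rightarrow> ('v \<Rightarrow> nat) \<Rightarrow> nat \<Rightarrow> nat \<Rightarrow> nat option" where
  "labelled_ask V nb p l i = (let v = inv_into V p l in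
     if l \<in> p ` V \<and> 1 \<le> i \<and> i \<le> length (nb v) then Some (p (nb v ! (i - 1))) else None)"

lemma extending_transpose:
  assumes p: "p \<in> extending V K \<kappa>" and v: "v \<in> V - K" "v' \<in> V - K"
  shows "p \<circ> Transposition.transpose v v' \<in> extending V K \<kappa>"
proof -
  have "bij_betw (Transposition.transpose v v') V V"
    using v by (metis DiffD1 bij_betw_transpose_iff transpose_image_eq bij_betw_def inj_on_transpose)
  then have "bij_betw (p \<circ> Transposition.transpose v v') V {1..card V}"
    using p bij_betw_trans by (auto simp: extending_def labelings_def)
  moreover have "p \<circ> Transposition.transpose v v' \<in> extensional V"
  proof (unfold extensional_def, intro CollectI allI impI)
    fix x assume "x \<notin> V"
    moreover then have "Transposition.transpose v v' x = x" using v by (intro transpose_apply_other) auto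
    ultimately show "(p \<circ> Transposition.transpose v v') x = undefined"
      using p by (auto simp: extending_def labelings_def extensional_def)
  qed
  moreover have "(p \<circ> Transposition.transpose v v') x = \<kappa> x" if "x \<in> K" for x
  proof -
    have "Transposition.transpose v v' x = x" using v that by (intro transpose_apply_other) auto
    then show ?thesis using p that by (auto simp: extending_def)
  qed
  ultimately show ?thesis by (auto simp: extending_def labelings_def)
qed

text \<open>Swapping two vertices with unrevealed labels maps the compatible labellings to each
  other. Used in both directions, this makes an unrevealed label equally likely at every remaining
  vertex.\<close>

lemma card_fresh_le:
  assumes "finite V" "v \<in> V - K" "v' \<in> V - K"
  shows "card {p \<in> extending V K \<kappa>. p v = l} \<le> card {p \<in> extending V K \<kappa>. p v' = l}"
proof (rule card_inj_on_le)
  show "inj_on (\<lambda>p. p \<circ> Transposition.transpose v v') {p \<in> extending V K \<kappa>. p v = l}"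
    by (rule inj_on_inverseI[where g = "\<lambda>p. p \<circ> Transposition.transpose v v'"])
      (simp add: comp_assoc)
  show "(\<lambda>p. p \<circ> Transposition.transpose v v') ` {p \<in> extending V K \<kappa>. p v = l} \<subseteq> {p \<in> extending V K \<kappa>. p v' = l}"
    using extending_transpose assms by fastforce
  show "finite {p \<in> extending V K \<kappa>. p v' = l}"
    using finite_labelings[OF assms(1)] by (simp add: extending_def)
qed

lemma extending_insert:
  assumes "v \<notin> K"
  shows "extending V (insert v K) (\<kappa>(v := l)) = {p \<in> extending V K \<kappa>. p v = l}"
  using assms by (auto simp: extending_def)

text \<open>
  The labels revealed so far are fixed to be \<open>\<kappa>\<close> on \<open>K\<close>, and \<open>D s\<close> is what must be avoided with
  \<open>s\<close> probes left. The only way to get into it is through a label not revealed before, and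
  such a label sits at a uniformly random remaining vertex.
\<close>

lemma card_hitting_le:
  fixes b kmax q :: nat
  assumes finV: "finite V" and nbV: "\<And>v. v \<in> V \<Longrightarrow> set (nb v) \<subseteq> V"
    and Dmono: "\<And>j. D j \<subseteq> D (Suc j)" and DV: "\<And>j. D j \<subseteq> V"
    and Dnb: "\<And>j v w. v \<in> V \<Longrightarrow> v \<notin> D (Suc j) \<Longrightarrow> w \<in> set (nb v) \<Longrightarrow> w \<notin> D j"
    and Db: "card (D q) \<le> b" and kmax: "kmax < card V"
    and "K \<subseteq> V" "card K + 2 * s \<le> kmax" "K \<inter> D s = {}" "s \<le> q"
    and "\<And>p. p \<in> extending V K \<kappa> \<Longrightarrow> length (replies (labelled_ask V nb p) c) \<le> s"
  shows "card {p \<in> extending V K \<kappa>. \<exists>l\<in>set (probes (labelled_ask V nb p) c). l \<in> p ` D 0}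
    \<le> s * (b / (card V - kmax)) * card (extending V K \<kappa>)"
  using assms(8-)
proof (induction c arbitrary: K \<kappa> s)
  case (Answer x)
  then show ?case by simp
next
  case (Probe l i k)
  let ?ask = "labelled_ask V nb"
  define \<beta> where "\<beta> = real b / real (card V - kmax)"
  have \<beta>0: "\<beta> \<ge> 0" by (simp add: \<beta>_def)
  define hits where "hits p c \<longleftrightarrow> (\<exists>l\<in>set (probes (?ask p) c). l \<in> p ` D 0)" for p c
  have finX: "finite (extending V K \<kappa>)" for K \<kappa>
    using finite_labelings[OF finV] by (simp add: extending_def)
  have IH: "card {p \<in> extending V K \<kappa>. hits p (k x)} \<le> s * \<beta> * card (extending V K \<kappa>)"
    if "K \<subseteq> V" "card K + 2 * s \<le> kmax" "K \<inter> D s = {}" "s \<le> q"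
      "\<And>p. p \<in> extending V K \<kappa> \<Longrightarrow> length (replies (?ask p) (k x)) \<le> s" for x K \<kappa> s
    using Probe.IH[OF rangeI that(1-4), of \<kappa> x] that(5) unfolding hits_def \<beta>_def by blast
  have Dle: "D j \<subseteq> D j'" if "j \<le> j'" for j j' using lift_Suc_mono_le[of D] Dmono that by blast
  \<comment> \<open>Total probability over the label \<open>j\<close> of \<open>w\<close>: a bound
    valid for every \<open>j\<close> is valid without revealing it.\<close>
  have split: "card {p \<in> extending V K \<kappa>. hits p c} \<le> r * card (extending V K \<kappa>)"
    if w: "w \<in> V" "w \<notin> K" and each: "\<And>j. card {p \<in> extending V (insert w K) (\<kappa>(w := j)). hits p c}
      \<le> r * card (extending V (insert w K) (\<kappa>(w := j)))" for w K \<kappa> c and r :: real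
  proof -
    let ?Q = "extending V K \<kappa>"
    let ?I = "{1..card V}"
    have in_I: "p w \<in> ?I" if "p \<in> ?Q" for p
      using that w bij_betwE[of p V ?I] by (simp add: extending_def labelings_def)
    have "{p \<in> ?Q. hits p c} = (\<Union>j\<in>?I. {p \<in> ?Q. p w = j \<and> hits p c})" using in_I by blast
    then have "card {p \<in> ?Q. hits p c} = (\<Sum>j\<in>?I. card {p \<in> ?Q. p w = j \<and> hits p c})"
      using finX by (simp only: , subst card_UN_disjoint) auto
    also have "\<dots> = (\<Sum>j\<in>?I. card {p \<in> extending V (insert w K) (\<kappa>(w := j)). hits p c})"
      unfolding extending_insert[OF w(2)] by (simp add: conj_assoc)
    finally have "real (card {p \<in> ?Q. hits p c}) = (\<Sum>j\<in>?I. real (card {p \<in> extending V (insert w K) (\<kappa>(w := j)). hits p c}))"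
      by simp
    also have "\<dots> \<le> (\<Sum>j\<in>?I. r * card (extending V (insert w K) (\<kappa>(w := j))))"
      by (rule sum_mono) (rule each)
    also have "\<dots> = r * (\<Sum>j\<in>?I. card {p \<in> ?Q. p w = j})"
      unfolding extending_insert[OF w(2)] by (simp add: sum_distrib_left)
    also have "(\<Sum>j\<in>?I. card {p \<in> ?Q. p w = j}) = card (\<Union>j\<in>?I. {p \<in> ?Q. p w = j})"
      by (rule card_UN_disjoint[symmetric]) (use finX in auto)
    also have "(\<Union>j\<in>?I. {p \<in> ?Q. p w = j}) = ?Q" using in_I by blast
    finally show ?thesis .
  qed
  \<comment> \<open>A probe at a revealed vertex cannot hit: the vertex is outside
    \<open>D (Suc s)\<close>, so the neighbour in the reply is outside \<open>D s\<close>, and it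
    simply joins the revealed vertices.\<close>
  have known: "card {p \<in> extending V K \<kappa>. hits p (Probe l i k)} \<le> s * \<beta> * card (extending V K \<kappa>)"
    if K: "K \<subseteq> V" "card K + 1 + 2 * s \<le> kmax" "K \<inter> D (Suc s) = {}" "s \<le> q" "v \<in> K" "\<kappa> v = l"
      and len: "\<And>p. p \<in> extending V K \<kappa> \<Longrightarrow> length (replies (?ask p) (Probe l i k)) \<le> Suc s"
    for K \<kappa> s v
  proof -
    let ?Q = "extending V K \<kappa>"
    have fK: "finite K" using K(1) finV finite_subset by blast
    have vV: "v \<in> V" using K by blast
    define w where "w = nb v ! (i - 1)"
    define ok where "ok \<longleftrightarrow> 1 \<le> i \<and> i \<le> length (nb v)"
    have ask: "?ask p l i = (if ok then Some (p w) else None)" if p: "p \<in> ?Q" for p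
    proof -
      have "p v = l" using p K by (auto simp: extending_def)
      moreover have "inj_on p V" using p by (auto simp: extending_def labelings_def bij_betw_def)
      ultimately have "inv_into V p l = v" "l \<in> p ` V" using vV by auto
      then show ?thesis by (auto simp: labelled_ask_def w_def ok_def)
    qed
    have noth: "l \<notin> p ` D 0" if p: "p \<in> ?Q" for p
    proof
      assume "l \<in> p ` D 0"
      then obtain u where u: "u \<in> D 0" "p u = l" by blast
      have "p v = l" using p K by (auto simp: extending_def)
      moreover have "inj_on p V" using p by (auto simp: extending_def labelings_def bij_betw_def)
      ultimately have "u = v" using u DV vV by (metis inj_onD subsetD)
      then show False using u K Dle[of 0 "Suc s"] by blast
    qed
    have red: "hits p (Probe l i k) \<longleftrightarrow> hits p (k (if ok then Some (p w) else None))" if "p \<in> ?Q" for p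
      using noth[OF that] ask[OF that] by (simp add: hits_def)
    have len': "length (replies (?ask p) (k (if ok then Some (p w) else None))) \<le> s" if "p \<in> ?Q" for p
      using len[OF that] ask[OF that] by simp
    have KD: "K \<inter> D s = {}" using K(3) Dmono by blast
    show ?thesis
    proof (cases ok)
      case False
      have "{p \<in> ?Q. hits p (Probe l i k)} = {p \<in> ?Q. hits p (k None)}" using red False by auto
      moreover have "card {p \<in> ?Q. hits p (k None)} \<le> s * \<beta> * card ?Q"
        by (rule IH) (use K KD len' False in auto)
      ultimately show ?thesis by simp
    next
      case True
      then have wn: "w \<in> set (nb v)" by (auto simp: w_def ok_def)
      then have wV: "w \<in> V" using nbV vV by blast
      have "v \<notin> D (Suc s)" using K by blast
      then have wD: "w \<notin> D s" using Dnb vV wn by blast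
      have Q: "{p \<in> ?Q. hits p (Probe l i k)} = {p \<in> ?Q. hits p (k (Some (p w)))}" using red True by auto
      show ?thesis
      proof (cases "w \<in> K")
        case wK: True
        then have pw: "p w = \<kappa> w" if "p \<in> ?Q" for p using that by (auto simp: extending_def)
        then have "{p \<in> ?Q. hits p (k (Some (p w)))} = {p \<in> ?Q. hits p (k (Some (\<kappa> w)))}" by auto
        moreover have "card {p \<in> ?Q. hits p (k (Some (\<kappa> w)))} \<le> s * \<beta> * card ?Q"
          by (rule IH) (use K KD len' True pw in auto)
        ultimately show ?thesis using Q by simp
      next
        case wK: False
        show ?thesis
        proof (rule split[OF wV wK])
          fix j
          let ?Qj = "extending V (insert w K) (\<kappa>(w := j))"
          have sub: "p \<in> ?Q \<and> p w = j" if "p \<in> ?Qj" for p using that extending_insert[OF wK] by auto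
          have "{p \<in> ?Qj. hits p (Probe l i k)} = {p \<in> ?Qj. hits p (k (Some j))}"
            using red sub True by auto
          moreover have "card {p \<in> ?Qj. hits p (k (Some j))} \<le> s * \<beta> * card ?Qj"
          proof (rule IH)
            show "length (replies (?ask p) (k (Some j))) \<le> s" if "p \<in> ?Qj" for p
              using len'[of p] sub[OF that] True by simp
          qed (use K KD wD wK wV fK in auto)
          ultimately show "card {p \<in> ?Qj. hits p (Probe l i k)} \<le> s * \<beta> * card ?Qj" by simp
        qed
      qed
    qed
  qed
  let ?Q = "extending V K \<kappa>"
  have "card {p \<in> ?Q. hits p (Probe l i k)} \<le> s * \<beta> * card ?Q"
  proof (cases "?Q = {}")
    case False
    then obtain p0 where "p0 \<in> ?Q" by blast
    then have "s \<noteq> 0" using Probe.prems(5)[of p0] by auto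
    then obtain s' where s: "s = Suc s'" by (cases s) auto
    have fK: "finite K" using Probe.prems(1) finV finite_subset by blast
    have KD: "K \<inter> D s' = {}" using Probe.prems(3) Dmono s by blast
    have up: "s' * \<beta> * card ?Q \<le> s * \<beta> * card ?Q"
      using \<beta>0 by (intro mult_right_mono) (auto simp: s)
    consider "l \<notin> {1..card V}" | "l \<in> \<kappa> ` K" | "l \<in> {1..card V}" "l \<notin> \<kappa> ` K" by blast
    then show ?thesis
    proof cases
      case 1
      have lV: "l \<notin> p ` V" if "p \<in> ?Q" for p
        using that 1 by (auto simp: extending_def labelings_def bij_betw_def)
      then have n: "?ask p l i = None" if "p \<in> ?Q" for p
        using that by (auto simp: labelled_ask_def)
      have "hits p (Probe l i k) = hits p (k None)" if "p \<in> ?Q" for p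
        using n[OF that] lV[OF that] DV[of 0] by (auto simp: hits_def)
      then have "{p \<in> ?Q. hits p (Probe l i k)} = {p \<in> ?Q. hits p (k None)}" by blast
      moreover have "card {p \<in> ?Q. hits p (k None)} \<le> s' * \<beta> * card ?Q"
      proof (rule IH)
        show "length (replies (?ask p) (k None)) \<le> s'" if "p \<in> ?Q" for p
          using Probe.prems(5)[OF that] n[OF that] by (simp add: s)
      qed (use Probe.prems s KD in auto)
      ultimately show ?thesis using up by simp
    next
      case 2
      then obtain v where "v \<in> K" "\<kappa> v = l" by blast
      then have "card {p \<in> ?Q. hits p (Probe l i k)} \<le> s' * \<beta> * card ?Q"
        using Probe.prems unfolding s by (intro known[of K s' v \<kappa>]) auto
      then show ?thesis using up by simp
    next
      \<comment> \<open>A fresh label may reveal two vertices, its own and the one in the reply,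
        hence the budget \<open>card K + 2 * s\<close>. Its position is uniform on
        \<open>V - K\<close>. Positions in \<open>D s\<close>, at most \<open>b\<close> of them, are
        given up as hits; elsewhere the vertex is added to \<open>K\<close> and the step for
        revealed vertices applies.\<close>
      case 3
      let ?X = "V - K"
      let ?Qv = "\<lambda>v. extending V (insert v K) (\<kappa>(v := l))"
      have Qv: "?Qv v = {p \<in> ?Q. p v = l}" if "v \<in> ?X" for v using extending_insert[of v K] that by blast
      have ex: "\<exists>v\<in>?X. p v = l" if "p \<in> ?Q" for p
      proof -
        have "l \<in> p ` V" using that 3 by (auto simp: extending_def labelings_def bij_betw_def)
        then obtain v where "v \<in> V" "p v = l" by blast
        moreover have "v \<notin> K" using 3(2) that \<open>p v = l\<close> by (auto simp: extending_def)
        ultimately show ?thesis by blast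
      qed
      have inj: "v = v'" if "p \<in> ?Q" "p v = l" "p v' = l" "v \<in> V" "v' \<in> V" for p v v'
        using that by (auto simp: extending_def labelings_def bij_betw_def inj_on_def)
      have finXX: "finite ?X" using finV by simp
      have kk: "card K \<le> kmax" using Probe.prems(2) by simp
      then have "card K < card V" using kmax by simp
      then have Xne: "?X \<noteq> {}" using fK card_mono[of K V] by (metis Diff_eq_empty_iff not_le)
      then obtain v1 where v1: "v1 \<in> ?X" by blast
      define N1 where "N1 = card (?Qv v1)"
      have N1: "card (?Qv v) = N1" if "v \<in> ?X" for v
        unfolding N1_def Qv[OF that] Qv[OF v1]
        using card_fresh_le[OF finV that v1] card_fresh_le[OF finV v1 that] by (rule antisym)
      have "?Q = (\<Union>v\<in>?X. ?Qv v)" using ex Qv by blast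
      moreover have "card (\<Union>v\<in>?X. ?Qv v) = (\<Sum>v\<in>?X. card (?Qv v))"
      proof (rule card_UN_disjoint[OF finXX])
        show "\<forall>v\<in>?X. \<forall>v'\<in>?X. v \<noteq> v' \<longrightarrow> ?Qv v \<inter> ?Qv v' = {}"
        proof (intro ballI impI)
          fix v v' assume "v \<in> ?X" "v' \<in> ?X" "v \<noteq> v'"
          then show "?Qv v \<inter> ?Qv v' = {}" using Qv[of v] Qv[of v'] inj[of _ v v'] by blast
        qed
      qed (use finX in auto)
      ultimately have cQ: "card ?Q = card ?X * N1" using N1 by simp
      have cX: "card V - kmax \<le> card ?X" using fK kk Probe.prems(1) by (simp add: card_Diff_subset)
      let ?h = "\<lambda>v. card {p \<in> ?Qv v. hits p (Probe l i k)}"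
      have "{p \<in> ?Q. hits p (Probe l i k)} = (\<Union>v\<in>?X. {p \<in> ?Qv v. hits p (Probe l i k)})"
        using ex Qv by blast
      then have "card {p \<in> ?Q. hits p (Probe l i k)} = card (\<Union>v\<in>?X. {p \<in> ?Qv v. hits p (Probe l i k)})"
        by (rule arg_cong)
      also have "\<dots> \<le> (\<Sum>v\<in>?X. ?h v)"
        by (rule card_UN_le[OF finXX])
      also have "(\<Sum>v\<in>?X. ?h v) = (\<Sum>v\<in>?X \<inter> D s. ?h v) + (\<Sum>v\<in>?X - D s. ?h v)"
        using finXX by (subst sum.Int_Diff[of _ _ "D s"]) auto
      finally have "real (card {p \<in> ?Q. hits p (Probe l i k)})
          \<le> real ((\<Sum>v\<in>?X \<inter> D s. ?h v) + (\<Sum>v\<in>?X - D s. ?h v))"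
        by (simp only: of_nat_le_iff)
      also have "\<dots> = (\<Sum>v\<in>?X \<inter> D s. real (?h v)) + (\<Sum>v\<in>?X - D s. real (?h v))"
        by (simp only: of_nat_add of_nat_sum)
      also have "(\<Sum>v\<in>?X \<inter> D s. real (?h v)) \<le> (\<Sum>v\<in>?X \<inter> D s. real N1)"
      proof (rule sum_mono)
        fix v assume v: "v \<in> ?X \<inter> D s"
        have "?h v \<le> card (?Qv v)" by (rule card_mono[OF finX]) blast
        then show "real (?h v) \<le> real N1" using N1[of v] v by simp
      qed
      also have "\<dots> \<le> b * N1"
      proof -
        have "card (?X \<inter> D s) \<le> card (D q)"
        proof (rule card_mono)
          show "finite (D q)" using DV finV by (rule finite_subset)
          show "?X \<inter> D s \<subseteq> D q" using Dle[OF Probe.prems(4)] by blast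
        qed
        then have "card (?X \<inter> D s) \<le> b" using Db by simp
        then show ?thesis by (simp add: mult_right_mono)
      qed
      also have "real (b * N1) \<le> \<beta> * card ?Q"
      proof -
        have pos: "real (card V - kmax) > 0" using kmax by simp
        have "real (b * N1) = \<beta> * (real (card V - kmax) * N1)" using pos by (simp add: \<beta>_def)
        also have "\<dots> \<le> \<beta> * card ?Q"
          unfolding cQ using cX \<beta>0 by (intro mult_left_mono) (simp_all add: mult_right_mono del: of_nat_diff)
        finally show ?thesis .
      qed
      also have "(\<Sum>v\<in>?X - D s. real (?h v)) \<le> (\<Sum>v\<in>?X - D s. s' * \<beta> * N1)"
      proof (rule sum_mono)
        fix v assume v: "v \<in> ?X - D s"
        have "?h v \<le> s' * \<beta> * card (?Qv v)"
        proof (rule known[of "insert v K" s' v])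
          show "length (replies (?ask p) (Probe l i k)) \<le> Suc s'" if "p \<in> ?Qv v" for p
            using Probe.prems(5)[of p] that Qv[of v] v s by auto
        qed (use Probe.prems v fK s in auto)
        then show "real (?h v) \<le> s' * \<beta> * N1" using N1[of v] v by simp
      qed
      also have "\<dots> \<le> s' * \<beta> * card ?Q"
      proof -
        have "card (?X - D s) \<le> card ?X" using finXX by (intro card_mono) auto
        then have "real (card (?X - D s)) * (s' * \<beta> * N1) \<le> real (card ?X) * (s' * \<beta> * N1)"
          using \<beta>0 by (intro mult_right_mono) auto
        then show ?thesis unfolding cQ by (simp add: mult_ac)
      qed
      finally have "real (card {p \<in> ?Q. hits p (Probe l i k)}) \<le> \<beta> * card ?Q + s' * \<beta> * card ?Q"
        by simp
      then show ?thesis by (simp add: s distrib_right)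
    qed
  qed simp
  then show ?case unfolding hits_def \<beta>_def .
qed

section \<open>Edges that look like a bridge\<close>

definition relabel :: "('v \<Rightarrow> nat) \<Rightarrow> 'v ugraph \<Rightarrow> nat ugraph" where
  "relabel p G = ({1..card (verts G)}, (\<lambda>e. p ` e) ` edges G)"

lemma relabel_in_family:
  assumes G: "simple_graph G" and enc: "inj_on enc (verts G)" and p: "p \<in> labelings (verts G)"
    and L: "represents L (relabel p G)"
  shows "(relabel p G, L) \<in> isomorphic_family (enc ` verts G, (\<lambda>e. enc ` e) ` edges G)"
proof -
  let ?V = "verts G"
  let ?\<pi> = "p \<circ> inv_into ?V enc"
  have "bij_betw (inv_into ?V enc) (enc ` ?V) ?V"
    using enc by (simp add: bij_betw_inv_into inj_on_imp_bij_betw)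
  then have "bij_betw ?\<pi> (enc ` ?V) {1..card (enc ` ?V)}"
    using p bij_betw_trans card_image[OF enc] by (fastforce simp: labelings_def)
  moreover have "?\<pi> ` enc ` e = p ` e" if "e \<in> edges G" for e
  proof -
    have "e \<subseteq> ?V" using G that by (auto simp: simple_graph_def)
    then show ?thesis using enc by (force simp: image_comp inv_into_f_f subset_iff intro!: image_cong)
  qed
  then have "(\<lambda>e. ?\<pi> ` e) ` (\<lambda>e. enc ` e) ` edges G = (\<lambda>e. p ` e) ` edges G"
    by (simp add: image_image)
  then have "relabel p G = ({1..card (enc ` ?V)}, (\<lambda>e. ?\<pi> ` e) ` (\<lambda>e. enc ` e) ` edges G)"
    by (simp only: relabel_def card_image[OF enc])
  ultimately show ?thesis
    unfolding isomorphic_family_def mem_Collect_eq prod.case fst_conv snd_conv using L by blast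
qed

lemma relabel_nbrs:
  assumes G: "simple_graph G" and p: "inj_on p (verts G)" and v: "v \<in> verts G"
  shows "{u. {p v, u} \<in> edges (relabel p G)} = p ` nbrs (edges G) v"
proof
  show "p ` nbrs (edges G) v \<subseteq> {u. {p v, u} \<in> edges (relabel p G)}"
  proof
    fix u assume "u \<in> p ` nbrs (edges G) v"
    then obtain w where "u = p w" "{v, w} \<in> edges G" by (auto simp: nbrs_def)
    then have "p ` {v, w} \<in> edges (relabel p G)" unfolding relabel_def snd_conv by (intro imageI)
    then show "u \<in> {u. {p v, u} \<in> edges (relabel p G)}" using \<open>u = p w\<close> by simp
  qed
  show "{u. {p v, u} \<in> edges (relabel p G)} \<subseteq> p ` nbrs (edges G) v"
  proof
    fix u assume "u \<in> {u. {p v, u} \<in> edges (relabel p G)}"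
    then obtain e where e: "e \<in> edges G" "{p v, u} = p ` e" by (auto simp: relabel_def)
    have eV: "e \<subseteq> verts G" "card e = 2" using G e by (auto simp: simple_graph_def)
    have "p v \<in> p ` e" using e(2) by blast
    then have "v \<in> e" using p v eV(1) by (metis inj_on_image_mem_iff)
    then obtain w where w: "e = {v, w}" using eV(2) by (auto simp: card_2_iff)
    then have "u = p w" if "p v \<noteq> p w" using e(2) that by (auto simp: doubleton_eq_iff)
    moreover have "p v \<noteq> p w" using w eV p v by (auto simp: inj_on_def card_2_iff doubleton_eq_iff)
    ultimately show "u \<in> p ` nbrs (edges G) v" using e(1) w by (auto simp: nbrs_def)
  qed
qed

lemma labelingsD:
  assumes "p \<in> labelings V"
  shows "inj_on p V" "p ` V = {1..card V}"
  using assms by (auto simp: labelings_def bij_betw_def)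

definition listing :: "'v ugraph \<Rightarrow> ('v \<Rightarrow> 'v list) \<Rightarrow> bool" where
  "listing G nb \<longleftrightarrow> (\<forall>v\<in>verts G. distinct (nb v) \<and> set (nb v) = nbrs (edges G) v)"

definition transported :: "'v set \<Rightarrow> ('v \<Rightarrow> 'v list) \<Rightarrow> ('v \<Rightarrow> nat) \<Rightarrow> incidence_lists" where
  "transported V nb p l = map p (nb (inv_into V p l))"

lemma nbrs_subset: "simple_graph G \<Longrightarrow> nbrs (edges G) v \<subseteq> verts G"
  by (auto simp: nbrs_def simple_graph_def)

lemma represents_transported:
  assumes G: "simple_graph G" and nb: "listing G nb" and p: "p \<in> labelings (verts G)"
  shows "represents (transported (verts G) nb p) (relabel p G)"
  unfolding represents_def
proof (rule ballI)
  fix l assume "l \<in> verts (relabel p G)"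
  then have "l \<in> p ` verts G" unfolding labelingsD(2)[OF p] by (simp add: relabel_def)
  then obtain v where v: "v \<in> verts G" "l = p v" by blast
  then have t: "transported (verts G) nb p l = map p (nb v)"
    using labelingsD(1)[OF p] by (simp add: transported_def)
  have "set (nb v) \<subseteq> verts G" using nb v nbrs_subset[OF G] by (auto simp: listing_def)
  then have "inj_on p (set (nb v))" using labelingsD(1)[OF p] inj_on_subset by blast
  then show "distinct (transported (verts G) nb p l) \<and>
      set (transported (verts G) nb p l) = {u. {l, u} \<in> edges (relabel p G)}"
    using relabel_nbrs[OF G labelingsD(1)[OF p] v(1)] nb v unfolding t
    by (simp add: distinct_map listing_def)
qed

lemma neighbour_query_transported:
  assumes p: "p \<in> labelings (verts G)"
  shows "neighbour_query (relabel p G) (transported (verts G) nb p) = labelled_ask (verts G) nb p"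
  using labelingsD(2)[OF p]
  by (intro ext) (auto simp: neighbour_query_def relabel_def labelled_ask_def transported_def Let_def)

lemma connected_pullback:
  assumes G: "simple_graph G" and p: "inj_on p (verts G)" "p ` verts G = {1..card (verts G)}"
    and F: "F \<subseteq> edges (relabel p G)" and con: "graph_connected (verts (relabel p G), F)"
  shows "graph_connected (verts G, {e \<in> edges G. p ` e \<in> F})"
proof -
  let ?F = "{e \<in> edges G. p ` e \<in> F}"
  have ind: "\<exists>w\<in>verts G. b = p w \<and> (u, w) \<in> {(x, y). {x, y} \<in> ?F}\<^sup>*"
    if "(p u, b) \<in> {(x, y). {x, y} \<in> F}\<^sup>*" "u \<in> verts G" for u b
    using that
  proof (induction rule: rtrancl_induct)
    case (step b c)
    then obtain w where w: "w \<in> verts G" "b = p w" "(u, w) \<in> {(x, y). {x, y} \<in> ?F}\<^sup>*" by blast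
    have "{p w, c} \<in> F" using step w by simp
    then have "c \<in> {u. {p w, u} \<in> edges (relabel p G)}" using F by blast
    then obtain x where x: "c = p x" "{w, x} \<in> edges G"
      using relabel_nbrs[OF G p(1) w(1)] by (auto simp: nbrs_def)
    have "{w, x} \<in> ?F" using x \<open>{p w, c} \<in> F\<close> by simp
    then have "(u, x) \<in> {(x, y). {x, y} \<in> ?F}\<^sup>*" using w(3) by (simp add: rtrancl.rtrancl_into_rtrancl)
    moreover have "x \<in> verts G" using x G by (auto simp: simple_graph_def)
    ultimately show ?case using x by blast
  qed blast
  show ?thesis unfolding graph_connected_def fst_conv snd_conv
  proof (intro ballI)
    fix u v assume uv: "u \<in> verts G" "v \<in> verts G"
    have "p u \<in> {1..card (verts G)}" "p v \<in> {1..card (verts G)}" using uv p(2) by blast+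
    then have "(p u, p v) \<in> {(x, y). {x, y} \<in> F}\<^sup>*"
      using con by (simp add: graph_connected_def relabel_def)
    then obtain w where "w \<in> verts G" "p v = p w" "(u, w) \<in> {(x, y). {x, y} \<in> ?F}\<^sup>*"
      using ind uv by blast
    then show "(u, v) \<in> {(x, y). {x, y} \<in> ?F}\<^sup>*" using p uv by (auto dest: inj_onD)
  qed
qed

text \<open>
  The labelling \<open>p \<circ> \<theta>\<close> puts the bridge \<open>{y0, z0}\<close> where \<open>p\<close> puts \<open>{y, z}\<close>, and incidence lists can be
  chosen such that a run which avoids the labels of \<open>D0\<close> gets the same replies for both labellings.
\<close>

lemma kept_if_not_hit:
  assumes G: "simple_graph G" and nb: "listing G nb" and p: "p \<in> labelings (verts G)"
    and works: "\<And>p L. p \<in> labelings (verts G) \<Longrightarrow> represents L (relabel p G) \<Longrightarrow>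
      \<exists>F\<subseteq>edges (relabel p G). provides_access q (relabel p G) L B F \<and>
        graph_connected (verts (relabel p G), F)"
    and \<theta>: "\<And>v. v \<in> verts G \<Longrightarrow> \<theta> v \<in> verts G \<and> \<theta> (\<theta> v) = v"
    and yz: "y0 \<in> verts G" "z0 \<in> verts G" "\<theta> y0 = y" "\<theta> z0 = z"
    and e0: "{y0, z0} \<in> edges G"
    and bridge: "\<And>F. F \<subseteq> edges G \<Longrightarrow> graph_connected (verts G, F) \<Longrightarrow> {y0, z0} \<in> F"
    and D0: "\<And>v. v \<in> verts G \<Longrightarrow> v \<notin> D0 \<Longrightarrow> nbrs (edges G) v = \<theta> ` nbrs (edges G) (\<theta> v)"
    and nohit: "\<And>l. l \<in> set (probes (labelled_ask (verts G) nb p) (B [] (p y, p z))) \<Longrightarrow> l \<notin> p ` D0"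
  shows "result (labelled_ask (verts G) nb p) (B [] (p y, p z))"
proof -
  let ?V = "verts G" and ?E = "edges G" and ?c = "B [] (p y, p z)"
  define p' where "p' = restrict (p \<circ> \<theta>) ?V"
  have injp: "inj_on p ?V" and imp: "p ` ?V = {1..card ?V}" using labelingsD[OF p] by auto
  have "bij_betw \<theta> ?V ?V" by (rule bij_betw_byWitness[where f' = \<theta>]) (use \<theta> in auto)
  then have "bij_betw (p \<circ> \<theta>) ?V {1..card ?V}"
    using p bij_betw_trans by (auto simp: labelings_def)
  then have p': "p' \<in> labelings ?V"
    unfolding labelings_def p'_def by (simp add: bij_betw_cong[of ?V "restrict (p \<circ> \<theta>) ?V" "p \<circ> \<theta>"])
  have p'v: "p' v = p (\<theta> v)" if "v \<in> ?V" for v using that by (simp add: p'_def)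
  let ?H = "relabel p' G"
  have nbH: "{u. {p v, u} \<in> edges ?H} = p ` \<theta> ` nbrs ?E (\<theta> v)" if v: "v \<in> ?V" for v
  proof -
    have "p v = p' (\<theta> v)" using p'v \<theta> v by simp
    then have "{u. {p v, u} \<in> edges ?H} = p' ` nbrs ?E (\<theta> v)"
      using relabel_nbrs[OF G labelingsD(1)[OF p']] \<theta> v by simp
    also have "\<dots> = p ` \<theta> ` nbrs ?E (\<theta> v)"
      unfolding image_image by (rule image_cong[OF refl]) (use p'v nbrs_subset[OF G] in blast)
    finally show ?thesis .
  qed
  \<comment> \<open>Away from the labels of \<open>D0\<close> the lists of \<open>p\<close> are
    reused, which is legitimate since \<open>\<theta>\<close> respects neighbourhoods there. On the
    labels of \<open>D0\<close> an arbitrary valid ordering is taken.\<close>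
  define L where "L l = (if l \<in> p ` D0 then SOME xs. distinct xs \<and> set xs = {u. {l, u} \<in> edges ?H}
    else transported ?V nb p l)" for l
  have finV: "finite ?V" using G by (simp add: simple_graph_def)
  have L: "represents L ?H" unfolding represents_def
  proof (rule ballI)
    fix l assume lH: "l \<in> verts ?H"
    then have "l \<in> p ` ?V" unfolding imp by (simp add: relabel_def)
    then obtain v where v: "v \<in> ?V" "l = p v" by blast
    show "distinct (L l) \<and> set (L l) = {u. {l, u} \<in> edges ?H}"
    proof (cases "l \<in> p ` D0")
      case True
      have "finite (nbrs ?E (\<theta> v))" using nbrs_subset[OF G] finV finite_subset by blast
      then have "finite {u. {l, u} \<in> edges ?H}" using nbH v by simp
      then have "\<exists>xs. distinct xs \<and> set xs = {u. {l, u} \<in> edges ?H}"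
        using finite_distinct_list by metis
      then show ?thesis using someI_ex True unfolding L_def by (simp add: someI_ex)
    next
      case False
      then have "v \<notin> D0" using v by blast
      then have "{u. {l, u} \<in> edges ?H} = p ` nbrs ?E v" using nbH v D0 by metis
      also have "\<dots> = {u. {l, u} \<in> edges (relabel p G)}" using relabel_nbrs[OF G injp v(1)] v by simp
      finally have "{u. {l, u} \<in> edges ?H} = {u. {l, u} \<in> edges (relabel p G)}" .
      moreover have "l \<in> verts (relabel p G)" using lH by (simp add: relabel_def)
      ultimately show ?thesis
        using represents_transported[OF G nb p] False unfolding represents_def L_def by simp
    qed
  qed
  obtain F where F: "F \<subseteq> edges ?H" "provides_access q ?H L B F" "graph_connected (verts ?H, F)"
    using works[OF p' L] by blast
  have py: "p y = p' y0" "p z = p' z0" using p'v yz by auto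
  have "graph_connected (?V, {e \<in> ?E. p' ` e \<in> F})"
    by (rule connected_pullback[OF G labelingsD[OF p'] F(1,3)])
  then have "{y0, z0} \<in> {e \<in> ?E. p' ` e \<in> F}" by (intro bridge) auto
  then have inF: "{p y, p z} \<in> F" using py by simp
  then have "result (neighbour_query ?H L) (B (history_after (neighbour_query ?H L) B []) (p y, p z))"
    using F(1,2) unfolding provides_access_def Let_def by (metis empty_iff empty_set subsetD)
  then have "result (neighbour_query ?H L) ?c" by (simp add: history_after_def)
  moreover have "result (labelled_ask ?V nb p) ?c = result (neighbour_query ?H L) ?c"
  proof (rule result_cong)
    fix l i assume "l \<in> set (probes (labelled_ask ?V nb p) ?c)"
    then have "l \<notin> p ` D0" by (rule nohit)
    then have "neighbour_query ?H L l i = neighbour_query (relabel p G) (transported ?V nb p) l i"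
      by (simp add: neighbour_query_def relabel_def L_def)
    then show "labelled_ask ?V nb p l i = neighbour_query ?H L l i"
      by (simp add: neighbour_query_transported[OF p])
  qed
  ultimately show ?thesis by simp
qed

text \<open>Total probability for counting: a bound conditional on each value of \<open>f\<close>
  holds overall.\<close>

lemma card_partition_fun:
  assumes "finite S" and "\<And>c. c \<in> f ` S \<Longrightarrow>
    real (card {p \<in> S. f p = c \<and> Q p}) \<le> r * real (card {p \<in> S. f p = c})"
  shows "real (card {p \<in> S. Q p}) \<le> r * real (card S)"
proof -
  have part: "card A = (\<Sum>c\<in>f ` S. card {p \<in> A. f p = c})" if "A \<subseteq> S" for A
  proof -
    have "(\<Sum>c\<in>f ` S. sum (\<lambda>_. 1 :: nat) {p \<in> A. f p = c}) = sum (\<lambda>_. 1) A"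
      by (rule sum.group) (use that assms(1) finite_subset in auto)
    then show ?thesis by simp
  qed
  have "card {p \<in> S. Q p} = (\<Sum>c\<in>f ` S. card {p \<in> {p \<in> S. Q p}. f p = c})"
    by (rule part) blast
  also have "\<dots> = (\<Sum>c\<in>f ` S. card {p \<in> S. f p = c \<and> Q p})"
    by (rule sum.cong[OF refl], rule arg_cong[where f = card]) blast
  finally have "real (card {p \<in> S. Q p}) = (\<Sum>c\<in>f ` S. real (card {p \<in> S. f p = c \<and> Q p}))"
    by (simp only: of_nat_sum)
  also have "\<dots> \<le> (\<Sum>c\<in>f ` S. r * real (card {p \<in> S. f p = c}))" by (rule sum_mono) (rule assms(2))
  also have "\<dots> = r * real (\<Sum>c\<in>f ` S. card {p \<in> S. f p = c})"
    by (simp only: sum_distrib_left of_nat_sum)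
  also have "\<dots> = r * real (card S)" by (simp only: part[OF subset_refl])
  finally show ?thesis .
qed

text \<open>
  \<open>e\<close> looks like a bridge: an involution \<open>\<theta>\<close> takes a bridge to \<open>e\<close>, and \<open>D j\<close> contains all vertices at
  distance at most \<open>j\<close> from the places where \<open>\<theta>\<close> fails to be an automorphism.
\<close>

definition bridge_like :: "'v ugraph \<Rightarrow> nat \<Rightarrow> nat \<Rightarrow> 'v set \<Rightarrow> bool" where
  "bridge_like G q b e \<longleftrightarrow> (\<exists>y0 z0 \<theta> D. e = {\<theta> y0, \<theta> z0} \<and> {y0, z0} \<in> edges G \<and>
     (\<forall>F\<subseteq>edges G. graph_connected (verts G, F) \<longrightarrow> {y0, z0} \<in> F) \<and>
     (\<forall>v\<in>verts G. \<theta> v \<in> verts G \<and> \<theta> (\<theta> v) = v) \<and>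
     (\<forall>v\<in>verts G. v \<notin> D 0 \<longrightarrow> nbrs (edges G) v = \<theta> ` nbrs (edges G) (\<theta> v)) \<and>
     (\<forall>j. D j \<subseteq> D (Suc j) \<and> D j \<subseteq> verts G) \<and>
     (\<forall>j v w. {v, w} \<in> edges G \<longrightarrow> v \<notin> D (Suc j) \<longrightarrow> w \<notin> D j) \<and>
     \<theta> y0 \<notin> D q \<and> \<theta> z0 \<notin> D q \<and> card (D q) \<le> b)"

text \<open>The computation depends on the labelling through the queried pair
  \<open>(p y, p z)\<close>. Conditioning on these two labels therefore fixes one decision tree, to
  which the hitting bound applies; \<open>2 * q + 2\<close> counts these two vertices and two for
  each probe.\<close>

lemma card_dropped_le:
  fixes q b :: nat
  assumes G: "simple_graph G" and nb: "listing G nb"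
    and works: "\<And>p L. p \<in> labelings (verts G) \<Longrightarrow> represents L (relabel p G) \<Longrightarrow>
      \<exists>F\<subseteq>edges (relabel p G). provides_access q (relabel p G) L B F \<and>
        graph_connected (verts (relabel p G), F)"
    and F: "\<And>p. p \<in> labelings (verts G) \<Longrightarrow> provides_access q (relabel p G) (transported (verts G) nb p) B (F p)"
    and n: "2 * q + 2 < card (verts G)"
    and e: "e \<in> edges G" "bridge_like G q b e"
  shows "card {p \<in> labelings (verts G). p ` e \<notin> F p}
    \<le> q * (b / (card (verts G) - (2 * q + 2))) * card (labelings (verts G))"
proof -
  let ?V = "verts G" and ?E = "edges G"
  have finV: "finite ?V" using G by (simp add: simple_graph_def)
  obtain y0 z0 \<theta> D where e_eq: "e = {\<theta> y0, \<theta> z0}" and e0: "{y0, z0} \<in> ?E"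
    and *: "\<forall>F\<subseteq>?E. graph_connected (?V, F) \<longrightarrow> {y0, z0} \<in> F"
      "\<forall>v\<in>?V. \<theta> v \<in> ?V \<and> \<theta> (\<theta> v) = v"
      "\<forall>v\<in>?V. v \<notin> D 0 \<longrightarrow> nbrs ?E v = \<theta> ` nbrs ?E (\<theta> v)"
      "\<forall>j. D j \<subseteq> D (Suc j) \<and> D j \<subseteq> ?V"
      "\<forall>j v w. {v, w} \<in> ?E \<longrightarrow> v \<notin> D (Suc j) \<longrightarrow> w \<notin> D j"
    and far: "\<theta> y0 \<notin> D q" "\<theta> z0 \<notin> D q" and b: "card (D q) \<le> b"
    using e(2) unfolding bridge_like_def by (elim exE conjE) (rule that)
  have bridge: "{y0, z0} \<in> F" if "F \<subseteq> ?E" "graph_connected (?V, F)" for F using *(1) that by blast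
  have \<theta>: "\<theta> v \<in> ?V \<and> \<theta> (\<theta> v) = v" if "v \<in> ?V" for v using *(2) that by blast
  have D0: "nbrs ?E v = \<theta> ` nbrs ?E (\<theta> v)" if "v \<in> ?V" "v \<notin> D 0" for v using *(3) that by blast
  have Dm: "D j \<subseteq> D (Suc j)" and DV: "D j \<subseteq> ?V" for j using *(4) by blast+
  have Dn: "w \<notin> D j" if "{v, w} \<in> ?E" "v \<notin> D (Suc j)" for j v w using *(5) that by blast
  define y z where "y = \<theta> y0" and "z = \<theta> z0"
  have e_yz: "e = {y, z}" using e_eq by (simp add: y_def z_def)
  have yz: "y \<in> ?V" "z \<in> ?V" using e e_yz G by (auto simp: simple_graph_def)
  have yz0: "y0 \<in> ?V" "z0 \<in> ?V" using e0 G by (auto simp: simple_graph_def)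
  define c where "c p = B [] (p y, p z)" for p
  have edge: "{p y, p z} \<in> edges (relabel p G)" for p
    unfolding relabel_def snd_conv using e(1) e_yz by (intro image_eqI[of _ _ e]) auto
  have access: "result (labelled_ask ?V nb p) (c p) \<longleftrightarrow> {p y, p z} \<in> F p"
    "length (replies (labelled_ask ?V nb p) (c p)) \<le> q" if "p \<in> labelings ?V" for p
  proof -
    have "\<forall>(x, y)\<in>set []. {x, y} \<in> edges (relabel p G)" by simp
    then have "(let c' = B (history_after (labelled_ask ?V nb p) B []) (p y, p z) in
      (result (labelled_ask ?V nb p) c' \<longleftrightarrow> {p y, p z} \<in> F p) \<and> length (replies (labelled_ask ?V nb p) c') \<le> q)"
      using F[OF that] edge[of p] unfolding provides_access_def neighbour_query_transported[OF that] by blast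
    then show "result (labelled_ask ?V nb p) (c p) \<longleftrightarrow> {p y, p z} \<in> F p"
      "length (replies (labelled_ask ?V nb p) (c p)) \<le> q"
      by (simp_all add: c_def history_after_def Let_def)
  qed
  let ?P = "labelings ?V"
  define hits where "hits p \<longleftrightarrow> (\<exists>l\<in>set (probes (labelled_ask ?V nb p) (c p)). l \<in> p ` D 0)" for p
  have sub: "{p \<in> ?P. p ` e \<notin> F p} \<subseteq> {p \<in> ?P. hits p}"
  proof
    fix p assume "p \<in> {p \<in> ?P. p ` e \<notin> F p}"
    then have p: "p \<in> ?P" "{p y, p z} \<notin> F p" using e_yz by auto
    have "hits p"
    proof (rule ccontr)
      assume "\<not> hits p"
      then have "result (labelled_ask ?V nb p) (c p)"
        unfolding c_def hits_def
        by (intro kept_if_not_hit[where \<theta> = \<theta> and ?y0.0 = y0 and ?z0.0 = z0 and ?D0.0 = "D 0", OF G nb p(1) works])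
          (use \<theta> yz0 e0 bridge D0 in \<open>auto simp: y_def z_def\<close>)
      then show False using access p by blast
    qed
    then show "p \<in> {p \<in> ?P. hits p}" using p by simp
  qed
  let ?r = "q * (b / (card ?V - (2 * q + 2)))"
  have "real (card {p \<in> ?P. hits p}) \<le> ?r * card ?P"
  proof (rule card_partition_fun[where f = "\<lambda>p. (p y, p z)", OF finite_labelings[OF finV]])
    fix jj assume "jj \<in> (\<lambda>p. (p y, p z)) ` ?P"
    then obtain \<kappa> where \<kappa>: "\<kappa> \<in> ?P" "jj = (\<kappa> y, \<kappa> z)" by blast
    have X: "extending ?V {y, z} \<kappa> = {p \<in> ?P. (p y, p z) = jj}"
      using \<kappa> by (auto simp: extending_def)
    have cc: "c p = c \<kappa>" if "p \<in> extending ?V {y, z} \<kappa>" for p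
      using that by (simp add: extending_def c_def)
    have "card {p \<in> extending ?V {y, z} \<kappa>. \<exists>l\<in>set (probes (labelled_ask ?V nb p) (c \<kappa>)). l \<in> p ` D 0}
        \<le> ?r * card (extending ?V {y, z} \<kappa>)"
    proof (rule card_hitting_le[where q = q])
      show "set (nb v) \<subseteq> ?V" if "v \<in> ?V" for v
        using that nb nbrs_subset[OF G] by (auto simp: listing_def)
      show "w \<notin> D j" if "v \<in> ?V" "v \<notin> D (Suc j)" "w \<in> set (nb v)" for j v w
      proof -
        have "{v, w} \<in> ?E" using that(1,3) nb by (auto simp: listing_def nbrs_def)
        then show ?thesis using Dn that(2) by blast
      qed
      show "card {y, z} + 2 * q \<le> 2 * q + 2"
        using card_insert_le_m1[of 2 "{z}" y] by simp
      show "length (replies (labelled_ask ?V nb p) (c \<kappa>)) \<le> q" if "p \<in> extending ?V {y, z} \<kappa>" for p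
        using access(2)[of p] cc[OF that] that by (simp add: extending_def)
    qed (use finV Dm DV b n yz far in \<open>auto simp: y_def z_def\<close>)
    moreover have "{p \<in> extending ?V {y, z} \<kappa>. \<exists>l\<in>set (probes (labelled_ask ?V nb p) (c \<kappa>)). l \<in> p ` D 0}
        = {p \<in> ?P. (p y, p z) = jj \<and> hits p}"
    proof -
      have "{p \<in> extending ?V {y, z} \<kappa>. \<exists>l\<in>set (probes (labelled_ask ?V nb p) (c \<kappa>)). l \<in> p ` D 0}
        = {p \<in> extending ?V {y, z} \<kappa>. hits p}"
        unfolding hits_def by (rule Collect_cong) (use cc in auto)
      then show ?thesis unfolding X by blast
    qed
    ultimately show "real (card {p \<in> ?P. (p y, p z) = jj \<and> hits p}) \<le> ?r * real (card {p \<in> ?P. (p y, p z) = jj})"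
      using X by simp
  qed
  then show ?thesis
    by (rule order_trans[rotated]) (use sub finite_labelings[OF finV] in \<open>simp add: card_mono\<close>)
qed

text \<open>The easy direction of Yao's principle: the expected number of good labellings is at
  least two thirds of all, so some seed attains this.\<close>

lemma many_good_labelings:
  assumes M: "prob_space M" and P: "finite P" "P \<noteq> {}"
    and A: "\<And>p. p \<in> P \<Longrightarrow> measure M {\<omega>\<in>space M. R p \<omega>} \<ge> 2 / 3"
  shows "\<exists>\<omega>\<in>space M. 2 / 3 * card P \<le> card {p \<in> P. R p \<omega>}"
proof (rule ccontr)
  interpret prob_space M by fact
  assume no: "\<not> ?thesis"
  let ?A = "\<lambda>p. {\<omega>\<in>space M. R p \<omega>}"
  \<comment> \<open>A non-measurable set would have measure 0, below \<open>2 / 3\<close>.\<close>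
  have meas: "?A p \<in> sets M" if "p \<in> P" for p
    using A[OF that] measure_notin_sets[of "?A p" M] by fastforce
  let ?X = "\<lambda>\<omega>. \<Sum>p\<in>P. indicator (?A p) \<omega> :: real"
  have ind: "integrable M (indicator (?A p) :: _ \<Rightarrow> real)" if "p \<in> P" for p
    using meas[OF that] by (intro integrable_real_indicator) (simp_all add: emeasure_eq_measure)
  have int: "integrable M ?X" by (rule Bochner_Integration.integrable_sum) (rule ind)
  have "?X \<omega> < 2 / 3 * card P" if w: "\<omega> \<in> space M" for \<omega>
  proof -
    have "?X \<omega> = card {p \<in> P. R p \<omega>}"
      using P w by (simp add: indicator_def sum.If_cases Int_def)
    then show ?thesis using no w by (simp add: not_le)
  qed
  then have "expectation ?X < 2 / 3 * card P" by (intro expectation_less[OF int]) simp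
  moreover have "expectation ?X = (\<Sum>p\<in>P. prob (?A p))"
    using meas ind by (subst Bochner_Integration.integral_sum) auto
  moreover have "(\<Sum>p\<in>P. 2 / 3) \<le> (\<Sum>p\<in>P. prob (?A p))" by (rule sum_mono) (rule A)
  ultimately show False by simp
qed

text \<open>Count pairs of a labelling and a dropped edge of \<open>S\<close> in two ways, for a
  fixed good seed. Each of the sparse labellings drops at least
  \<open>card S - 3 / 2 * card (verts G)\<close> edges, whereas each bridge-like edge is dropped by
  only a small fraction of the labellings.\<close>

lemma query_lower_bound:
  fixes q b :: nat
  assumes G: "simple_graph G" and con: "graph_connected G" and enc: "inj_on enc (verts G)"
    and alg: "local_sparse_spanning_alg (1 / 2) q
      (isomorphic_family (enc ` verts G, (\<lambda>e. enc ` e) ` edges G)) M A"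
    and n: "2 * q + 2 < card (verts G)"
    and S: "S \<subseteq> edges G" "\<And>e. e \<in> S \<Longrightarrow> bridge_like G q b e"
  shows "2 / 3 * (card S - 3 / 2 * card (verts G)) \<le> card S * (q * (b / (card (verts G) - (2 * q + 2))))"
proof (cases "card S \<le> 3 / 2 * card (verts G)")
  case True
  then have "2 / 3 * (card S - 3 / 2 * card (verts G)) \<le> 0" by simp
  also have "0 \<le> card S * (q * (b / (card (verts G) - (2 * q + 2))))" by simp
  finally show ?thesis .
next
  case False
  let ?V = "verts G" and ?E = "edges G"
  let ?n = "card ?V"
  let ?P = "labelings ?V"
  have finV: "finite ?V" using G by (simp add: simple_graph_def)
  have finE: "finite ?E" by (rule finite_edges[OF G])
  \<comment> \<open>A valid degree bound for every relabelling; \<open>Suc\<close> makes it at least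
    1, as the specification requires.\<close>
  define d where "d = Suc (card ?E)"
  have M: "prob_space M" using alg by (simp add: local_sparse_spanning_alg_def)
  have spec: "\<exists>E'. (\<forall>\<omega>\<in>space M. E' \<omega> \<subseteq> edges (relabel p G) \<and>
        provides_access q (relabel p G) L (A ?n d \<omega>) (E' \<omega>) \<and>
        graph_connected (verts (relabel p G), E' \<omega>)) \<and>
      measure M {\<omega>\<in>space M. real (card (E' \<omega>)) < (1 + 1 / 2) * real ?n} \<ge> 2 / 3"
    if p: "p \<in> ?P" and L: "represents L (relabel p G)" for p L
  proof -
    let ?H = "relabel p G"
    have inj: "inj_on p ?V" and im: "p ` ?V = {1..?n}" using labelingsD[OF p] by auto
    have simple: "simple_graph ?H" unfolding simple_graph_def
    proof (intro conjI ballI)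
      fix e assume "e \<in> edges ?H"
      then obtain e' where e': "e' \<in> ?E" "e = p ` e'" by (auto simp: relabel_def)
      then have "e' \<subseteq> ?V" "card e' = 2" using G by (auto simp: simple_graph_def)
      moreover from this have "card e = card e'" using e' inj by (simp add: card_image inj_on_subset)
      ultimately show "e \<subseteq> verts ?H" "card e = 2" using e' im by (auto simp: relabel_def)
    qed (simp add: relabel_def)
    have vs: "verts ?H = {1..?n}" by (simp add: relabel_def)
    have conH: "graph_connected ?H" unfolding graph_connected_def
    proof (intro ballI)
      fix a b assume "a \<in> verts ?H" "b \<in> verts ?H"
      then have "a \<in> p ` ?V" "b \<in> p ` ?V" unfolding im vs by auto
      then obtain u v where uv: "u \<in> ?V" "v \<in> ?V" "a = p u" "b = p v" by blast
      have "(p u, p w) \<in> {(x, y). {x, y} \<in> edges ?H}\<^sup>*" if "(u, w) \<in> {(x, y). {x, y} \<in> ?E}\<^sup>*" for w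
        using that
      proof (induction rule: rtrancl_induct)
        case (step y z)
        have "p ` {y, z} \<in> edges ?H" using step(2) unfolding relabel_def snd_conv by (intro imageI) simp
        then show ?case using step(3) by (simp add: rtrancl.rtrancl_into_rtrancl)
      qed simp
      then show "(a, b) \<in> {(x, y). {x, y} \<in> edges ?H}\<^sup>*"
        using con uv by (auto simp: graph_connected_def)
    qed
    have deg: "vdegree ?H v \<le> d" for v
    proof -
      have "vdegree ?H v \<le> card (edges ?H)"
        unfolding vdegree_def by (rule card_mono) (use finite_edges[OF simple] in auto)
      also have "\<dots> \<le> card ?E" using finE by (simp add: relabel_def card_image_le)
      finally show ?thesis by (simp add: d_def)
    qed
    have "?n \<ge> 1" "d \<ge> 1" using n by (auto simp: d_def)
    then show ?thesis
      using alg relabel_in_family[OF G enc p L] simple vs L conH deg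
      unfolding local_sparse_spanning_alg_def by blast
  qed
  obtain nb where nb: "listing G nb"
  proof -
    have "\<exists>xs. distinct xs \<and> set xs = nbrs ?E v" for v
      using finite_distinct_list[of "nbrs ?E v"] finite_subset[OF nbrs_subset[OF G] finV] by metis
    then show ?thesis using that unfolding listing_def by metis
  qed
  define L where "L p = transported ?V nb p" for p
  define Sol where "Sol p X \<longleftrightarrow> (\<forall>\<omega>\<in>space M. X \<omega> \<subseteq> edges (relabel p G) \<and>
        provides_access q (relabel p G) (L p) (A ?n d \<omega>) (X \<omega>)) \<and>
      measure M {\<omega>\<in>space M. real (card (X \<omega>)) < (1 + 1 / 2) * real ?n} \<ge> 2 / 3" for p X
  have "\<exists>X. Sol p X" if p: "p \<in> ?P" for p
  proof -
    obtain X where "\<forall>\<omega>\<in>space M. X \<omega> \<subseteq> edges (relabel p G) \<and>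
        provides_access q (relabel p G) (L p) (A ?n d \<omega>) (X \<omega>) \<and>
        graph_connected (verts (relabel p G), X \<omega>)"
      "measure M {\<omega>\<in>space M. real (card (X \<omega>)) < (1 + 1 / 2) * real ?n} \<ge> 2 / 3"
      using spec[OF p represents_transported[OF G nb p]] unfolding L_def[symmetric]
      by (elim exE conjE) (rule that)
    then have "Sol p X" unfolding Sol_def by simp
    then show ?thesis by blast
  qed
  then obtain E' where Sol: "\<forall>p\<in>?P. Sol p (E' p)" using bchoice[of ?P Sol] by blast
  have E': "E' p \<omega> \<subseteq> edges (relabel p G)" "provides_access q (relabel p G) (L p) (A ?n d \<omega>) (E' p \<omega>)"
    if "p \<in> ?P" "\<omega> \<in> space M" for p \<omega>
    using Sol that unfolding Sol_def by blast+
  have sparse: "measure M {\<omega>\<in>space M. real (card (E' p \<omega>)) < (1 + 1 / 2) * real ?n} \<ge> 2 / 3"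
    if "p \<in> ?P" for p
    using Sol that unfolding Sol_def by blast
  have "\<exists>\<omega>\<in>space M. 2 / 3 * card ?P \<le> card {p \<in> ?P. real (card (E' p \<omega>)) < (1 + 1 / 2) * real ?n}"
    by (rule many_good_labelings[OF M finite_labelings[OF finV] labelings_nonempty[OF finV]]) (rule sparse)
  then obtain \<omega> where \<omega>: "\<omega> \<in> space M"
    and most: "2 / 3 * card ?P \<le> card {p \<in> ?P. real (card (E' p \<omega>)) < (1 + 1 / 2) * real ?n}"
    by (elim bexE) (rule that)
  let ?T = "{p \<in> ?P. real (card (E' p \<omega>)) < (1 + 1 / 2) * real ?n}"
  let ?r = "q * (b / (?n - (2 * q + 2)))"
  have finS: "finite S" using S(1) finE finite_subset by blast
  have drop: "card S - 3 / 2 * ?n \<le> card {e \<in> S. p ` e \<notin> E' p \<omega>}" if p: "p \<in> ?T" for p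
  proof -
    have inj: "inj_on p ?V" using labelingsD p by blast
    have finE': "finite (E' p \<omega>)"
      by (rule finite_subset[OF E'(1)]) (use p \<omega> finE in \<open>auto simp: relabel_def\<close>)
    have "inj_on (\<lambda>e. p ` e) {e \<in> S. p ` e \<in> E' p \<omega>}"
    proof (rule inj_onI)
      fix e e' assume *: "e \<in> {e \<in> S. p ` e \<in> E' p \<omega>}" "e' \<in> {e \<in> S. p ` e \<in> E' p \<omega>}" "p ` e = p ` e'"
      then have "e \<subseteq> ?V" "e' \<subseteq> ?V" using S(1) G by (auto simp: simple_graph_def)
      then show "e = e'" using inj *(3) by (simp add: inj_on_image_eq_iff)
    qed
    then have "card {e \<in> S. p ` e \<in> E' p \<omega>} \<le> card (E' p \<omega>)"
      using finE' by (intro card_inj_on_le) auto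
    moreover have "card S = card {e \<in> S. p ` e \<in> E' p \<omega>} + card {e \<in> S. p ` e \<notin> E' p \<omega>}"
      using finS by (subst card_Un_disjoint[symmetric]) (auto intro: arg_cong[where f = card])
    ultimately show ?thesis using p by simp
  qed
  have "2 / 3 * (card S - 3 / 2 * ?n) * card ?P = (2 / 3 * card ?P) * (card S - 3 / 2 * ?n)"
    by (simp only: mult_ac)
  also have "\<dots> \<le> card ?T * (card S - 3 / 2 * ?n)"
    by (rule mult_right_mono[OF most]) (use False in simp)
  also have "\<dots> \<le> (\<Sum>p\<in>?T. real (card {e \<in> S. p ` e \<notin> E' p \<omega>}))"
    using sum_mono[of ?T "\<lambda>_. card S - 3 / 2 * ?n", OF drop] by simp
  also have "\<dots> \<le> (\<Sum>p\<in>?P. real (card {e \<in> S. p ` e \<notin> E' p \<omega>}))"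
    by (rule sum_mono2) (use finite_labelings[OF finV] in auto)
  also have "\<dots> = (\<Sum>e\<in>S. real (card {p \<in> ?P. p ` e \<notin> E' p \<omega>}))"
  proof -
    have "(\<Sum>p\<in>?P. card {e \<in> S. p ` e \<notin> E' p \<omega>}) = (\<Sum>e\<in>S. card {p \<in> ?P. p ` e \<notin> E' p \<omega>})"
      by (rule sum_multicount_gen) (use finite_labelings[OF finV] finS in auto)
    then have "real (\<Sum>p\<in>?P. card {e \<in> S. p ` e \<notin> E' p \<omega>}) = real (\<Sum>e\<in>S. card {p \<in> ?P. p ` e \<notin> E' p \<omega>})"
      by (rule arg_cong)
    then show ?thesis by (simp only: of_nat_sum)
  qed
  also have "\<dots> \<le> (\<Sum>e\<in>S. ?r * card ?P)"
  proof (rule sum_mono)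
    fix e assume e: "e \<in> S"
    have works: "\<exists>F\<subseteq>edges (relabel p G). provides_access q (relabel p G) L (A ?n d \<omega>) F \<and>
        graph_connected (verts (relabel p G), F)"
      if w: "p \<in> ?P" "represents L (relabel p G)" for p L
    proof -
      obtain X where "\<forall>\<omega>\<in>space M. X \<omega> \<subseteq> edges (relabel p G) \<and>
          provides_access q (relabel p G) L (A ?n d \<omega>) (X \<omega>) \<and>
          graph_connected (verts (relabel p G), X \<omega>)"
        using spec[OF w] by (elim exE conjE) (rule that)
      then show ?thesis using \<omega> by blast
    qed
    have acc: "provides_access q (relabel p G) (transported ?V nb p) (A ?n d \<omega>) (E' p \<omega>)"
      if "p \<in> ?P" for p
      using E'(2)[OF that \<omega>] by (simp only: L_def)
    have br: "e \<in> ?E" "bridge_like G q b e" using e S by auto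
    show "real (card {p \<in> ?P. p ` e \<notin> E' p \<omega>}) \<le> ?r * card ?P"
      by (rule card_dropped_le[OF G nb works acc n br])
  qed
  also have "\<dots> = card S * ?r * card ?P" by simp
  finally have "2 / 3 * (card S - 3 / 2 * ?n) * card ?P \<le> card S * ?r * card ?P" .
  then show ?thesis
    by (rule mult_right_le_imp_le)
      (use labelings_nonempty[OF finV] finite_labelings[OF finV] in \<open>simp add: card_gt_0_iff\<close>)
qed

section \<open>The hard graph\<close>

definition toggle :: "'a set set \<Rightarrow> 'a set \<Rightarrow> 'a set set" where
  "toggle x e = sym_diff x {e}"

lemma toggle_toggle [simp]: "toggle (toggle x e) e = x"
  by (auto simp: toggle_def)

lemma mem_toggle: "f \<in> toggle x e \<longleftrightarrow> (f \<in> x) \<noteq> (f = e)"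
  by (auto simp: toggle_def)

lemma sym_diff_toggle: "sym_diff x (toggle x e) = {e}"
  by (auto simp: toggle_def)

lemma toggle_sym_diff: "toggle (sym_diff x z) e = sym_diff (toggle x e) z"
  by (auto simp: toggle_def)

locale girth_graph =
  fixes V :: "'a set" and E :: "'a set set" and g :: nat and a :: 'a
  assumes finV: "finite V" and aV: "a \<in> V" and two: "\<forall>e\<in>E. card e = 2 \<and> e \<subseteq> V"
    and girth: "girth_ge g E" and deg: "card (nbrs E v) \<le> 8" and g2: "g \<ge> 2"
    and cardV: "card V \<le> 2 * 8 ^ g"
    and cut: "\<forall>A\<subset>V. A \<noteq> {} \<longrightarrow> 2 \<le> card (crossing E A)"
begin

abbreviation "fib \<equiv> fibre E a"
abbreviation "m \<equiv> card E"
abbreviation "fs \<equiv> card (even_sets E)"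

lemma finE: "finite E"
  by (rule finite_subset[of _ "Pow V"]) (use two finV in auto)

lemma fin_nbrs: "finite (nbrs E v)"
  by (rule finite_subset[of _ V]) (use two finV in \<open>auto simp: nbrs_def\<close>)

lemma finfib: "finite (fib v)"
  by (rule finite_fibre[OF finE])

lemma connE: "connects E V"
  unfolding connects_def
proof (intro allI impI)
  fix A assume "A \<subset> V" "A \<noteq> {}"
  then have "2 \<le> card (crossing E A)" using cut by blast
  then show "crossing E A \<noteq> {}" by auto
qed

lemma connE_minus: "connects (E - {e}) V"
  unfolding connects_def
proof (intro allI impI)
  fix A assume "A \<subset> V" "A \<noteq> {}"
  then have c: "2 \<le> card (crossing E A)" using cut by blast
  have "crossing E A - {e} \<noteq> {}"
  proof
    assume "crossing E A - {e} = {}"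
    then have "crossing E A \<subseteq> {e}" by blast
    then have "card (crossing E A) \<le> card {e}" by (intro card_mono) auto
    then show False using c by simp
  qed
  then show "crossing (E - {e}) A \<noteq> {}" by (auto simp: crossing_def)
qed

lemma cardfib: "v \<in> V \<Longrightarrow> card (fib v) = fs"
  by (rule card_fibre[OF connE two finE aV])

lemma edge_ends: "{u, v} \<in> E \<Longrightarrow> u \<in> V \<and> v \<in> V \<and> u \<noteq> v"
  using two by fastforce

lemma fibD: "x \<in> fib v \<Longrightarrow> x \<subseteq> E \<and> finite x \<and> odd_verts x = sym_diff {a} {v}"
  unfolding fibre_def using finE finite_subset by blast

lemma fib_toggle:
  assumes "x \<in> fib u" "{u, v} \<in> E"
  shows "toggle x {u, v} \<in> fib v"
proof -
  have "odd_verts (toggle x {u, v}) = sym_diff (sym_diff {a} {u}) {u, v}"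
    unfolding toggle_def using odd_verts_sym_diff[of x "{{u, v}}"] fibD[OF assms(1)] by simp
  also have "\<dots> = sym_diff {a} {v}" using edge_ends[OF assms(2)] by auto
  finally show ?thesis using fibD[OF assms(1)] assms(2) unfolding fibre_def toggle_def by auto
qed

lemma fib_shift:
  assumes "x \<in> fib v" "z \<subseteq> E" "odd_verts z = {}"
  shows "sym_diff x z \<in> fib v"
proof -
  have "odd_verts (sym_diff x z) = sym_diff {a} {v}"
    using odd_verts_sym_diff[of x z] fibD[OF assms(1)] assms(2,3) finE finite_subset by auto
  moreover have "sym_diff x z \<subseteq> E" using fibD[OF assms(1)] assms(2) by blast
  ultimately show ?thesis unfolding fibre_def by blast
qed

lemma odd_verts_fib_diff:
  assumes "x \<in> fib u" "y \<in> fib v"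
  shows "odd_verts (sym_diff x y) = sym_diff {u} {v}"
proof -
  have "odd_verts (sym_diff x y) = sym_diff (sym_diff {a} {u}) (sym_diff {a} {v})"
    using odd_verts_sym_diff[of x y] fibD[OF assms(1)] fibD[OF assms(2)] by simp
  also have "\<dots> = sym_diff {u} {v}" by blast
  finally show ?thesis .
qed

definition around :: "nat \<Rightarrow> 'a set set \<Rightarrow> ('a set set \<times> 'a) set" where
  "around k y = {(x, v). v \<in> V \<and> x \<in> fib v \<and> card (sym_diff y x) \<le> k}"

text \<open>The differences from \<open>y\<close> are joins starting at \<open>w\<close>, and
  \<open>2 * 256 ^ j\<close> summed over \<open>j \<le> k\<close> is at most
  \<open>4 * 256 ^ k\<close>.\<close>

lemma card_around:
  assumes "y \<in> fib w"
  shows "finite (around k y) \<and> card (around k y) \<le> 4 * 256 ^ k"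
proof -
  have J: "finite (joins E j w)" "card (joins E j w) \<le> 2 * 256 ^ j" for j
    using card_joins[OF finE finV two _ girth _ cardV, of j w] deg fin_nbrs g2 by auto
  let ?f = "\<lambda>(x, v). (sym_diff y x, v)"
  have sub: "?f ` around k y \<subseteq> (\<Union>j\<le>k. joins E j w)"
  proof
    fix p assume "p \<in> ?f ` around k y"
    then obtain x v where x: "v \<in> V" "x \<in> fib v" "card (sym_diff y x) \<le> k" "p = (sym_diff y x, v)"
      by (auto simp: around_def)
    have "sym_diff y x \<subseteq> E" using fibD[OF assms] fibD[OF x(2)] by blast
    then have "p \<in> joins E (card (sym_diff y x)) w"
      using odd_verts_fib_diff[OF assms x(2)] x(4) by (simp add: joins_def)
    then show "p \<in> (\<Union>j\<le>k. joins E j w)" using x(3) by blast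
  qed
  have inj: "inj_on ?f (around k y)"
    by (rule inj_on_inverseI[where g = ?f]) auto
  have fin: "finite (\<Union>j\<le>k. joins E j w)" using J by simp
  have "card (around k y) \<le> card (\<Union>j\<le>k. joins E j w)" by (rule card_inj_on_le[OF inj sub fin])
  also have "\<dots> \<le> (\<Sum>j\<le>k. card (joins E j w))" by (rule card_UN_le) simp
  also have "\<dots> \<le> (\<Sum>j\<le>k. 2 * 256 ^ j)" by (rule sum_mono) (rule J)
  also have "\<dots> \<le> 4 * 256 ^ k" by (induction k) auto
  finally show ?thesis using inj_on_finite[OF inj sub fin] by simp
qed

text \<open>A fibre larger than a ball about the empty label set must leave that ball. This provides
  a place for the bridge far from the connectors.\<close>

lemma heavy_in_fibre:
  assumes "v \<in> V" "4 * 256 ^ k < fs"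
  shows "\<exists>x\<in>fib v. k < card x"
proof (rule ccontr)
  assume "\<not> ?thesis"
  then have "(\<lambda>x. (x, v)) ` fib v \<subseteq> around k {}" using assms(1) by (auto simp: around_def not_less)
  moreover have e: "{} \<in> fib a" by (simp add: fibre_def)
  ultimately have "card (fib v) \<le> card (around k {})"
    using card_around[OF e] by (intro card_inj_on_le[where f = "\<lambda>x. (x, v)"]) (auto simp: inj_on_def)
  then show False using card_around[OF e, of k] cardfib[OF assms(1)] assms(2) by simp
qed

end

text \<open>Copy \<open>i < m\<close> is the one damaged for the edge \<open>{ea i, eb i}\<close>,
  and its surviving lift starts at \<open>xs i\<close>. The condition
  \<open>q + 1 < card (xs i)\<close> separates that lift from the empty label set;
  \<open>q + 2 < g\<close> makes every even set of at most \<open>q + 2\<close> edges empty.\<close>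

locale pieces = girth_graph +
  fixes J q :: nat and ea eb :: "nat \<Rightarrow> 'a" and xs :: "nat \<Rightarrow> 'a set set"
  assumes J: "m \<le> J" "0 < J" and q: "q + 2 < g"
    and lab: "bij_betw (\<lambda>i. {ea i, eb i}) {..<m} E"
    and xs: "\<And>i. i < m \<Longrightarrow> xs i \<in> fib (ea i) \<and> q + 1 < card (xs i)"
begin

abbreviation "lab i \<equiv> {ea i, eb i}"

definition VV :: "(nat \<times> 'a set set \<times> 'a) set" where
  "VV = {(l, x, v). l < J \<and> v \<in> V \<and> x \<in> fib v}"

definition lift :: "nat \<Rightarrow> 'a set set \<Rightarrow> 'a \<Rightarrow> 'a \<Rightarrow> (nat \<times> 'a set set \<times> 'a) set" where
  "lift l x u v = {(l, x, u), (l, toggle x {u, v}, v)}"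

definition full :: "(nat \<times> 'a set set \<times> 'a) set set" where
  "full = {lift l x u v | l x u v. (l, x, u) \<in> VV \<and> {u, v} \<in> E}"

definition e0 :: "nat \<Rightarrow> (nat \<times> 'a set set \<times> 'a) set" where
  "e0 i = lift i (xs i) (ea i) (eb i)"

text \<open>A lift determines its copy, so subtracting all of the \<open>e0 i\<close> spares exactly
  one edge in each damaged copy.\<close>

definition removed :: "(nat \<times> 'a set set \<times> 'a) set set" where
  "removed = {lift l x u v | l x u v. (l, x, u) \<in> VV \<and> l < m \<and> {u, v} = lab l} - e0 ` {..<m}"

definition conn :: "(nat \<times> 'a set set \<times> 'a) set set" where
  "conn = {{(l, {}, a), (Suc l, {}, a)} | l. Suc l < J}"

definition GE :: "(nat \<times> 'a set set \<times> 'a) set set" where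
  "GE = (full - removed) \<union> conn"

definition irr :: "(nat \<times> 'a set set \<times> 'a) set" where
  "irr = \<Union>removed \<union> \<Union>conn"

abbreviation "GG \<equiv> (VV, GE)"

lemma labE: "i < m \<Longrightarrow> lab i \<in> E"
  using lab by (auto simp: bij_betw_def)

lemma lift_flip: "lift l (toggle x {u, v}) v u = lift l x u v"
  by (auto simp: lift_def insert_commute)

lemma toggle_VV: "(l, x, u) \<in> VV \<Longrightarrow> {u, v} \<in> E \<Longrightarrow> (l, toggle x {u, v}, v) \<in> VV"
  using fib_toggle edge_ends by (auto simp: VV_def)

lemma full_at:
  assumes "e \<in> full" "(l, y, w) \<in> e"
  shows "\<exists>w'. e = lift l y w w' \<and> {w, w'} \<in> E \<and> (l, y, w) \<in> VV"
proof -
  obtain l' x u v where *: "e = lift l' x u v" "(l', x, u) \<in> VV" "{u, v} \<in> E"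
    using assms(1) by (auto simp: full_def)
  then consider "(l, y, w) = (l', x, u)" | "(l, y, w) = (l', toggle x {u, v}, v)"
    using assms(2) by (auto simp: lift_def)
  then show ?thesis
  proof cases
    case 1
    then show ?thesis using * by blast
  next
    case 2
    then have "e = lift l y w u" using * lift_flip by simp
    moreover have "{w, u} \<in> E" using 2 * by (simp add: insert_commute)
    moreover have "(l, y, w) \<in> VV" using 2 toggle_VV[OF *(2,3)] by simp
    ultimately show ?thesis by blast
  qed
qed

lemma lift_label: "lift l x u v = lift l' x' u' v' \<Longrightarrow> l = l' \<and> {u, v} = {u', v'}"
  by (auto simp: lift_def doubleton_eq_iff)

lemma lift_full: "(l, x, u) \<in> VV \<Longrightarrow> {u, v} \<in> E \<Longrightarrow> lift l x u v \<in> full"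
  unfolding full_def by blast

lemma xsV: "i < m \<Longrightarrow> (i, xs i, ea i) \<in> VV"
  using xs[of i] J edge_ends[OF labE, of i] by (auto simp: VV_def)

lemma removed_at:
  assumes "e \<in> removed" "(l, y, w) \<in> e"
  shows "\<exists>w'. e = lift l y w w' \<and> {w, w'} = lab l \<and> l < m \<and> (l, y, w) \<in> VV \<and> e \<notin> e0 ` {..<m}"
proof -
  obtain l' x u v where *: "e = lift l' x u v" "(l', x, u) \<in> VV" "l' < m" "{u, v} = lab l'"
      and ne: "e \<notin> e0 ` {..<m}"
    using assms(1) by (auto simp: removed_def)
  have "e \<in> full" using * labE lift_full by metis
  then obtain w' where w': "e = lift l y w w'" "(l, y, w) \<in> VV" using full_at assms(2) by blast
  then have "l' = l \<and> {u, v} = {w, w'}" using *(1) lift_label by metis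
  then show ?thesis using w' * ne by auto
qed

lemma removed_full: "removed \<subseteq> full"
  using labE unfolding removed_def full_def by fastforce

lemma nbrs_full:
  assumes "(l, x, u) \<in> VV"
  shows "nbrs full (l, x, u) = (\<lambda>v. (l, toggle x {u, v}, v)) ` nbrs E u"
proof
  show "nbrs full (l, x, u) \<subseteq> (\<lambda>v. (l, toggle x {u, v}, v)) ` nbrs E u"
  proof
    fix p assume "p \<in> nbrs full (l, x, u)"
    then have "{(l, x, u), p} \<in> full" by (simp add: nbrs_def)
    then obtain v where v: "{(l, x, u), p} = lift l x u v" "{u, v} \<in> E" using full_at by blast
    have "u \<noteq> v" using edge_ends v by blast
    then have "p = (l, toggle x {u, v}, v)" using v(1) by (auto simp: lift_def doubleton_eq_iff)
    then show "p \<in> (\<lambda>v. (l, toggle x {u, v}, v)) ` nbrs E u" using v by (auto simp: nbrs_def)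
  qed
  show "(\<lambda>v. (l, toggle x {u, v}, v)) ` nbrs E u \<subseteq> nbrs full (l, x, u)"
    using lift_full[OF assms] by (auto simp: nbrs_def lift_def)
qed

lemma finVV: "finite VV"
proof -
  have "VV \<subseteq> {..<J} \<times> Pow E \<times> V" using fibD by (auto simp: VV_def)
  then show ?thesis using finE finV finite_subset by (meson finite_Pow_iff finite_SigmaI finite_lessThan)
qed

lemma base_VV: "l < J \<Longrightarrow> (l, {}, a) \<in> VV"
  using aV by (simp add: VV_def fibre_def)

lemma conn_VV: "e \<in> conn \<Longrightarrow> e \<subseteq> VV"
  using base_VV by (auto simp: conn_def)

lemma full_VV: "e \<in> full \<Longrightarrow> e \<subseteq> VV \<and> card e = 2"
  using toggle_VV edge_ends by (fastforce simp: full_def lift_def)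

lemma simple_GG: "simple_graph GG"
proof -
  have "card e = 2" if "e \<in> conn" for e using that by (auto simp: conn_def)
  then show ?thesis using finVV full_VV conn_VV by (auto simp: simple_graph_def GE_def)
qed

lemma nbrs_regular:
  assumes "p \<notin> irr"
  shows "nbrs GE p = nbrs full p"
  using assms by (auto simp: nbrs_def GE_def irr_def)

section \<open>Coordinates on the chain of copies, its growth and its degrees\<close>

definition coords :: "nat \<times> 'a set set \<times> 'a \<Rightarrow> ('a set + nat) set" where
  "coords p = (case p of (l, x, v) \<Rightarrow> Inl ` x \<union> Inr ` {..<l})"

text \<open>The copy index is written in unary, so a connector, whose ends share the empty label
  set, flips the single coordinate \<open>Inr l\<close>.\<close>

lemma coords_flip:
  assumes "{p, p'} \<in> GE"
  shows "\<exists>c. sym_diff (coords p) (coords p') = {c}"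
proof (cases "{p, p'} \<in> full")
  case True
  obtain l x u where p: "p = (l, x, u)" by (cases p) auto
  then obtain v where v: "{p, p'} = lift l x u v" "{u, v} \<in> E" using full_at[OF True] by blast
  have "u \<noteq> v" using edge_ends v by blast
  then have "p' = (l, toggle x {u, v}, v)" using v(1) p by (auto simp: lift_def doubleton_eq_iff)
  then have "sym_diff (coords p) (coords p') = Inl ` sym_diff x (toggle x {u, v})"
    using p by (auto simp: coords_def)
  then show ?thesis unfolding sym_diff_toggle by auto
next
  case False
  then have "{p, p'} \<in> conn" using assms by (auto simp: GE_def)
  then obtain l where "{p, p'} = {(l, {}, a), (Suc l, {}, a)}" by (auto simp: conn_def)
  then have "(p = (l, {}, a) \<and> p' = (Suc l, {}, a)) \<or> (p' = (l, {}, a) \<and> p = (Suc l, {}, a))"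
    by (simp add: doubleton_eq_iff) blast
  then have "sym_diff (coords p) (coords p') = {Inr l}" by (auto simp: coords_def)
  then show ?thesis by blast
qed

lemma finite_coords: "p \<in> VV \<Longrightarrow> finite (coords p)"
  using fibD by (auto simp: coords_def VV_def)

text \<open>Moving between copies and flipping labels both cost coordinates, so the ball lies in an
  interval of \<open>2 * k + 1\<close> copies times a ball in the cover. Bounding
  \<open>2 * k + 1\<close> by \<open>2 * 2 ^ k\<close> turns 256 into 512.\<close>

lemma card_coords_ball:
  assumes "p \<in> VV"
  shows "card {p' \<in> VV. card (sym_diff (coords p) (coords p')) \<le> k} \<le> 8 * 512 ^ k"
proof -
  obtain l x u where p: "p = (l, x, u)" "x \<in> fib u" using assms by (auto simp: VV_def)
  have "{p' \<in> VV. card (sym_diff (coords p) (coords p')) \<le> k} \<subseteq> {l - k..l + k} \<times> around k x"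
  proof
    fix p' assume "p' \<in> {p' \<in> VV. card (sym_diff (coords p) (coords p')) \<le> k}"
    then have p': "p' \<in> VV" and le: "card (sym_diff (coords p) (coords p')) \<le> k" by auto
    obtain l' y v where p'e: "p' = (l', y, v)" "v \<in> V" "y \<in> fib v" using p' by (auto simp: VV_def)
    have fin: "finite (sym_diff (coords p) (coords p'))" using finite_coords assms p' by blast
    have "card T \<le> k" if "T \<subseteq> sym_diff (coords p) (coords p')" for T
      using card_mono[OF fin that] le by linarith
    note T = this
    have "Inl ` sym_diff x y \<subseteq> sym_diff (coords p) (coords p')" using p p'e by (auto simp: coords_def)
    from T[OF this] have 1: "card (sym_diff x y) \<le> k" by (simp add: card_image)
    have "Inr ` {l..<l'} \<subseteq> sym_diff (coords p) (coords p')" using p p'e by (auto simp: coords_def)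
    from T[OF this] have 2: "l' - l \<le> k" by (simp add: card_image)
    have "Inr ` {l'..<l} \<subseteq> sym_diff (coords p) (coords p')" using p p'e by (auto simp: coords_def)
    from T[OF this] have 3: "l - l' \<le> k" by (simp add: card_image)
    show "p' \<in> {l - k..l + k} \<times> around k x" using 1 2 3 p'e by (auto simp: around_def)
  qed
  then have "card {p' \<in> VV. card (sym_diff (coords p) (coords p')) \<le> k} \<le> card ({l - k..l + k} \<times> around k x)"
    using card_around[OF p(2), of k] by (intro card_mono) auto
  also have "\<dots> \<le> (2 * k + 1) * (4 * 256 ^ k)"
    unfolding card_cartesian_product using card_around[OF p(2), of k] by (intro mult_le_mono) auto
  also have "\<dots> \<le> (2 * 2 ^ k) * (4 * 256 ^ k)"
  proof (rule mult_le_mono1)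
    have "k < 2 ^ k" by (rule less_exp)
    then show "2 * k + 1 \<le> 2 * 2 ^ k" by linarith
  qed
  also have "\<dots> = 8 * (2 * 256) ^ k" unfolding power_mult_distrib by simp
  finally show ?thesis by simp
qed

lemma degree_GG: "p \<in> VV \<Longrightarrow> card {e \<in> GE. p \<in> e} \<le> 10"
proof -
  assume p: "p \<in> VV"
  obtain l x u where pe: "p = (l, x, u)" by (cases p) auto
  have "nbrs GE p \<subseteq> nbrs full p \<union> {(Suc l, {}, a), (l - 1, {}, a)}"
    unfolding nbrs_def GE_def conn_def pe by (auto simp: doubleton_eq_iff)
  moreover have nf: "nbrs full p = (\<lambda>v. (l, toggle x {u, v}, v)) ` nbrs E u"
    using nbrs_full p pe by blast
  moreover have "card (nbrs full p) \<le> 8"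
    unfolding nf using deg card_image_le[OF fin_nbrs] order_trans by blast
  ultimately have "card (nbrs GE p) \<le> card (nbrs full p \<union> {(Suc l, {}, a), (l - 1, {}, a)})"
    using fin_nbrs by (intro card_mono) auto
  also have "\<dots> \<le> card (nbrs full p) + card {(Suc l, {} :: 'a set set, a), (l - 1, {}, a)}" by (rule card_Un_le)
  also have "\<dots> \<le> 8 + 2" using \<open>card (nbrs full p) \<le> 8\<close> card_insert_le_m1[of 2 "{(l - 1, {} :: 'a set set, a)}"]
    by (intro add_mono) auto
  finally show ?thesis using card_nbrs[of GE p] simple_GG by (simp add: simple_graph_def)
qed

section \<open>Connectedness of the hard graph\<close>

definition RR where "RR = {(p, p'). {p, p'} \<in> GE}"

lemma sym_RR: "sym RR"
  by (rule symI) (simp add: RR_def insert_commute)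

lemma RR_sym: "(p, p') \<in> RR\<^sup>* \<Longrightarrow> (p', p) \<in> RR\<^sup>*"
  by (rule symD[OF sym_rtrancl[OF sym_RR]])

lemma lift_kept:
  assumes "(l, x, u) \<in> VV" "{u, v} \<in> E" "l < m \<Longrightarrow> {u, v} \<noteq> lab l"
  shows "((l, x, u), (l, toggle x {u, v}, v)) \<in> RR"
proof -
  have "lift l x u v \<notin> removed"
  proof
    assume "lift l x u v \<in> removed"
    then have "\<exists>w'. lift l x u v = lift l x u w' \<and> {u, w'} = lab l \<and> l < m"
      using removed_at[of "lift l x u v" l x u] by (auto simp: lift_def)
    then obtain w' where w': "lift l x u v = lift l x u w'" "{u, w'} = lab l" "l < m" by blast
    then have "{u, v} = lab l" using lift_label[OF w'(1)] by simp
    then show False using assms(3) w'(3) by blast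
  qed
  then have "lift l x u v \<in> GE" using lift_full[OF assms(1,2)] by (simp add: GE_def)
  then show ?thesis by (simp add: RR_def lift_def)
qed

lemma piece_path:
  assumes F: "F \<subseteq> E" "\<And>e. e \<in> F \<Longrightarrow> l < m \<Longrightarrow> e \<noteq> lab l"
    and "(p, p') \<in> (cover_rel F)\<^sup>*" and "(l, p) \<in> VV"
  shows "(l, p') \<in> VV \<and> ((l, p), (l, p')) \<in> RR\<^sup>*"
  using assms(3)
proof (induction rule: rtrancl_induct)
  case base
  show ?case using assms(4) by simp
next
  case (step y z)
  obtain x u w v where yz: "y = (x, u)" "z = (w, v)" by (metis surj_pair)
  then have uv: "{u, v} \<in> F" "w = toggle x {u, v}" using step(2) by (auto simp: cover_rel_def toggle_def)
  have V: "(l, x, u) \<in> VV" using step(3) yz by simp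
  have E: "{u, v} \<in> E" using uv F by blast
  have "((l, x, u), (l, w, v)) \<in> RR" unfolding uv(2) using lift_kept[OF V E] F(2)[OF uv(1)] by blast
  moreover have "(l, w, v) \<in> VV" unfolding uv(2) by (rule toggle_VV[OF V E])
  ultimately show ?case using step(3) yz by (auto intro: rtrancl_into_rtrancl)
qed

text \<open>If \<open>lab l\<close> lies in both label sets or in neither, their difference avoids
  it. The difference is thus a join in \<open>E - {lab l}\<close>, which is still connected, and the
  cover walk for it uses no lift of \<open>lab l\<close>.\<close>

lemma same_side:
  assumes "(l, x, u) \<in> VV" "(l, y, v) \<in> VV" "l < m \<Longrightarrow> lab l \<in> x \<longleftrightarrow> lab l \<in> y"
  shows "((l, x, u), (l, y, v)) \<in> RR\<^sup>*"
proof -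
  define F where "F = (if l < m then E - {lab l} else E)"
  have F: "F \<subseteq> E" "\<And>e. e \<in> F \<Longrightarrow> l < m \<Longrightarrow> e \<noteq> lab l" by (auto simp: F_def split: if_splits)
  have con: "connects F V" using connE connE_minus by (simp add: F_def)
  have xy: "x \<in> fib u" "y \<in> fib v" "u \<in> V" "v \<in> V" using assms(1,2) by (auto simp: VV_def)
  have "sym_diff x y \<subseteq> F" using fibD[OF xy(1)] fibD[OF xy(2)] assms(3) by (auto simp: F_def)
  moreover have "\<forall>e\<in>F. card e = 2 \<and> e \<subseteq> V" "finite F" using F(1) two finE finite_subset by blast+
  ultimately have "((x, u), (sym_diff x (sym_diff x y), v)) \<in> (cover_rel F)\<^sup>*"
    using cover_connected[OF con] odd_verts_fib_diff[OF xy(1,2)] xy(3,4) by blast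
  moreover have "sym_diff x (sym_diff x y) = y" by blast
  ultimately have "((x, u), (y, v)) \<in> (cover_rel F)\<^sup>*" by simp
  then show ?thesis using piece_path[OF F _ assms(1)] by blast
qed

lemma e0_GE: "i < m \<Longrightarrow> e0 i \<in> GE"
  using lift_full[OF xsV labE, of i] by (auto simp: GE_def e0_def removed_def)

text \<open>The base point \<open>{}\<close> is on the side without \<open>lab l\<close>; the other
  side is reached through \<open>e0 l\<close>. Which end of \<open>e0 l\<close> is on the base side
  depends on whether \<open>xs l\<close> contains \<open>lab l\<close>.\<close>

lemma piece_connected:
  assumes "(l, x, v) \<in> VV"
  shows "((l, {}, a), (l, x, v)) \<in> RR\<^sup>*"
proof (cases "l < m \<and> lab l \<in> x")
  case False
  have "l < J" using assms by (simp add: VV_def)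
  then show ?thesis using False assms base_VV by (intro same_side) auto
next
  case True
  then have l: "l < m" "l < J" using J by auto
  let ?x = "xs l" and ?y = "toggle (xs l) (lab l)"
  have x: "(l, ?x, ea l) \<in> VV" by (rule xsV[OF l(1)])
  have y: "(l, ?y, eb l) \<in> VV" by (rule toggle_VV[OF x labE[OF l(1)]])
  have xy: "((l, ?x, ea l), (l, ?y, eb l)) \<in> RR" using e0_GE[OF l(1)] by (simp add: RR_def e0_def lift_def)
  have b: "(l, {}, a) \<in> VV" using base_VV l(2) by blast
  show ?thesis
  proof (cases "lab l \<in> ?x")
    case xin: True
    then have "lab l \<notin> ?y" by (simp add: mem_toggle)
    then have "((l, {}, a), (l, ?y, eb l)) \<in> RR\<^sup>*" using same_side[OF b y] by blast
    moreover have "((l, ?y, eb l), (l, ?x, ea l)) \<in> RR" using xy sym_RR by (meson symD)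
    moreover have "((l, ?x, ea l), (l, x, v)) \<in> RR\<^sup>*" using same_side[OF x assms] True xin by blast
    ultimately show ?thesis by (meson rtrancl_into_rtrancl rtrancl_trans)
  next
    case xout: False
    then have "((l, {}, a), (l, ?x, ea l)) \<in> RR\<^sup>*" using same_side[OF b x] by blast
    moreover have "lab l \<in> ?y" using xout by (simp add: mem_toggle)
    then have "((l, ?y, eb l), (l, x, v)) \<in> RR\<^sup>*" using same_side[OF y assms] True by blast
    ultimately show ?thesis using xy by (meson rtrancl_into_rtrancl rtrancl_trans)
  qed
qed

lemma connected_GG: "graph_connected GG"
proof -
  have chain: "((0, {}, a), (l, {}, a)) \<in> RR\<^sup>*" if "l < J" for l
    using that
  proof (induction l)
    case (Suc l)
    have "{(l, {}, a), (Suc l, {}, a)} \<in> conn" using Suc.prems by (auto simp: conn_def)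
    then have "((l, {}, a), (Suc l, {}, a)) \<in> RR" by (simp add: RR_def GE_def)
    then show ?case using Suc by (auto intro: rtrancl_into_rtrancl)
  qed simp
  have base: "((0, {}, a), p) \<in> RR\<^sup>*" if pV: "p \<in> VV" for p
  proof -
    obtain l x v where p: "p = (l, x, v)" "l < J" using pV by (auto simp: VV_def)
    show ?thesis using chain[OF p(2)] piece_connected[of l x v] pV p(1) by (metis rtrancl_trans)
  qed
  show ?thesis unfolding graph_connected_def fst_conv snd_conv RR_def[symmetric]
  proof (intro ballI)
    fix p p' assume "p \<in> VV" "p' \<in> VV"
    then show "(p, p') \<in> RR\<^sup>*" using RR_sym[OF base] base by (metis rtrancl_trans)
  qed
qed

section \<open>The surviving lifts are bridges\<close>

lemma rtrancl_leaves:
  assumes "(p, p') \<in> R\<^sup>*" "p \<in> S" "p' \<notin> S"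
  shows "\<exists>s t. (s, t) \<in> R \<and> s \<in> S \<and> t \<notin> S"
  using assms by (induction rule: rtrancl_induct) blast+

text \<open>Let \<open>S\<close> be the part of copy \<open>i\<close> whose label sets contain
  \<open>lab i\<close>. Connectors meet only empty label sets and so avoid \<open>S\<close>. Any
  other edge leaving \<open>S\<close> flips \<open>lab i\<close>, so it is a lift of
  \<open>lab i\<close> in copy \<open>i\<close>, and \<open>e0 i\<close> is the only one not
  removed.\<close>

lemma bridge_e0:
  assumes i: "i < m" and F: "F \<subseteq> GE" "graph_connected (VV, F)"
  shows "e0 i \<in> F"
proof -
  define S :: "(nat \<times> 'a set set \<times> 'a) set" where "S = {(l, x, v). l = i \<and> lab i \<in> x}"
  let ?p = "(i, xs i, ea i)" and ?p' = "(i, toggle (xs i) (lab i), eb i)"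
  let ?R = "{(p, p'). {p, p'} \<in> F}"
  have pV: "?p \<in> VV" by (rule xsV[OF i])
  have pV': "?p' \<in> VV" by (rule toggle_VV[OF pV labE[OF i]])
  have con: "(p, p') \<in> ?R\<^sup>*" if "p \<in> VV" "p' \<in> VV" for p p'
    using F(2) that by (simp add: graph_connected_def)
  have one: "(?p \<in> S) \<noteq> (?p' \<in> S)" by (simp add: S_def mem_toggle)
  then obtain s t where st: "{s, t} \<in> F" "s \<in> S" "t \<notin> S"
    using rtrancl_leaves[OF con[OF pV pV'], of S] rtrancl_leaves[OF con[OF pV' pV], of S] by blast
  obtain x u where s: "s = (i, x, u)" "lab i \<in> x" using st(2) by (auto simp: S_def)
  have "{s, t} \<notin> conn" using s by (auto simp: conn_def doubleton_eq_iff)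
  then have full: "{s, t} \<in> full" "{s, t} \<notin> removed" using st(1) F(1) by (auto simp: GE_def)
  then obtain v where v: "{s, t} = lift i x u v" "{u, v} \<in> E" "(i, x, u) \<in> VV" using full_at s by blast
  have "u \<noteq> v" using edge_ends v by blast
  then have "t = (i, toggle x {u, v}, v)" using v(1) s by (auto simp: lift_def doubleton_eq_iff)
  then have "lab i \<notin> toggle x {u, v}" using st(3) by (simp add: S_def)
  then have "{u, v} = lab i" using s by (simp add: mem_toggle)
  then have "{s, t} \<in> e0 ` {..<m}" using full(2) v i unfolding removed_def by blast
  then obtain j where j: "j < m" "{s, t} = e0 j" by blast
  then have "i = j" using v(1) lift_label unfolding e0_def by metis
  then show ?thesis using j st(1) by simp
qed

section \<open>Neighbourhoods in a copy, measured by the number of flipped labels\<close>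

definition near :: "(nat \<times> 'a set set \<times> 'a) set \<Rightarrow> nat \<Rightarrow> (nat \<times> 'a set set \<times> 'a) set" where
  "near S j = {(l, x, v). (l, x, v) \<in> VV \<and> (\<exists>y w. (l, y, w) \<in> S \<and> (l, y, w) \<in> VV \<and> card (sym_diff x y) \<le> j)}"

lemma near_VV: "near S j \<subseteq> VV"
  by (auto simp: near_def)

lemma near_Suc: "near S j \<subseteq> near S (Suc j)"
  unfolding near_def by (auto intro: le_SucI)

lemma near_0: "p \<in> S \<Longrightarrow> p \<in> VV \<Longrightarrow> p \<in> near S j"
  unfolding near_def by (cases p) (auto intro!: exI)

text \<open>Walking along a cover edge changes the flip distance by at most one, so
  \<open>near S j\<close> contains the ball of radius \<open>j\<close> in the cover. Connectors are
  left aside because their ends already belong to \<open>irr\<close>.\<close>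

lemma near_step:
  assumes "{p, p'} \<in> full" "p' \<in> near S j"
  shows "p \<in> near S (Suc j)"
proof -
  obtain l x u where p: "p = (l, x, u)" by (cases p) auto
  then obtain v where v: "{p, p'} = lift l x u v" "{u, v} \<in> E" "(l, x, u) \<in> VV" using full_at assms(1) by blast
  have "u \<noteq> v" using edge_ends v by blast
  then have p': "p' = (l, toggle x {u, v}, v)" using v(1) p by (auto simp: lift_def doubleton_eq_iff)
  then obtain y w where y: "(l, y, w) \<in> S" "(l, y, w) \<in> VV" "card (sym_diff (toggle x {u, v}) y) \<le> j"
    using assms(2) by (auto simp: near_def)
  have "toggle x {u, v} \<in> fib v" using p' assms(2) by (auto simp: near_def VV_def)
  then have fin: "finite (sym_diff (toggle x {u, v}) y)" using y(2) fibD by (auto simp: VV_def)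
  have "sym_diff x y \<subseteq> insert {u, v} (sym_diff (toggle x {u, v}) y)" by (auto simp: toggle_def)
  then have "card (sym_diff x y) \<le> card (insert {u, v} (sym_diff (toggle x {u, v}) y))"
    using fin by (intro card_mono) auto
  also have "\<dots> \<le> Suc j" using y(3) fin by (simp add: card_insert_if)
  finally show ?thesis using p v(3) y(1,2) by (auto simp: near_def)
qed

lemma card_near:
  assumes "S \<subseteq> VV"
  shows "card (near S j) \<le> card S * (4 * 256 ^ j)"
proof -
  have finS: "finite S" using assms finVV finite_subset by blast
  have fa: "finite (around j (fst (snd s)))" "card (around j (fst (snd s))) \<le> 4 * 256 ^ j" if "s \<in> S" for s
    using card_around[of "fst (snd s)" "snd (snd s)" j] that assms by (auto simp: VV_def)
  have "near S j \<subseteq> (\<Union>s\<in>S. Pair (fst s) ` around j (fst (snd s)))"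
  proof
    fix p assume "p \<in> near S j"
    then obtain l x v y w where p: "p = (l, x, v)" "(l, x, v) \<in> VV" "(l, y, w) \<in> S" "card (sym_diff x y) \<le> j"
      by (auto simp: near_def)
    have "sym_diff y x = sym_diff x y" by blast
    then have "(x, v) \<in> around j y" using p by (simp add: around_def VV_def)
    then show "p \<in> (\<Union>s\<in>S. Pair (fst s) ` around j (fst (snd s)))" using p(1,3) by force
  qed
  then have "card (near S j) \<le> card (\<Union>s\<in>S. Pair (fst s) ` around j (fst (snd s)))"
    using finS fa by (intro card_mono) auto
  also have "\<dots> \<le> (\<Sum>s\<in>S. card (Pair (fst s) ` around j (fst (snd s))))" by (rule card_UN_le[OF finS])
  also have "\<dots> \<le> (\<Sum>s\<in>S. 4 * 256 ^ j)"
    by (rule sum_mono, rule order_trans[OF card_image_le]) (use fa in auto)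
  finally show ?thesis by simp
qed

lemma irr_VV: "irr \<subseteq> VV"
  using removed_full full_VV conn_VV by (fastforce simp: irr_def)

text \<open>A connector end has label set \<open>{}\<close>, which is too far from
  \<open>xs i\<close>. An end of a removed edge lies over \<open>ea i\<close> or
  \<open>eb i\<close>; its difference from \<open>xs i\<close>, in the second case with
  \<open>lab i\<close> toggled, is even with at most \<open>q + 2 < g\<close> edges, hence empty.
  The removed edge would then be \<open>e0 i\<close> itself.\<close>

lemma e0_far:
  assumes i: "i < m" and y: "(i, y, w) \<in> irr" and le: "card (sym_diff (xs i) y) \<le> q + 1"
  shows False
proof -
  have x: "xs i \<in> fib (ea i)" "q + 1 < card (xs i)" using xs[OF i] by auto
  have yV: "(i, y, w) \<in> VV" using y irr_VV by blast
  have "(i, y, w) \<notin> \<Union>conn"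
  proof
    assume "(i, y, w) \<in> \<Union>conn"
    then have "y = {}" by (auto simp: conn_def)
    then show False using le x by simp
  qed
  then obtain r where r: "r \<in> removed" "(i, y, w) \<in> r" using y by (auto simp: irr_def)
  then obtain w' where w': "r = lift i y w w'" "{w, w'} = lab i" "r \<notin> e0 ` {..<m}"
    using removed_at by blast
  have ne: "r \<noteq> e0 i" using w'(3) i by blast
  have yf: "y \<in> fib w" using yV by (simp add: VV_def)
  have small: "z = {}" if "z \<subseteq> E" "odd_verts z = {}" "card z \<le> q + 2" for z
  proof (rule ccontr)
    assume "z \<noteq> {}"
    then have "g \<le> card z" using girth that(1,2) unfolding girth_ge_def by blast
    then show False using that(3) q by linarith
  qed
  have ab: "ea i \<noteq> eb i" using edge_ends[OF labE[OF i]] by blast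
  have xyE: "sym_diff (xs i) y \<subseteq> E" using fibD[OF x(1)] fibD[OF yf] by blast
  consider "w = ea i" "w' = eb i" | "w = eb i" "w' = ea i" using w'(2) by (auto simp: doubleton_eq_iff)
  then show False
  proof cases
    case 1
    have "odd_verts (sym_diff (xs i) y) = {}" using odd_verts_fib_diff[OF x(1) yf] 1 by simp
    then have "sym_diff (xs i) y = {}" using small[OF xyE] le by simp
    then have "y = xs i" by blast
    then show False using ne w'(1) 1 by (simp add: e0_def)
  next
    case 2
    let ?z = "toggle (sym_diff (xs i) y) (lab i)"
    have fz: "finite (sym_diff (xs i) y)" using xyE finE finite_subset by blast
    have "odd_verts ?z = sym_diff (sym_diff {ea i} {w}) (lab i)"
      unfolding toggle_def
      using odd_verts_sym_diff[of "sym_diff (xs i) y" "{lab i}"] fz odd_verts_fib_diff[OF x(1) yf] by simp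
    also have "\<dots> = {}" using 2 ab by auto
    finally have o: "odd_verts ?z = {}" .
    have "?z \<subseteq> E" using xyE labE[OF i] by (auto simp: toggle_def)
    moreover have "card ?z \<le> card (insert (lab i) (sym_diff (xs i) y))"
      using fz by (intro card_mono) (auto simp: toggle_def)
    then have "card ?z \<le> q + 2" using le fz by (simp add: card_insert_if split: if_splits)
    ultimately have "?z = {}" using small o by blast
    then have "y = toggle (xs i) (lab i)" unfolding toggle_def by blast
    then have "r = lift i (toggle (xs i) (lab i)) (eb i) (ea i)" using w'(1) 2 by simp
    then show False using ne lift_flip[of i "xs i" "ea i" "eb i"] by (simp add: e0_def)
  qed
qed

text \<open>Translation by the even set \<open>z\<close> is the deck transformation taking
  \<open>xs i\<close> to \<open>x\<close>. Combined with the swap of copies \<open>i\<close> and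
  \<open>l\<close> it can fail to be an automorphism only where a vertex or its image is irregular,
  so \<open>D\<close> is built around \<open>irr\<close> and its image. Distance from
  \<open>irr\<close> is assumed; distance from the image is transported back to the surroundings of
  \<open>e0 i\<close>.\<close>

lemma bridge_like_lift:
  assumes l: "l < J" and i: "i < m" and xV: "(l, x, ea i) \<in> VV"
    and far: "(l, x, ea i) \<notin> near irr q" "(l, toggle x (lab i), eb i) \<notin> near irr q"
    and b: "2 * card irr * (4 * 256 ^ q) \<le> b"
  shows "bridge_like GG q b (lift l x (ea i) (eb i))"
proof -
  define z where "z = sym_diff x (xs i)"
  have x: "x \<in> fib (ea i)" using xV by (simp add: VV_def)
  have xi: "xs i \<in> fib (ea i)" using xs[OF i] by blast
  have z: "z \<subseteq> E" "odd_verts z = {}"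
    using odd_verts_fib_diff[OF x xi] fibD[OF x] fibD[OF xi] by (auto simp: z_def)
  define \<tau> where "\<tau> = Transposition.transpose i l"
  have \<tau>J: "\<tau> l' < J \<longleftrightarrow> l' < J" for l'
    using i J l by (auto simp: \<tau>_def Transposition.transpose_def)
  have \<tau>\<tau>: "\<tau> (\<tau> l') = l'" for l' by (simp add: \<tau>_def)
  have \<tau>i: "\<tau> i = l" "\<tau> l = i" by (simp_all add: \<tau>_def)
  define \<theta> where "\<theta> p = (case p of (l', y, v) \<Rightarrow> (\<tau> l', sym_diff y z, v))" for p :: "nat \<times> 'a set set \<times> 'a"
  have \<theta>: "\<theta> (l', y, v) = (\<tau> l', sym_diff y z, v)" for l' y v by (simp add: \<theta>_def)
  have \<theta>V: "\<theta> p \<in> VV" if "p \<in> VV" for p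
  proof -
    obtain l' y v where p: "p = (l', y, v)" by (cases p) auto
    have "sym_diff y z \<in> fib v" using fib_shift[OF _ z] that p by (simp add: VV_def)
    then show ?thesis using that unfolding p \<theta> VV_def by (simp add: \<tau>J)
  qed
  have \<theta>\<theta>: "\<theta> (\<theta> p) = p" for p
  proof -
    obtain l' y v where p: "p = (l', y, v)" by (cases p) auto
    show ?thesis unfolding p \<theta> \<tau>\<tau> sym_diff_cancel ..
  qed
  have auto_full: "nbrs full (\<theta> p) = \<theta> ` nbrs full p" if pV: "p \<in> VV" for p
  proof -
    obtain l' y v where p: "p = (l', y, v)" by (cases p) auto
    have 1: "nbrs full (\<theta> p) = (\<lambda>w. (\<tau> l', toggle (sym_diff y z) {v, w}, w)) ` nbrs E v"
      using nbrs_full[of "\<tau> l'" "sym_diff y z" v] \<theta>V[OF pV] unfolding p \<theta> by blast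
    have 2: "nbrs full p = (\<lambda>w. (l', toggle y {v, w}, w)) ` nbrs E v"
      using nbrs_full pV unfolding p by blast
    show ?thesis unfolding 1 2 image_image \<theta> toggle_sym_diff ..
  qed
  define D where "D = near (irr \<union> \<theta> ` irr)"
  have sub: "irr \<union> \<theta> ` irr \<subseteq> VV" using irr_VV \<theta>V by blast
  have inD: "p \<in> D j" if "p \<in> irr \<union> \<theta> ` irr" for p j
    unfolding D_def by (rule near_0[OF that]) (rule subsetD[OF sub that])
  let ?y0 = "(i, xs i, ea i)" and ?z0 = "(i, toggle (xs i) (lab i), eb i)"
  have sx: "sym_diff (xs i) z = x" unfolding z_def by blast
  have \<theta>y0: "\<theta> ?y0 = (l, x, ea i)" unfolding \<theta> \<tau>i sx ..
  have \<theta>z0: "\<theta> ?z0 = (l, toggle x (lab i), eb i)" unfolding \<theta> \<tau>i toggle_sym_diff[symmetric] sx ..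
  \<comment> \<open>The bound 1 covers both ends of \<open>e0 i\<close>, as the label set at the
    second differs from \<open>xs i\<close> by one flip. This extra flip explains the radius
    \<open>q + 1\<close> in \<open>e0_far\<close>.\<close>
  have far\<theta>: "(l, sym_diff y' z, w) \<notin> near (\<theta> ` irr) q"
    if y': "y' \<subseteq> E" "card (sym_diff (xs i) y') \<le> 1" for y' w
  proof
    assume "(l, sym_diff y' z, w) \<in> near (\<theta> ` irr) q"
    then obtain u v where u: "(l, u, v) \<in> \<theta> ` irr" "(l, u, v) \<in> VV"
        "card (sym_diff (sym_diff y' z) u) \<le> q"
      unfolding near_def mem_Collect_eq prod.case by (elim conjE exE) (rule that)
    then obtain p where p: "(l, u, v) = \<theta> p" "p \<in> irr" by blast
    have "p = \<theta> (l, u, v)" using p(1) \<theta>\<theta> by simp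
    then have pe: "(i, sym_diff u z, v) \<in> irr" using p(2) unfolding \<theta> \<tau>i by simp
    have "u \<in> fib v" using u(2) by (simp add: VV_def)
    then have uE: "u \<subseteq> E" using fibD by blast
    have eq: "sym_diff (sym_diff y' z) u = sym_diff y' (sym_diff u z)" by blast
    have fin: "finite (xs i)" "finite y'" "finite (sym_diff u z)"
      using fibD[OF xi] finite_subset[OF y'(1) finE] finite_subset[OF uE finE] finite_subset[OF z(1) finE]
      by simp_all
    have "sym_diff (xs i) (sym_diff u z) \<subseteq> sym_diff (xs i) y' \<union> sym_diff y' (sym_diff u z)" by blast
    then have "card (sym_diff (xs i) (sym_diff u z)) \<le> card (sym_diff (xs i) y' \<union> sym_diff y' (sym_diff u z))"
      using fin by (intro card_mono) auto
    also have "\<dots> \<le> card (sym_diff (xs i) y') + card (sym_diff y' (sym_diff u z))" by (rule card_Un_le)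
    also have "\<dots> \<le> 1 + q" using y'(2) u(3) unfolding eq by (rule add_mono)
    finally show False using e0_far[OF i pe] by simp
  qed
  have nearUn: "near (S \<union> T) j = near S j \<union> near T j" for S T j
    unfolding near_def by blast
  have xiE: "xs i \<subseteq> E" "toggle (xs i) (lab i) \<subseteq> E"
    using fibD[OF xi] labE[OF i] by (auto simp: toggle_def)
  have "(l, sym_diff (xs i) z, ea i) \<notin> near (\<theta> ` irr) q"
    by (rule far\<theta>) (use xiE in auto)
  then have 1: "\<theta> ?y0 \<notin> D q" unfolding \<theta>y0 D_def nearUn sx using far(1) by blast
  have "(l, sym_diff (toggle (xs i) (lab i)) z, eb i) \<notin> near (\<theta> ` irr) q"
    by (rule far\<theta>[OF xiE(2)]) (simp only: sym_diff_toggle card.insert card.empty finite.emptyI, simp)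
  then have 2: "\<theta> ?z0 \<notin> D q" unfolding \<theta>z0 D_def nearUn toggle_sym_diff[symmetric] sx using far(2) by blast
  have 3: "nbrs GE p = \<theta> ` nbrs GE (\<theta> p)" if p: "p \<in> VV" "p \<notin> D 0" for p
  proof -
    have "p \<notin> irr" using inD p(2) by blast
    moreover have "\<theta> p \<notin> irr"
    proof
      assume "\<theta> p \<in> irr"
      then have "\<theta> (\<theta> p) \<in> \<theta> ` irr" by (rule imageI)
      then show False using inD p(2) \<theta>\<theta> by simp
    qed
    ultimately show ?thesis
      using nbrs_regular auto_full[OF \<theta>V[OF p(1)]] \<theta>\<theta> by simp
  qed
  have 4: "w \<notin> D j" if vw: "{v, w} \<in> GE" "v \<notin> D (Suc j)" for v w j
  proof -
    have "v \<notin> irr" using inD vw(2) by blast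
    then have "{v, w} \<in> full" using vw(1) by (auto simp: irr_def GE_def)
    then show ?thesis using near_step vw(2) unfolding D_def by blast
  qed
  have 5: "card (D q) \<le> b"
  proof -
    have fi: "finite irr" using irr_VV finVV finite_subset by blast
    have "card (irr \<union> \<theta> ` irr) \<le> card irr + card (\<theta> ` irr)" by (rule card_Un_le)
    also have "\<dots> \<le> 2 * card irr" using card_image_le[OF fi, of \<theta>] by simp
    finally have "card (irr \<union> \<theta> ` irr) * (4 * 256 ^ q) \<le> 2 * card irr * (4 * 256 ^ q)" by (rule mult_le_mono1)
    then show ?thesis using card_near[OF sub, of q] b unfolding D_def by linarith
  qed
  have 6: "{?y0, ?z0} = e0 i" by (simp add: e0_def lift_def)
  have 7: "lift l x (ea i) (eb i) = {\<theta> ?y0, \<theta> ?z0}" unfolding \<theta>y0 \<theta>z0 lift_def ..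
  show ?thesis unfolding bridge_like_def fst_conv snd_conv
  proof (rule exI[of _ ?y0], rule exI[of _ ?z0], rule exI[of _ \<theta>], rule exI[of _ D], intro conjI)
    show "lift l x (ea i) (eb i) = {\<theta> ?y0, \<theta> ?z0}" by (rule 7)
    show "{?y0, ?z0} \<in> GE" unfolding 6 by (rule e0_GE[OF i])
    show "\<forall>F\<subseteq>GE. graph_connected (VV, F) \<longrightarrow> {?y0, ?z0} \<in> F" unfolding 6 using bridge_e0[OF i] by blast
    show "\<forall>v\<in>VV. \<theta> v \<in> VV \<and> \<theta> (\<theta> v) = v" using \<theta>V \<theta>\<theta> by blast
    show "\<forall>v\<in>VV. v \<notin> D 0 \<longrightarrow> nbrs GE v = \<theta> ` nbrs GE (\<theta> v)" using 3 by blast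
    show "\<forall>j. D j \<subseteq> D (Suc j) \<and> D j \<subseteq> VV" unfolding D_def using near_Suc near_VV by blast
    show "\<forall>j v w. {v, w} \<in> GE \<longrightarrow> v \<notin> D (Suc j) \<longrightarrow> w \<notin> D j" using 4 by blast
  qed (use 1 2 5 in auto)
qed

section \<open>Counting vertices, irregular vertices and bridge-like edges\<close>

lemma card_VV: "card VV = J * card V * fs"
proof -
  have "bij_betw (\<lambda>(l, v, x). (l, x, v)) ({..<J} \<times> Sigma V fib) VV"
    by (rule bij_betw_byWitness[where f' = "\<lambda>(l, x, v). (l, v, x)"]) (auto simp: VV_def)
  then have "card VV = card ({..<J} \<times> Sigma V fib)" by (simp add: bij_betw_same_card)
  also have "\<dots> = J * (\<Sum>v\<in>V. card (fib v))"
    using finV finfib by (simp add: card_cartesian_product)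
  also have "(\<Sum>v\<in>V. card (fib v)) = card V * fs" using cardfib by simp
  finally show ?thesis by simp
qed

text \<open>A damaged copy contributes at most the two fibres over the ends of its edge, and the
  connectors use one base point per copy.\<close>

lemma card_irr: "card irr \<le> 2 * m * fs + J"
proof -
  let ?A = "(\<lambda>(l, v, x). (l, x, v)) ` (SIGMA l:{..<m}. SIGMA v:lab l. fib v)"
  let ?B = "(\<lambda>l. (l, {} :: 'a set set, a)) ` {..<J}"
  have "irr \<subseteq> ?A \<union> ?B"
  proof
    fix p assume p: "p \<in> irr"
    obtain l y w where pe: "p = (l, y, w)" by (cases p) auto
    consider r where "r \<in> removed" "p \<in> r" | "p \<in> \<Union>conn" using p by (auto simp: irr_def)
    then show "p \<in> ?A \<union> ?B"
    proof cases
      case 1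
      then obtain w' where "{w, w'} = lab l" "l < m" "(l, y, w) \<in> VV" using removed_at pe by blast
      then have "(l, w, y) \<in> (SIGMA l:{..<m}. SIGMA v:lab l. fib v)" by (auto simp: VV_def)
      then have "(\<lambda>(l, v, x). (l, x, v)) (l, w, y) \<in> ?A" by (rule imageI)
      then show ?thesis using pe by simp
    next
      case 2
      then obtain l where "Suc l < J" "p = (l, {}, a) \<or> p = (Suc l, {}, a)" unfolding conn_def by blast
      then have "p \<in> ?B" by auto
      then show ?thesis by blast
    qed
  qed
  moreover have fin: "finite (SIGMA l:{..<m}. SIGMA v:lab l. fib v)" using finfib by auto
  ultimately have "card irr \<le> card (?A \<union> ?B)" by (intro card_mono) auto
  also have "\<dots> \<le> card ?A + card ?B" by (rule card_Un_le)
  also have "card ?B \<le> J" using card_image_le[of "{..<J}"] by fastforce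
  also have "card ?A \<le> card (SIGMA l:{..<m}. SIGMA v:lab l. fib v)" by (rule card_image_le[OF fin])
  also have "\<dots> = (\<Sum>l<m. \<Sum>v\<in>lab l. card (fib v))"
    using finfib by simp
  also have "\<dots> \<le> (\<Sum>l<m. 2 * fs)"
  proof (rule sum_mono)
    fix l assume "l \<in> {..<m}"
    then have e: "lab l \<in> E" using labE by blast
    then have "card (lab l) = 2" using two by blast
    moreover have "(\<Sum>v\<in>lab l. card (fib v)) = (\<Sum>v\<in>lab l. fs)"
      by (rule sum.cong[OF refl]) (use cardfib edge_ends[OF e] in blast)
    ultimately show "(\<Sum>v\<in>lab l. card (fib v)) \<le> 2 * fs" by simp
  qed
  finally show ?thesis by simp
qed

definition forced :: "(nat \<times> 'a set set \<times> 'a) set set" where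
  "forced = {lift l x (ea i) (eb i) | l i x. l < J \<and> i < m \<and> x \<in> fib (ea i) \<and>
     (l, x, ea i) \<notin> near irr q \<and> (l, toggle x (lab i), eb i) \<notin> near irr q}"

lemma eaV: "i < m \<Longrightarrow> ea i \<in> V \<and> eb i \<in> V \<and> ea i \<noteq> eb i"
  using edge_ends[OF labE] .

lemma forced_bridge_like:
  assumes "e \<in> forced" "2 * card irr * (4 * 256 ^ q) \<le> b"
  shows "bridge_like GG q b e"
proof -
  obtain l i x where e: "e = lift l x (ea i) (eb i)" "l < J" "i < m" "x \<in> fib (ea i)"
     "(l, x, ea i) \<notin> near irr q" "(l, toggle x (lab i), eb i) \<notin> near irr q"
    using assms(1) unfolding forced_def by blast
  have "(l, x, ea i) \<in> VV" using e eaV by (simp add: VV_def)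
  then show ?thesis unfolding e(1) using bridge_like_lift e assms(2) by blast
qed

lemma forced_GE: "forced \<subseteq> GE"
proof
  fix e assume "e \<in> forced"
  then obtain l i x where e: "e = lift l x (ea i) (eb i)" "l < J" "i < m" "x \<in> fib (ea i)"
     "(l, x, ea i) \<notin> near irr q"
    unfolding forced_def by blast
  have V: "(l, x, ea i) \<in> VV" using e eaV by (simp add: VV_def)
  have "(l, x, ea i) \<notin> irr" using near_0[OF _ V] e(5) by blast
  moreover have "(l, x, ea i) \<in> e" using e(1) by (simp add: lift_def)
  ultimately have "e \<notin> removed" by (auto simp: irr_def)
  then show "e \<in> GE" using lift_full[OF V labE] e by (simp add: GE_def)
qed

text \<open>With the orientation from \<open>ea i\<close> to \<open>eb i\<close> fixed, each cover
  edge comes from exactly one triple \<open>(l, i, x)\<close>. A vertex near \<open>irr\<close>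
  spoils at most \<open>m\<close> triples as first end and \<open>m\<close> as second end.\<close>

lemma card_forced:
  "card forced \<le> J * m * fs" "J * m * fs \<le> card forced + 2 * m * card (near irr q)"
proof -
  let ?I = "{..<J} \<times> (SIGMA i:{..<m}. fib (ea i))"
  let ?f = "\<lambda>(l, i, x). lift l x (ea i) (eb i)"
  let ?N = "near irr q"
  have finI: "finite ?I" using finfib by auto
  have cI: "card ?I = J * m * fs"
  proof -
    have "card ?I = J * (\<Sum>i<m. card (fib (ea i)))" using finfib by (simp add: card_cartesian_product)
    also have "(\<Sum>i<m. card (fib (ea i))) = m * fs" using cardfib eaV by simp
    finally show ?thesis by simp
  qed
  have inj: "inj_on ?f ?I"
  proof (rule inj_onI)
    fix t t' assume t: "t \<in> ?I" "t' \<in> ?I" "?f t = ?f t'"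
    obtain l i x l' i' x' where tt: "t = (l, i, x)" "t' = (l', i', x')" by (metis prod_cases3)
    then have i: "i < m" "i' < m" and eq: "lift l x (ea i) (eb i) = lift l' x' (ea i') (eb i')"
      using t by auto
    have "l = l'" "lab i = lab i'" using lift_label[OF eq] by auto
    then have "i = i'" using lab i by (auto simp: bij_betw_def inj_on_def)
    moreover have "x = x'"
    proof -
      have "(l, x, ea i) \<in> lift l x (ea i) (eb i)" by (simp add: lift_def)
      then have "(l, x, ea i) \<in> lift l' x' (ea i') (eb i')" by (simp only: eq)
      then have "(l, x, ea i) \<in> lift l' x' (ea i) (eb i)" unfolding \<open>i = i'\<close>[symmetric] .
      then have "(l, x, ea i) = (l', x', ea i) \<or> (l, x, ea i) = (l', toggle x' (lab i), eb i)"
        unfolding lift_def by blast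
      then show ?thesis using eaV[OF i(1)] by simp
    qed
    ultimately show "t = t'" using tt \<open>l = l'\<close> by simp
  qed
  have "forced \<subseteq> ?f ` ?I"
    unfolding forced_def by force
  then have "card forced \<le> card (?f ` ?I)" using finI by (intro card_mono) auto
  then show "card forced \<le> J * m * fs" using card_image_le[OF finI, of ?f] cI by simp
  define B1 where "B1 = {t \<in> ?I. case t of (l, i, x) \<Rightarrow> (l, x, ea i) \<in> ?N}"
  define B2 where "B2 = {t \<in> ?I. case t of (l, i, x) \<Rightarrow> (l, toggle x (lab i), eb i) \<in> ?N}"
  have finN: "finite ?N" using near_VV finVV finite_subset by blast
  have c1: "card B1 \<le> m * card ?N"
  proof -
    have "card B1 \<le> card ({..<m} \<times> ?N)"
      by (rule card_inj_on_le[where f = "\<lambda>(l, i, x). (i, (l, x, ea i))"])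
        (auto simp: B1_def inj_on_def finN)
    then show ?thesis by (simp add: card_cartesian_product)
  qed
  have c2: "card B2 \<le> m * card ?N"
  proof -
    have "card B2 \<le> card ({..<m} \<times> ?N)"
    proof (rule card_inj_on_le[where f = "\<lambda>(l, i, x). (i, (l, toggle x (lab i), eb i))"])
      show "inj_on (\<lambda>(l, i, x). (i, (l, toggle x (lab i), eb i))) B2"
        by (rule inj_on_inverseI[where g = "\<lambda>(i, (l, x, v)). (l, i, toggle x (lab i))"]) auto
    qed (auto simp: B2_def finN)
    then show ?thesis by (simp add: card_cartesian_product)
  qed
  have "?f ` (?I - (B1 \<union> B2)) \<subseteq> forced"
  proof
    fix e assume "e \<in> ?f ` (?I - (B1 \<union> B2))"
    then obtain l i x where "e = lift l x (ea i) (eb i)" "l < J" "i < m" "x \<in> fib (ea i)"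
       "(l, x, ea i) \<notin> ?N" "(l, toggle x (lab i), eb i) \<notin> ?N"
      unfolding B1_def B2_def by force
    then show "e \<in> forced" unfolding forced_def by blast
  qed
  moreover have "finite forced" using forced_GE simple_GG finite_edges[of GG] finite_subset by auto
  ultimately have "card (?f ` (?I - (B1 \<union> B2))) \<le> card forced" by (intro card_mono)
  moreover have "card (?f ` (?I - (B1 \<union> B2))) = card (?I - (B1 \<union> B2))"
    by (rule card_image) (rule inj_on_subset[OF inj], blast)
  moreover have "card ?I - card (B1 \<union> B2) \<le> card (?I - (B1 \<union> B2))"
    by (rule diff_card_le_card_Diff) (use finI in \<open>auto simp: B1_def B2_def\<close>)
  moreover have "card (B1 \<union> B2) \<le> card B1 + card B2" by (rule card_Un_le)
  ultimately show "J * m * fs \<le> card forced + 2 * m * card ?N" using c1 c2 cI by linarith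
qed

end

section \<open>The theorem\<close>

text \<open>Carries the hard graph, whose vertices are triples, over to natural numbers; the
  coordinates are read through the inverse of \<open>enc\<close>.\<close>

lemma non_expanding_image:
  fixes X :: "'v \<Rightarrow> 'c set"
  assumes G: "simple_graph G" and enc: "inj_on enc (verts G)"
    and fX: "\<And>v. v \<in> verts G \<Longrightarrow> finite (X v)"
    and flip: "\<And>u v. {u, v} \<in> edges G \<Longrightarrow> \<exists>c. sym_diff (X u) (X v) = {c}"
    and deg: "\<And>v. v \<in> verts G \<Longrightarrow> card {e \<in> edges G. v \<in> e} \<le> 10"
    and cnt: "\<And>u k. u \<in> verts G \<Longrightarrow>
      card {v \<in> verts G. card (sym_diff (X u) (X v)) \<le> k} \<le> 8 * 512 ^ k"
  defines "H \<equiv> (enc ` verts G, (\<lambda>e. enc ` e) ` edges G)"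
  shows "simple_graph H \<and> non_expanding (\<lambda>x. 1 / log 2 x * (70 * log 2 (log 2 x))\<^sup>2) H"
proof -
  define dec where "dec = inv_into (verts G) enc"
  have dec: "dec (enc v) = v" if "v \<in> verts G" for v using enc that by (simp add: dec_def)
  have eV: "e \<subseteq> verts G" "card e = 2" if "e \<in> edges G" for e using G that by (auto simp: simple_graph_def)
  have finV: "finite (verts G)" using G by (simp add: simple_graph_def)
  have simple: "simple_graph H" unfolding simple_graph_def
  proof (intro conjI ballI)
    fix e assume "e \<in> edges H"
    then obtain e' where e': "e' \<in> edges G" "e = enc ` e'" by (auto simp: H_def)
    then have "card e = card e'" using eV(1) enc by (simp add: card_image inj_on_subset)
    then show "e \<subseteq> verts H" "card e = 2" using eV[OF e'(1)] e' by (auto simp: H_def)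
  qed (simp add: H_def finV)
  have "non_expanding (\<lambda>x. 1 / log 2 x * (70 * log 2 (log 2 x))\<^sup>2) H"
  proof (rule non_expanding_of_coordinates[where X = "\<lambda>v. X (dec v)", OF simple])
    fix v assume "v \<in> verts H"
    then obtain w where w: "w \<in> verts G" "v = enc w" by (auto simp: H_def)
    show "finite (X (dec v))" using fX w dec by simp
    have "{e \<in> edges H. v \<in> e} \<subseteq> (\<lambda>e. enc ` e) ` {e \<in> edges G. w \<in> e}"
    proof
      fix e assume "e \<in> {e \<in> edges H. v \<in> e}"
      then obtain e' where e': "e' \<in> edges G" "e = enc ` e'" "v \<in> e" by (auto simp: H_def)
      then have "w \<in> e'" using eV(1)[OF e'(1)] w enc by (metis inj_on_image_mem_iff)
      then show "e \<in> (\<lambda>e. enc ` e) ` {e \<in> edges G. w \<in> e}" using e' by blast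
    qed
    moreover have fE: "finite {e \<in> edges G. w \<in> e}" using finite_edges[OF G] by simp
    ultimately have "card {e \<in> edges H. v \<in> e} \<le> card {e \<in> edges G. w \<in> e}"
      using surj_card_le by blast
    then show "card {e \<in> edges H. v \<in> e} \<le> 10" using deg[OF w(1)] by linarith
  next
    fix u v assume "{u, v} \<in> edges H"
    then obtain e where e: "e \<in> edges G" "{u, v} = enc ` e" by (auto simp: H_def)
    have "{dec u, dec v} = dec ` enc ` e" unfolding e(2)[symmetric] by simp
    also have "\<dots> = e" using eV(1)[OF e(1)] dec by (force simp: image_image)
    finally show "\<exists>c. sym_diff (X (dec u)) (X (dec v)) = {c}" using flip e(1) by simp
  next
    fix u k assume "u \<in> verts H"
    then obtain w where w: "w \<in> verts G" "u = enc w" by (auto simp: H_def)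
    have "{v \<in> verts H. card (sym_diff (X (dec u)) (X (dec v))) \<le> k}
        \<subseteq> enc ` {v \<in> verts G. card (sym_diff (X w) (X v)) \<le> k}"
    proof
      fix v assume v: "v \<in> {v \<in> verts H. card (sym_diff (X (dec u)) (X (dec v))) \<le> k}"
      then obtain v' where v': "v' \<in> verts G" "v = enc v'" by (auto simp: H_def)
      have "dec u = w" "dec v = v'" using w v' dec by auto
      then have "v' \<in> {v \<in> verts G. card (sym_diff (X w) (X v)) \<le> k}" using v v'(1) by simp
      then show "v \<in> enc ` {v \<in> verts G. card (sym_diff (X w) (X v)) \<le> k}" using v'(2) by blast
    qed
    moreover have "finite {v \<in> verts G. card (sym_diff (X w) (X v)) \<le> k}" using finV by simp
    ultimately have "card {v \<in> verts H. card (sym_diff (X (dec u)) (X (dec v))) \<le> k}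
        \<le> card {v \<in> verts G. card (sym_diff (X w) (X v)) \<le> k}"
      using surj_card_le by blast
    then show "card {v \<in> verts H. card (sym_diff (X (dec u)) (X (dec v))) \<le> k} \<le> 8 * 512 ^ k"
      using cnt[OF w(1), of k] by linarith
  qed
  then show ?thesis using simple by blast
qed

lemma provides_access_mono:
  assumes "provides_access q G L B F" "q \<le> q'"
  shows "provides_access q' G L B F"
  unfolding provides_access_def
proof (intro allI impI)
  fix es u v assume "(\<forall>(x, y)\<in>set es. {x, y} \<in> edges G) \<and> {u, v} \<in> edges G"
  then have "let c = B (history_after (neighbour_query G L) B es) (u, v) in
          (result (neighbour_query G L) c \<longleftrightarrow> {u, v} \<in> F) \<and>
          length (replies (neighbour_query G L) c) \<le> q"
    using assms(1) unfolding provides_access_def by blast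
  then show "let c = B (history_after (neighbour_query G L) B es) (u, v) in
          (result (neighbour_query G L) c \<longleftrightarrow> {u, v} \<in> F) \<and>
          length (replies (neighbour_query G L) c) \<le> q'"
    using assms(2) unfolding Let_def by linarith
qed

text \<open>Lets an algorithm with fewer queries be treated as one with exactly the budget
  \<open>q\<close> for which the graph is built.\<close>

lemma local_sparse_spanning_alg_mono:
  assumes alg: "local_sparse_spanning_alg \<epsilon> q C M A" and q: "q \<le> q'"
  shows "local_sparse_spanning_alg \<epsilon> q' C M A"
  unfolding local_sparse_spanning_alg_def
proof (intro conjI allI impI ballI, goal_cases)
  case 1
  then show ?case using alg by (simp add: local_sparse_spanning_alg_def)
next
  case (2 n d GL)
  obtain G L where GL: "GL = (G, L)" by (cases GL)
  show ?case unfolding GL prod.case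
  proof (intro impI)
    assume *: "simple_graph G \<and> verts G = {1..n} \<and> represents L G \<and> graph_connected G \<and>
      (\<forall>v\<in>verts G. vdegree G v \<le> d)"
    then obtain E' where E': "\<forall>\<omega>\<in>space M. E' \<omega> \<subseteq> edges G \<and>
        provides_access q G L (A n d \<omega>) (E' \<omega>) \<and> graph_connected (verts G, E' \<omega>)"
      "measure M {\<omega>\<in>space M. real (card (E' \<omega>)) < (1 + \<epsilon>) * real n} \<ge> 2 / 3"
      using alg 2 GL unfolding local_sparse_spanning_alg_def by blast
    have "\<forall>\<omega>\<in>space M. E' \<omega> \<subseteq> edges G \<and>
        provides_access q' G L (A n d \<omega>) (E' \<omega>) \<and> graph_connected (verts G, E' \<omega>)"
      using E'(1) provides_access_mono[OF _ q] by blast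
    then show "\<exists>E'. (\<forall>\<omega>\<in>space M. E' \<omega> \<subseteq> edges G \<and>
        provides_access q' G L (A n d \<omega>) (E' \<omega>) \<and> graph_connected (verts G, E' \<omega>)) \<and>
      measure M {\<omega>\<in>space M. real (card (E' \<omega>)) < (1 + \<epsilon>) * real n} \<ge> 2 / 3"
      using E'(2) by (intro exI[of _ E'] conjI)
  qed
qed

section \<open>Size estimates and the choice of parameters\<close>

context girth_graph
begin

lemma edges_le: "m \<le> 4 * card V"
proof -
  have "2 * m = (\<Sum>v\<in>V. card (nbrs E v))" using handshake[OF finV finE two] by simp
  also have "\<dots> \<le> (\<Sum>v\<in>V. 8)" by (rule sum_mono) (rule deg)
  finally show ?thesis by simp
qed

lemma fs_le: "fs \<le> 2 ^ m"
proof -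
  have "even_sets E \<subseteq> Pow E" by (auto simp: even_sets_def)
  then have "fs \<le> card (Pow E)" using finE by (intro card_mono) auto
  then show ?thesis by (simp add: card_Pow finE)
qed

text \<open>Density leaves a cycle space of size at least \<open>2 ^ (m - card V)\<close>, where
  \<open>m - card V \<ge> m / 2\<close>. It contains a nonempty even set, whose size is between
  \<open>g\<close> and \<open>m\<close>.\<close>

lemma fs_ge:
  assumes dense: "2 * card V \<le> m"
  shows "g \<le> m" "2 ^ (g div 2) \<le> fs"
proof -
  have r0: "0 < card V" using aV finV by (auto simp: card_gt_0_iff)
  have "2 ^ card V * 2 ^ (m - card V) = (2::nat) ^ m" using dense by (simp flip: power_add)
  also have "\<dots> \<le> 2 ^ card V * fs" by (rule many_even_sets[OF finV _ finE]) (use two in auto)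
  finally have F: "2 ^ (m - card V) \<le> fs" by simp
  have "(2::nat) ^ 1 \<le> 2 ^ (m - card V)" using dense r0 by (intro power_increasing) auto
  then have "2 \<le> fs" using F by simp
  have "\<exists>w\<in>even_sets E. w \<noteq> {}"
  proof (rule ccontr)
    assume "\<not> ?thesis"
    then have "even_sets E \<subseteq> {{}}" by blast
    then have "fs \<le> card {{} :: 'a set set}" by (intro card_mono) auto
    then show False using \<open>2 \<le> fs\<close> by simp
  qed
  then obtain w where w: "w \<subseteq> E" "odd_verts w = {}" "w \<noteq> {}" by (auto simp: even_sets_def)
  then have "g \<le> card w" using girth unfolding girth_ge_def by blast
  then show gm: "g \<le> m" using card_mono[OF finE w(1)] by linarith
  have "(2::nat) ^ (g div 2) \<le> 2 ^ (m - card V)" using dense gm by (intro power_increasing) auto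
  then show "2 ^ (g div 2) \<le> fs" using F by linarith
qed

end

text \<open>Here \<open>T = J * m * F\<close> counts the edges of the undamaged copies,
  \<open>K\<close> is \<open>256 ^ q\<close>, and \<open>W\<close> bounds the vertices near
  irregular ones. Density gives \<open>n \<le> T / 2\<close>, so dropping down to
  \<open>3/2 * n\<close> edges loses at least \<open>T / 4\<close> of them, which is too many unless
  \<open>W\<close> is large.\<close>

lemma numeric_contradiction:
  fixes m r F J K W n q s b N :: real
  assumes pos: "m > 0" "F > 0" "J > 0" "K \<ge> 1" "W \<ge> 0" "q \<ge> 0" "r > 0"
    and mr: "2 * r \<le> m" "m \<le> 4 * r" and qm: "q \<le> m" and n: "n = J * r * F" and qn: "4 * q + 4 \<le> n"
    and W: "W = (2 * m * F + J) * (4 * K)"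
    and s: "J * m * F - 2 * m * W \<le> s" "s \<le> J * m * F" and b: "0 \<le> b" "b \<le> 2 * W"
    and JK: "J \<ge> 3500 * K * m" and FK: "F \<ge> 1700 * K"
    and main: "2 / 3 * (s - 3 / 2 * n) \<le> s * (q * (b / (n - (2 * q + 2))))"
  shows False
proof -
  define T where "T = J * m * F"
  have T0: "T > 0" using pos by (simp add: T_def)
  have JF: "J * F > 0" using pos by simp
  have "J * F * (2 * r) \<le> J * F * m" using mr(1) JF by (intro mult_left_mono) auto
  then have nT: "2 * n \<le> T" by (simp add: n T_def mult_ac)
  have "J * F * m \<le> J * F * (4 * r)" using mr(2) JF by (intro mult_left_mono) auto
  then have Tn: "T \<le> 4 * n" by (simp add: n T_def mult_ac)
  have den: "n - (2 * q + 2) \<ge> T / 8" using Tn qn by linarith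
  have "b / (n - (2 * q + 2)) \<le> 2 * W / (T / 8)"
    using b den T0 by (intro frac_le) auto
  then have "s * (q * (b / (n - (2 * q + 2)))) \<le> T * (q * (2 * W / (T / 8)))"
  proof -
    assume le: "b / (n - (2 * q + 2)) \<le> 2 * W / (T / 8)"
    have "0 \<le> b / (n - (2 * q + 2))" using b den T0 by (intro divide_nonneg_nonneg) linarith+
    then have 0: "0 \<le> q * (b / (n - (2 * q + 2)))" by (rule mult_nonneg_nonneg[OF pos(6)])
    have "s * (q * (b / (n - (2 * q + 2)))) \<le> T * (q * (b / (n - (2 * q + 2))))"
      using s(2) 0 by (intro mult_right_mono) (simp_all add: T_def)
    also have "\<dots> \<le> T * (q * (2 * W / (T / 8)))"
      using le pos T0 by (intro mult_left_mono) auto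
    finally show ?thesis .
  qed
  also have "\<dots> = 16 * (q * W)" using T0 by simp
  also have "\<dots> \<le> 16 * (m * W)" using qm pos by (intro mult_left_mono mult_right_mono) auto
  finally have "2 / 3 * (s - 3 / 2 * n) \<le> 16 * (m * W)" using main by linarith
  moreover have "s \<ge> T - 2 * (m * W)" using s(1) by (simp add: T_def mult_ac)
  \<comment> \<open>Inserting \<open>n \<le> T / 2\<close> gives
    \<open>T / 6 \<le> (16 + 4 / 3) * P\<close>, and \<open>104 = 6 * (16 + 4 / 3)\<close>.\<close>
  moreover have "T \<le> 104 * P" if "2 / 3 * (s - 3 / 2 * n) \<le> 16 * P" "s \<ge> T - 2 * P" for P
    using that nT by simp
  ultimately have "T \<le> 104 * (m * W)" by blast
  then have "m * (J * F) \<le> m * (104 * W)" by (simp add: T_def mult_ac)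
  then have le: "J * F \<le> 104 * W" using pos(1) by simp
  have "3500 * K * m * F \<le> J * F" using JK pos by (intro mult_right_mono) auto
  moreover have "J * (1700 * K) \<le> J * F" using FK pos by (intro mult_left_mono) auto
  moreover have "104 * W = 832 * (K * m * F) + 416 * (J * K)" unfolding W by (simp add: algebra_simps)
  moreover have "K * m * F > 0" using pos by simp
  moreover have "J * K > 0" using pos by simp
  moreover have "3500 * K * m * F = 3500 * (K * m * F)" "J * (1700 * K) = 1700 * (J * K)" by simp_all
  ultimately show False using le by linarith
qed

text \<open>Up to a constant, the spoiled fraction of the edges is \<open>256 ^ q\<close> times
  \<open>m / J + 1 / fs\<close>. The first term comes from deleted lifts and is small by
  \<open>J = m * 8 ^ g\<close>; the second comes from connectors and is small by
  \<open>fs \<ge> 2 ^ (g div 2)\<close>. Both beat \<open>256 ^ q\<close> since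
  \<open>q \<le> g / 1000\<close>.\<close>

lemma (in pieces) no_algorithm:
  assumes enc: "inj_on enc VV"
    and alg: "local_sparse_spanning_alg (1 / 2) q (isomorphic_family (enc ` VV, (\<lambda>e. enc ` e) ` GE)) M A"
    and dense: "2 * card V \<le> m" and J8: "J = m * 8 ^ g"
    and g1000: "g \<ge> 10000" and qg: "1000 * q \<le> g"
  shows False
proof -
  let ?r = "card V" and ?n = "card VV"
  define W where "W = (2 * m * fs + J) * (4 * 256 ^ q)"
  have gm: "g \<le> m" and Fg: "2 ^ (g div 2) \<le> fs" using fs_ge[OF dense] by auto
  have r0: "0 < ?r" using aV finV by (auto simp: card_gt_0_iff)
  have K: "(4096::nat) * 256 ^ q \<le> 2 ^ (g div 2)"
  proof -
    have "(4096::nat) * 256 ^ q = 2 ^ (12 + 8 * q)" by (simp add: power_add power_mult)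
    also have "\<dots> \<le> 2 ^ (g div 2)" using g1000 qg by (intro power_increasing) auto
    finally show ?thesis .
  qed
  also have "(2::nat) ^ (g div 2) \<le> 2 ^ (3 * g)" by (intro power_increasing) auto
  finally have K': "(4096::nat) * 256 ^ q \<le> 8 ^ g" by (simp add: power_mult)
  have F0: "fs > 0" using Fg by (metis less_le_trans zero_less_numeral zero_less_power)
  have n: "?n = J * ?r * fs" by (rule card_VV)
  have "J \<le> J * ?r * fs" using r0 F0 by simp
  then have nJ: "J \<le> ?n" using n by simp
  have "8 ^ g \<le> J" unfolding J8 using gm g1000 by simp
  moreover have "8 * g \<le> 8 ^ g"
  proof -
    have "g - 1 < 8 ^ (g - 1)" by (rule power_gt_expt) simp
    then have "8 * g \<le> 8 * 8 ^ (g - 1)" by simp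
    also have "\<dots> = 8 ^ g" using g1000 by (simp flip: power_Suc)
    finally show ?thesis .
  qed
  ultimately have nq: "4 * q + 4 \<le> ?n" "2 * q + 2 < ?n" using nJ qg g1000 by linarith+
  have irr: "card irr * (4 * 256 ^ q) \<le> W" unfolding W_def by (rule mult_le_mono1[OF card_irr])
  have near: "card (near irr q) \<le> W" using card_near[OF irr_VV, of q] irr by linarith
  define b where "b = 2 * card irr * (4 * 256 ^ q)"
  have b: "b \<le> 2 * W" using irr unfolding b_def by linarith
  have main: "2 / 3 * (real (card forced) - 3 / 2 * real (card (verts GG)))
      \<le> card forced * (q * (b / (card (verts GG) - (2 * q + 2))))"
  proof (rule query_lower_bound[OF simple_GG connected_GG])
    show "inj_on enc (verts GG)" using enc by simp
    show "local_sparse_spanning_alg (1 / 2) q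
        (isomorphic_family (enc ` verts GG, (\<lambda>e. enc ` e) ` edges GG)) M A" using alg by simp
    show "2 * q + 2 < card (verts GG)" using nq by simp
    show "forced \<subseteq> edges GG" using forced_GE by simp
    show "bridge_like GG q b e" if "e \<in> forced" for e
      using forced_bridge_like[OF that] by (simp add: b_def)
  qed
  have s: "J * m * fs \<le> card forced + 2 * m * W"
    using card_forced(2) near mult_le_mono2[OF near, of "2 * m"] by linarith
  show False
  proof (rule numeric_contradiction[of "real m" "real fs" "real J" "256 ^ q" "real W" "real q" "real ?r" "real ?n" "real (card forced)" "real b"])
    show "real J * real m * real fs - 2 * real m * real W \<le> real (card forced)"
    proof -
      have "real J * real m * real fs \<le> real (card forced) + 2 * real m * real W"
        using s by (simp only: of_nat_le_iff[symmetric, where 'a = real] of_nat_add of_nat_mult of_nat_numeral)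
      then show ?thesis by linarith
    qed
    show "real W = (2 * real m * real fs + real J) * (4 * 256 ^ q)" by (simp add: W_def)
    show "real (card forced) \<le> real J * real m * real fs"
      using card_forced(1) by (simp only: of_nat_le_iff[symmetric, where 'a = real] of_nat_mult)
    show "3500 * 256 ^ q * real m \<le> real J"
    proof -
      have "3500 * 256 ^ q * m \<le> J" unfolding J8 using K' by (simp add: mult.commute)
      then show ?thesis by (simp only: of_nat_le_iff[symmetric, where 'a = real] of_nat_mult of_nat_power of_nat_numeral)
    qed
    show "1700 * 256 ^ q \<le> real fs"
    proof -
      have "1700 * 256 ^ q \<le> fs" using K Fg by linarith
      then show ?thesis by (simp only: of_nat_le_iff[symmetric, where 'a = real] of_nat_mult of_nat_power of_nat_numeral)
    qed
    show "2 / 3 * (real (card forced) - 3 / 2 * real ?n) \<le> real (card forced) * (real q * (real b / (real ?n - (2 * real q + 2))))"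
      using main nq by (simp add: of_nat_diff add.commute)
    show "real b \<le> 2 * real W" using b by (simp only: of_nat_le_iff[symmetric, where 'a = real] of_nat_mult of_nat_numeral)
    show "4 * real q + 4 \<le> real ?n" using nq by linarith
    show "real ?n = real J * real ?r * real fs" using n by (simp only: of_nat_mult)
  qed (use gm g1000 F0 J r0 dense edges_le qg in auto)
qed

text \<open>The size is dominated by \<open>fs \<le> 2 ^ m\<close>, where
  \<open>m \<le> 4 * card V \<le> 2 ^ (3 * g + 3)\<close>; the remaining factors are absorbed by one
  more doubling of the exponent.\<close>

lemma (in pieces) log_log_card_VV:
  assumes J8: "J = m * 8 ^ g" and dense: "2 * card V \<le> m"
  shows "log 2 (log 2 (card VV)) \<le> 3 * g + 4"
proof -
  have r0: "0 < card V" using aV finV by (auto simp: card_gt_0_iff)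
  have mb: "m \<le> 2 ^ (3 * g + 3)" using edges_le cardV by (simp add: power_add power_mult)
  have "card VV = m * 8 ^ g * card V * fs" using card_VV J8 by simp
  also have "\<dots> \<le> 2 ^ (3 * g + 3) * 8 ^ g * (2 * 8 ^ g) * 2 ^ m"
    using mb cardV fs_le by (intro mult_le_mono) auto
  also have "\<dots> = 2 ^ (9 * g + 4 + m)" by (simp add: power_add power_mult) (simp flip: power_mult_distrib)
  also have "\<dots> \<le> 2 ^ (2 ^ (3 * g + 4))"
  proof (rule power_increasing)
    have "g < 2 ^ g" by (rule less_exp)
    then have "9 * g + 4 \<le> 16 * 2 ^ g" by linarith
    also have "\<dots> = 2 ^ (g + 4)" by (simp add: power_add)
    also have "\<dots> \<le> 2 ^ (3 * g + 3)" using g2 by (intro power_increasing) auto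
    finally have "9 * g + 4 + m \<le> 2 ^ (3 * g + 3) + 2 ^ (3 * g + 3)" using mb by linarith
    then show "9 * g + 4 + m \<le> 2 ^ (3 * g + 4)" by (simp add: power_add)
  qed simp
  finally have "card VV \<le> 2 ^ (2 ^ (3 * g + 4))" .
  then have le: "real (card VV) \<le> 2 ^ (2 ^ (3 * g + 4))"
    by (metis of_nat_le_iff of_nat_numeral of_nat_power)
  have F0: "fs > 0" using fs_ge(2)[OF dense] by (metis less_le_trans zero_less_numeral zero_less_power)
  have "2 ^ 1 \<le> (8::nat) ^ g" using g2 power_increasing[of 1 g "8::nat"] by simp
  moreover have "8 ^ g \<le> card VV"
    using card_VV J8 dense r0 F0 by simp
  ultimately have two: "2 \<le> card VV" by simp
  have l1: "log 2 (card VV) \<le> 2 ^ (3 * g + 4)"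
  proof -
    have "log 2 (card VV) \<le> log 2 (2 ^ (2 ^ (3 * g + 4)))"
      using le two by (subst log_le_cancel_iff) auto
    also have "\<dots> = 2 ^ (3 * g + 4)" by (simp add: log_nat_power)
    finally show ?thesis .
  qed
  have "log 2 2 \<le> log 2 (real (card VV))" using two by (subst log_le_cancel_iff) auto
  then have "1 \<le> log 2 (card VV)" by simp
  then have "log 2 (log 2 (card VV)) \<le> log 2 (2 ^ (3 * g + 4))"
    using l1 by (subst log_le_cancel_iff) auto
  also have "\<dots> = real (3 * g + 4)" by (subst log_nat_power) auto
  finally show ?thesis by simp
qed

text \<open>The graph is built for the budget \<open>q = g div 1000\<close>. The double logarithm of
  its size is at most \<open>3 * g + 4\<close>, so a budget \<open>q'\<close> below one 8000th of it
  satisfies \<open>q' \<le> q\<close>; the gap between \<open>3 * g / 8000\<close> and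
  \<open>g / 1000\<close> absorbs the rounding once \<open>g \<ge> 10000\<close>.\<close>

lemma hard_graph:
  fixes g :: nat
  assumes g: "g \<ge> 10000"
  shows "\<exists>n\<ge>g. \<exists>G :: nat ugraph. simple_graph G \<and> card (verts G) = n \<and>
     non_expanding (\<lambda>x. 1 / log 2 x * (70 * log 2 (log 2 x))\<^sup>2) G \<and>
     (\<forall>q M A. local_sparse_spanning_alg (1 / 2) q (isomorphic_family G) M A \<longrightarrow>
        real q \<ge> log 2 (log 2 (real n)) / 8000)"
proof -
  obtain V :: "nat set" and E where VE: "finite V" "V \<noteq> {}" "\<forall>e\<in>E. card e = 2 \<and> e \<subseteq> V" "girth_ge g E"
    "\<And>v. card (nbrs E v) \<le> 8" "card V \<le> 2 * 8 ^ g" "2 * card V \<le> card E"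
    "\<forall>A\<subset>V. A \<noteq> {} \<longrightarrow> 2 \<le> card (crossing E A)"
    using base_graph_exists[of g] g by auto
  then obtain a where a: "a \<in> V" by blast
  interpret girth_graph V E g a
    by unfold_locales (use VE a g in auto)
  define q where "q = g div 1000"
  define J where "J = m * 8 ^ g"
  have gm: "g \<le> m" and Fg: "2 ^ (g div 2) \<le> fs" using fs_ge[OF VE(7)] by auto
  obtain h where h: "bij_betw h {..<m} E"
    using ex_bij_betw_nat_finite[OF finE] by (auto simp: atLeast0LessThan)
  have "\<exists>u v. h i = {u, v}" if "i < m" for i
  proof -
    have "h i \<in> E" using h that by (auto simp: bij_betw_def)
    then show ?thesis using two card_2_iff by metis
  qed
  then obtain ea eb where e: "\<And>i. i < m \<Longrightarrow> h i = {ea i, eb i}" by metis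
  have lab: "bij_betw (\<lambda>i. {ea i, eb i}) {..<m} E"
    using h e by (subst bij_betw_cong[of _ _ h]) auto
  have room: "4 * 256 ^ (q + 1) < fs"
  proof -
    have "(4::nat) * 256 ^ (q + 1) = 2 ^ (10 + 8 * q)" by (simp add: power_add power_mult)
    also have "\<dots> < 2 ^ (g div 2)" using g by (intro power_strict_increasing) (auto simp: q_def)
    finally show ?thesis using Fg by linarith
  qed
  have "\<exists>x\<in>fib (ea i). q + 1 < card x" if "i < m" for i
  proof -
    have "{ea i, eb i} \<in> E" using lab that by (auto simp: bij_betw_def)
    then show ?thesis using heavy_in_fibre[OF _ room] two by blast
  qed
  then obtain xs where xs: "\<And>i. i < m \<Longrightarrow> xs i \<in> fib (ea i) \<and> q + 1 < card (xs i)" by metis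
  interpret pieces V E g a J q ea eb xs
    by unfold_locales (use lab xs gm g in \<open>auto simp: J_def q_def\<close>)
  obtain enc :: "_ \<Rightarrow> nat" where "bij_betw enc VV {0..<card VV}"
    using ex_bij_betw_finite_nat[OF finVV] by blast
  then have enc: "inj_on enc VV" by (auto simp: bij_betw_def)
  let ?G = "(enc ` VV, (\<lambda>e. enc ` e) ` GE)"
  have ne: "simple_graph ?G \<and> non_expanding (\<lambda>x. 1 / log 2 x * (70 * log 2 (log 2 x))\<^sup>2) ?G"
    using non_expanding_image[of GG enc coords] simple_GG enc finite_coords coords_flip degree_GG card_coords_ball
    by simp
  have low: "real q' \<ge> log 2 (log 2 (real (card VV))) / 8000"
    if alg: "local_sparse_spanning_alg (1 / 2) q' (isomorphic_family ?G) M A" for q' M A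
  proof (rule ccontr)
    assume "\<not> ?thesis"
    then have "8000 * real q' < 3 * real g + 4" using log_log_card_VV[OF J_def VE(7)] by linarith
    then have "q' \<le> q" using g unfolding q_def by linarith
    then have "local_sparse_spanning_alg (1 / 2) q (isomorphic_family ?G) M A"
      using local_sparse_spanning_alg_mono[OF alg] by blast
    then show False using no_algorithm[OF enc _ VE(7) J_def g] by (auto simp: q_def)
  qed
  have "g \<le> card VV"
  proof -
    have "0 < fs" using Fg by (metis less_le_trans zero_less_numeral zero_less_power)
    moreover have "0 < card V" using VE by (simp add: card_gt_0_iff)
    ultimately have "J \<le> J * card V * fs" by simp
    then have "J \<le> card VV" using card_VV by simp
    moreover have "m \<le> J" by (simp add: J_def)
    ultimately have "m \<le> card VV" by linarith
    then show ?thesis using gm by linarith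
  qed
  then show ?thesis
  proof (intro exI[of _ "card VV"] conjI exI[of _ ?G])
    show "card (verts ?G) = card VV" using card_image[OF enc] by simp
  qed (use ne low in blast)+
qed

theorem theorem4p1:
  "infinite {n :: nat. \<exists>G :: nat ugraph.
     simple_graph G \<and> card (verts G) = n \<and>
     non_expanding (\<lambda>x. 1 / log 2 x * (70 * log 2 (log 2 x))\<^sup>2) G \<and>
     (\<forall>q M A. local_sparse_spanning_alg (1 / 2) q (isomorphic_family G) M A \<longrightarrow>
        real q \<ge> log 2 (log 2 (real n)) / 8000)}"
  unfolding infinite_nat_iff_unbounded_le mem_Collect_eq
proof (rule allI, goal_cases)
  case (1 k)
  have "k \<le> n" if "max k 10000 \<le> n" for n using that by simp
  with hard_graph[OF max.cobounded2, of k] show ?case by blast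
qed

end
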